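(* For every $\lambda\in\Lambda$, the polynomial $R_\lambda(z;r)$ is an eigenvector of both $X(t)$ and $Y(t)$. More precisely, $$X(t)R_\lambda=\prod_{1\le i\le n,\ i\text{ odd}}(t+\rho_i+\lambda_i)\cdot R_\lambda,\qquad Y(t)R_\lambda=\prod_{1\le i\le n,\ i\text{ even}}(t+\rho_i+\lambda_i)\cdot R_\lambda .$$
   Context: Let $k$ be a field of characteristic zero, $n\ge 1$, $\mathcal P=k[z_1,\dots,z_n]$, and let $W\subseteq S_n$ be the group of permutations $\pi$ with $\pi(i)\equiv i \bmod 2$ for all $i$, acting by permuting variables; $\mathcal P^W$ is the ring of semisymmetric polynomials. Put $\underline n=\lfloor n/2\rfloor$, $\overline n=\lceil n/2\rceil$. $\Lambda$ is the set of integer tuples $\lambda=(\lambda_1\ge\dots\ge\lambda_n\ge 0)$ and $|\lambda|_{\rm odd}=\sum_{i\text{ odd}}\lambda_i$. Fix $r\in k$ which is not a negative rational number and put $\rho=((n-1)r,(n-2)r,\dots,r,0)$, i.e. $\rho_i=(n-i)r$. For $\lambda\in\Lambda$ let $[\lambda]\in\mathbb N^n$ be given by $[\lambda]_m=\lambda_m-\lambda_{m+1}+\dots+(-1)^{n-m}\lambda_n$. $R_\lambda(z)=R_\lambda(z;r)\in\mathcal P^W$ is the unique semisymmetric polynomial of degree $|\lambda|_{\rm odd}$ which satisfies $R_\lambda(\rho+\mu)=0$ for all $\mu\in\Lambda$ with $|\mu|_{\rm odd}\le|\lambda|_{\rm odd}$, $\mu\ne\lambda$, and in which the monomial $z^{[\lambda]}$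 has coefficient $1$ (it is known that this exists and is unique). Difference operators: let $\epsilon_i$ be the $i$-th standard basis vector and $(T_if)(z)=f(z-\epsilon_i)$. Write $x_i=z_{2i-1}$, $T_{x,i}=T_{2i-1}$ ($1\le i\le\overline n$) and $y_i=z_{2i}$, $T_{y,i}=T_{2i}$ ($1\le i\le\underline n$); $t$ is an indeterminate. Let $\mathfrak X(t)$ and $\mathfrak Y(t)$ be the $n\times n$ block matrices of difference operators $$\mathfrak X(t)=\begin{pmatrix}\big[(x_i+t)(x_i+r)^{\overline n-j}-x_i^{\overline n+1-j}T_{x,i}\big]_{i\le\overline n,\,j\le\overline n}&\big[-x_i^{\overline n-j}T_{x,i}\big]_{i\le\overline n,\,j\le\underline n}\\ \big[(y_i+r)^{\underline n+1-j}-y_i^{\underline n+1-j}T_{y,i}\big]_{i\le\underline n,\,j\le\overline n}&\big[(y_i+r)^{\underline n-j}\big]_{i\le\underline n,\,j\le\underline n}\end{pmatrix},$$ $$\mathfrak Y(t)=\begin{pmatrix}\big[(x_i+r)^{\overline n-j}\big]_{i\le\overline n,\,j\le\overline n}&\big[(x_i+r)^{\overline n-j}-x_i^{\overline n-j}T_{x,i}\big]_{i\le\overline n,\,j\le\underline n}\\ \big[-y_i^{\underline n+1-j}T_{y,i}\big]_{i\le\underline n,\,j\le\overline n}&\big[(y_i+t)(y_i+r)^{\underline n-j}-y_i^{\underline n+1-j}T_{y,i}\big]_{i\le\underline n,\,j\le\underline n}\end{pmatrix}$$ (row index $i$, column index $j$, both starting at $1$ in each block). Entries in different rows commute, so determinants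 are well defined. Let $\varphi(z)=\prod_{1\le i<j\le n,\ j-i\text{ even}}(z_i-z_j)$ and $X(t)=\varphi(z)^{-1}\det\mathfrak X(t)$, $Y(t)=\varphi(z)^{-1}\det\mathfrak Y(t)$. These operators map $\mathcal P^W$ to $\mathcal P^W[t]$. *)

theory Defs
  imports
    "HOL-Library.Poly_Mapping"
    "HOL-Computational_Algebra.Computational_Algebra"
    "HOL-Combinatorics.Permutations"
begin

text \<open>
  Polynomials in the variables \<open>z\<^sub>0, z\<^sub>1, z\<^sub>2, \<dots>\<close>: finitely supported functions from exponent
  vectors to coefficients, with the convolution product of \<^theory>\<open>HOL-Library.Poly_Mapping\<close>.
  The ring \<open>k[z\<^sub>1, \<dots>, z\<^sub>n]\<close> is the subset \<open>polys n\<close> below. An element of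
  \<open>k[z\<^sub>1, \<dots>, z\<^sub>n][t]\<close> is a univariate polynomial (in \<open>t\<close>) over this ring.
\<close>

type_synonym 'k mpol = "(nat \<Rightarrow>\<^sub>0 nat) \<Rightarrow>\<^sub>0 'k"

definition Const :: "'k::zero \<Rightarrow> 'k mpol" where
  "Const c = Poly_Mapping.single 0 c"

definition Var :: "nat \<Rightarrow> 'k::zero_neq_one mpol" where
  "Var i = Poly_Mapping.single (Poly_Mapping.single i 1) 1"

text \<open>\<open>subst_hom h a p\<close> applies \<open>h\<close> to the coefficients of \<open>p\<close> and replaces each \<open>z\<^sub>i\<close> by \<open>a i\<close>.\<close>

definition subst_hom ::
    "('k::comm_ring_1 \<Rightarrow> 'b::comm_ring_1) \<Rightarrow> (nat \<Rightarrow> 'b) \<Rightarrow> 'k mpol \<Rightarrow> 'b" where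
  "subst_hom h a p =
     (\<Sum>m\<in>Poly_Mapping.keys p. h (Poly_Mapping.lookup p m) *
        (\<Prod>i\<in>Poly_Mapping.keys m. a i ^ Poly_Mapping.lookup m i))"

definition eval_at :: "(nat \<Rightarrow> 'k::comm_ring_1) \<Rightarrow> 'k mpol \<Rightarrow> 'k" where
  "eval_at a p = subst_hom (\<lambda>c. c) a p"

definition substitute :: "(nat \<Rightarrow> 'k mpol) \<Rightarrow> 'k::comm_ring_1 mpol \<Rightarrow> 'k mpol" where
  "substitute a p = subst_hom Const a p"

definition mdegree :: "(nat \<Rightarrow>\<^sub>0 nat) \<Rightarrow> nat" where
  "mdegree m = (\<Sum>i\<in>Poly_Mapping.keys m. Poly_Mapping.lookup m i)"

text \<open>The total degree; the zero polynomial gets degree 0.\<close>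

definition total_degree :: "'k::zero mpol \<Rightarrow> nat" where
  "total_degree p = Max (insert 0 (mdegree ` Poly_Mapping.keys p))"

definition polys :: "nat \<Rightarrow> 'k::zero mpol set" where
  "polys n = {p. \<forall>m\<in>Poly_Mapping.keys p. Poly_Mapping.keys m \<subseteq> {1..n}}"

definition semisym_group :: "nat \<Rightarrow> (nat \<Rightarrow> nat) set" where
  "semisym_group n = {\<pi>. \<pi> permutes {1..n} \<and> (\<forall>i\<in>{1..n}. \<pi> i mod 2 = i mod 2)}"

definition semisymmetric :: "nat \<Rightarrow> 'k::comm_ring_1 mpol set" where
  "semisymmetric n =
     {p \<in> polys n. \<forall>\<pi>\<in>semisym_group n. substitute (\<lambda>i. Var (\<pi> i)) p = p}"

text \<open>Tuples are indexed by \<open>{1..n}\<close> and extended by 0, so that equality is equality of tuples.\<close>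

definition Partitions :: "nat \<Rightarrow> (nat \<Rightarrow> nat) set" where
  "Partitions n =
     {l. (\<forall>i\<in>{1..<n}. l (Suc i) \<le> l i) \<and> (\<forall>i. i \<notin> {1..n} \<longrightarrow> l i = 0)}"

definition odd_size :: "nat \<Rightarrow> (nat \<Rightarrow> nat) \<Rightarrow> nat" where
  "odd_size n l = (\<Sum>i\<in>{i\<in>{1..n}. odd i}. l i)"

definition rho :: "nat \<Rightarrow> 'k::comm_ring_1 \<Rightarrow> nat \<Rightarrow> 'k" where
  "rho n r i = of_nat (n - i) * r"

text \<open>
  The exponent vector \<open>[\<lambda>]\<close>. For \<open>l \<in> Partitions n\<close> the alternating sums are nonnegative,
  so \<^const>\<open>nat\<close> does not truncate.
\<close>

definition bracket :: "nat \<Rightarrow> (nat \<Rightarrow> nat) \<Rightarrow> (nat \<Rightarrow>\<^sub>0 nat)" where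
  "bracket n l =
     (\<Sum>m = 1..n. Poly_Mapping.single m (nat (\<Sum>j = m..n. (-1) ^ (j - m) * int (l j))))"

text \<open>\<open>is_R n r l R\<close>: the polynomial \<open>R\<close> has the properties that characterise \<open>R\<^sub>\<lambda>(z; r)\<close>.\<close>

definition is_R :: "nat \<Rightarrow> 'k::comm_ring_1 \<Rightarrow> (nat \<Rightarrow> nat) \<Rightarrow> 'k mpol \<Rightarrow> bool" where
  "is_R n r l R \<longleftrightarrow>
     R \<in> semisymmetric n \<and>
     total_degree R = odd_size n l \<and>
     (\<forall>m\<in>Partitions n. odd_size n m \<le> odd_size n l \<and> m \<noteq> l \<longrightarrow>
        eval_at (\<lambda>i. rho n r i + of_nat (m i)) R = 0) \<and>
     Poly_Mapping.lookup R (bracket n l) = 1"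

text \<open>
  Difference operators are represented as maps on \<open>k[z][t]\<close>; the product of operators is
  composition. \<open>shift i\<close> is \<open>T\<^sub>i\<close>, which fixes \<open>t\<close>.
\<close>

definition shift :: "nat \<Rightarrow> 'k::comm_ring_1 mpol poly \<Rightarrow> 'k mpol poly" where
  "shift i = map_poly (substitute (\<lambda>j. if j = i then Var j - 1 else Var j))"

text \<open>
  Determinant of an \<open>n \<times> n\<close> matrix of operators, by the Leibniz formula. The factors of each term
  come from different rows and are composed in the order of the rows.
\<close>

definition op_det ::
    "nat \<Rightarrow> (nat \<Rightarrow> nat \<Rightarrow> 'b \<Rightarrow> 'b) \<Rightarrow> 'b \<Rightarrow> 'b::comm_ring_1" where
  "op_det n A f =
     (\<Sum>\<sigma> | \<sigma> permutes {1..n}.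
        of_int (sign \<sigma>) * foldr (\<lambda>a F. A a (\<sigma> a) \<circ> F) [1..<Suc n] id f)"

text \<open>
  In the matrices below, \<open>N\<close> and \<open>M\<close> are the ceiling and the floor of \<open>n/2\<close>. Rows and columns are
  numbered \<open>1, \<dots>, n\<close> throughout, so row (column) \<open>a > N\<close> is row (column) \<open>a - N\<close> of a lower
  (right) block. In row \<open>a\<close>, \<open>v\<close> is the variable \<open>x\<^sub>i = z\<^sub>2\<^sub>i\<^sub>-\<^sub>1\<close> or \<open>y\<^sub>i = z\<^sub>2\<^sub>i\<close>, \<open>w\<close> is \<open>v + r\<close>
  and \<open>T\<close> is the shift in \<open>v\<close>. No subtraction in an exponent truncates.
\<close>

definition matX :: "nat \<Rightarrow> 'k::comm_ring_1 \<Rightarrow> nat \<Rightarrow> nat \<Rightarrow> 'k mpol poly \<Rightarrow> 'k mpol poly" where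
  "matX n r a b f =
    (let N = (n + 1) div 2; M = n div 2; t = [:0, 1:] in
     if a \<le> N then
       (let i = a; v = [:Var (2 * i - 1):]; w = v + [:Const r:]; T = shift (2 * i - 1) in
        if b \<le> N then
          (let j = b in (v + t) * w ^ (N - j) * f - v ^ (N + 1 - j) * T f)
        else
          (let j = b - N in - (v ^ (N - j) * T f)))
     else
       (let i = a - N; v = [:Var (2 * i):]; w = v + [:Const r:]; T = shift (2 * i) in
        if b \<le> N then
          (let j = b in w ^ (M + 1 - j) * f - v ^ (M + 1 - j) * T f)
        else
          (let j = b - N in w ^ (M - j) * f)))"

definition matY :: "nat \<Rightarrow> 'k::comm_ring_1 \<Rightarrow> nat \<Rightarrow> nat \<Rightarrow> 'k mpol poly \<Rightarrow> 'k mpol poly" where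
  "matY n r a b f =
    (let N = (n + 1) div 2; M = n div 2; t = [:0, 1:] in
     if a \<le> N then
       (let i = a; v = [:Var (2 * i - 1):]; w = v + [:Const r:]; T = shift (2 * i - 1) in
        if b \<le> N then
          (let j = b in w ^ (N - j) * f)
        else
          (let j = b - N in w ^ (N - j) * f - v ^ (N - j) * T f))
     else
       (let i = a - N; v = [:Var (2 * i):]; w = v + [:Const r:]; T = shift (2 * i) in
        if b \<le> N then
          (let j = b in - (v ^ (M + 1 - j) * T f))
        else
          (let j = b - N in (v + t) * w ^ (M - j) * f - v ^ (M + 1 - j) * T f)))"

definition varphi :: "nat \<Rightarrow> 'k::comm_ring_1 mpol" where
  "varphi n = (\<Prod>(i, j)\<in>{(i, j). 1 \<le> i \<and> i < j \<and> j \<le> n \<and> even (j - i)}. Var i - Var j)"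

text \<open>
  \<open>X(t)\<close> and \<open>Y(t)\<close> map a polynomial \<open>f\<close> to an element of \<open>k(z)[t]\<close>: the determinant is applied to
  \<open>f\<close> and the coefficients of the powers of \<open>t\<close> are divided by \<open>\<phi>\<close> in the fraction field. The ring
  \<open>k[z][t]\<close> embeds into \<open>k(z)[t]\<close> by \<open>to_frac\<close>.
\<close>

definition to_frac :: "'k::field mpol poly \<Rightarrow> 'k mpol fract poly" where
  "to_frac = map_poly (\<lambda>c. Fract c 1)"

definition opX :: "nat \<Rightarrow> 'k::field \<Rightarrow> 'k mpol \<Rightarrow> 'k mpol fract poly" where
  "opX n r f = smult (inverse (Fract (varphi n) 1)) (to_frac (op_det n (matX n r) [:f:]))"

definition opY :: "nat \<Rightarrow> 'k::field \<Rightarrow> 'k mpol \<Rightarrow> 'k mpol fract poly" where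
  "opY n r f = smult (inverse (Fract (varphi n) 1)) (to_frac (op_det n (matY n r) [:f:]))"

end

theory Submission
  imports Defs "Jordan_Normal_Form.Determinant"
begin

text \<open>
  Expanding the rows of the matrices writes \<open>\<phi> X(t)\<close> and \<open>\<phi> Y(t)\<close> as \<open>\<Sum>\<^sub>S c\<^sub>S T\<^sub>S\<close>, where
  \<open>T\<^sub>S\<close> shifts the variables in \<open>S\<close> and \<open>c\<^sub>S\<close> is an ordinary determinant
  (\<open>det_op_expansion\<close>). Three properties of these determinants make \<open>R\<^sub>\<lambda>\<close> an eigenvector.

  \<^item> At \<open>z = \<rho> + \<mu>\<close> the coefficient \<open>c\<^sub>S\<close> vanishes unless \<open>\<mu>\<close> minus the indicator of \<open>S\<close> is
    again a partition, because otherwise one row is 0 or two rows are proportional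
    (\<open>coef_matrix_cutoff\<close>).
  \<^item> \<open>c\<^sub>S = 0\<close> if \<open>S\<close> is nonempty and contains only even variables, that is, if the shift does
    not change \<open>|\<mu>|\<^sub>o\<^sub>d\<^sub>d\<close> (\<open>coef_matrix_even_shifts\<close>).
  \<^item> \<open>c\<^sub>\<emptyset>\<close> is \<open>\<phi>\<close> times the product of the \<open>z\<^sub>i + t\<close> over the odd \<open>i\<close> for \<open>X\<close>, and over the
    even \<open>i\<close> for \<open>Y\<close> (\<open>coef_matrix_no_shift\<close>).

  Hence \<open>\<phi> X(t) R\<^sub>\<lambda>\<close>, and likewise for \<open>Y(t)\<close>, vanishes at the nodes \<open>\<rho> + \<mu>\<close> with \<open>|\<mu>|\<^sub>o\<^sub>d\<^sub>d \<le> |\<lambda>|\<^sub>o\<^sub>d\<^sub>d\<close> and \<open>\<mu> \<noteq> \<lambda>\<close>, and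
  at \<open>\<rho> + \<lambda>\<close> it has the value that the eigenvalue equation predicts (\<open>eval_det_op\<close>). The
  polynomial \<open>\<phi> X(t) R\<^sub>\<lambda>\<close> is alternating, so it is divisible by \<open>\<phi>\<close> with a semisymmetric
  quotient, and the degree of the quotient does not exceed that of \<open>R\<^sub>\<lambda>\<close> because the leading
  terms in the entries of the matrices cancel (\<open>det_op_divisible\<close>, \<open>deg_le_det_op\<close>). A
  semisymmetric polynomial of degree at most \<open>d\<close> is determined by its values at the \<open>\<rho> + \<mu>\<close>
  with \<open>|\<mu>|\<^sub>o\<^sub>d\<^sub>d \<le> d\<close> (\<open>interpolation_unique\<close>), and the theorem follows
  (\<open>det_op_eigenvector\<close>).

  The last conclusion divides by \<open>\<phi>(\<rho> + \<mu>)\<close>, which may be 0 if \<open>r = 0\<close>. Therefore the argument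
  is carried out over \<open>k[s]\<close> with the indeterminate \<open>s\<close> in place of \<open>r\<close>. This requires
  interpolation polynomials over \<open>k[s]\<close> whose value at \<open>\<rho> + \<lambda>\<close> survives the specialisation
  \<open>s = r\<close> (\<open>interpolation_exists\<close>); the specialised polynomial is a multiple of \<open>R\<^sub>\<lambda>\<close>. The
  variable \<open>t\<close> is evaluated at all constants, of which there are infinitely many.
\<close>

section \<open>Polynomials and their homomorphisms\<close>

definition monomial_value :: "(nat \<Rightarrow> 'b::comm_ring_1) \<Rightarrow> (nat \<Rightarrow>\<^sub>0 nat) \<Rightarrow> 'b" where
  "monomial_value a m = (\<Prod>i\<in>Poly_Mapping.keys m. a i ^ Poly_Mapping.lookup m i)"

lemma monomial_value_superset:
  assumes "finite B" "Poly_Mapping.keys m \<subseteq> B"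
  shows "monomial_value a m = (\<Prod>i\<in>B. a i ^ Poly_Mapping.lookup m i)"
  unfolding monomial_value_def
  by (rule prod.mono_neutral_left) (use assms in \<open>auto simp: in_keys_iff\<close>)

lemma monomial_value_add: "monomial_value a (m + m') = monomial_value a m * monomial_value a m'"
proof -
  let ?B = "Poly_Mapping.keys m \<union> Poly_Mapping.keys m'"
  have "monomial_value a (m + m') = (\<Prod>i\<in>?B. a i ^ Poly_Mapping.lookup (m + m') i)"
    by (rule monomial_value_superset) (use keys_add[of m m'] in auto)
  also have "\<dots> = (\<Prod>i\<in>?B. a i ^ Poly_Mapping.lookup m i) * (\<Prod>i\<in>?B. a i ^ Poly_Mapping.lookup m' i)"
    by (simp add: lookup_add power_add prod.distrib)
  also have "\<dots> = monomial_value a m * monomial_value a m'"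
    by (simp add: monomial_value_superset[of ?B])
  finally show ?thesis .
qed

lemma subst_hom_superset:
  assumes "finite B" "Poly_Mapping.keys p \<subseteq> B" "h 0 = 0"
  shows "subst_hom h a p = (\<Sum>m\<in>B. h (Poly_Mapping.lookup p m) * monomial_value a m)"
  unfolding subst_hom_def monomial_value_def
  by (rule sum.mono_neutral_left) (use assms in \<open>auto simp: in_keys_iff\<close>)

lemma subst_hom_single:
  "h 0 = 0 \<Longrightarrow> subst_hom h a (Poly_Mapping.single m c) = h c * monomial_value a m"
  by (subst subst_hom_superset[of "{m}"]) auto

lemma sum_single_lookup:
  "(\<Sum>m\<in>Poly_Mapping.keys p. Poly_Mapping.single m (Poly_Mapping.lookup p m)) = p"
  by (rule poly_mapping_eqI) (auto simp: lookup_sum lookup_single when_def in_keys_iff)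

lemma mpol_induct_single [case_names single add]:
  fixes P :: "'a::comm_ring_1 mpol \<Rightarrow> bool"
  assumes single: "\<And>m c. P (Poly_Mapping.single m c)"
    and add: "\<And>p q. P p \<Longrightarrow> P q \<Longrightarrow> P (p + q)"
  shows "P p"
proof -
  have "P (\<Sum>m\<in>B. Poly_Mapping.single m (Poly_Mapping.lookup p m))" if "finite B" for B
    using that
  proof induction
    case empty
    show ?case using single[of 0 0] by simp
  qed (auto intro: single add)
  from this[of "Poly_Mapping.keys p"] show ?thesis by (simp add: sum_single_lookup)
qed

lemma mdegree_add: "mdegree (m + m') = mdegree m + mdegree m'"
proof -
  let ?B = "Poly_Mapping.keys m \<union> Poly_Mapping.keys m'"
  have sup: "mdegree x = (\<Sum>i\<in>?B. Poly_Mapping.lookup x i)" if "Poly_Mapping.keys x \<subseteq> ?B" for x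
    unfolding mdegree_def by (rule sum.mono_neutral_left) (use that in \<open>auto simp: in_keys_iff\<close>)
  show ?thesis using keys_add[of m m'] by (simp add: sup lookup_add sum.distrib)
qed

lemma mdegree_single: "mdegree (Poly_Mapping.single i k) = k"
  by (simp add: mdegree_def)

lemma exponent_induct [case_names zero add]:
  assumes zero: "P 0" and add: "\<And>i m. P m \<Longrightarrow> P (Poly_Mapping.single i 1 + m)"
  shows "P (m :: nat \<Rightarrow>\<^sub>0 nat)"
proof (induction "mdegree m" arbitrary: m)
  case 0
  have "m = 0"
    by (rule poly_mapping_eqI) (use 0 in \<open>auto simp: mdegree_def in_keys_iff\<close>)
  then show ?case using zero by simp
next
  case (Suc k)
  then have "Poly_Mapping.keys m \<noteq> {}" by (auto simp: mdegree_def)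
  then obtain i where i: "i \<in> Poly_Mapping.keys m" by blast
  define m' where "m' = m - Poly_Mapping.single i 1"
  have m: "m = Poly_Mapping.single i 1 + m'"
    by (rule poly_mapping_eqI)
      (use i in \<open>auto simp: m'_def lookup_add lookup_minus lookup_single when_def in_keys_iff\<close>)
  have "mdegree m = 1 + mdegree m'"
    unfolding m by (simp add: mdegree_add mdegree_single)
  with Suc have "P m'" by auto
  then show ?case using add m by simp
qed

lemma single_exponent_add:
  "Poly_Mapping.single (Poly_Mapping.single i 1 + m) c = Var i * Poly_Mapping.single m (c :: 'a::comm_ring_1)"
  by (simp add: Var_def mult_single)

lemma mpol_induct [case_names Const Var add mult]:
  fixes P :: "'a::comm_ring_1 mpol \<Rightarrow> bool"
  assumes "\<And>c. P (Const c)" "\<And>i. P (Var i)"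
    and "\<And>p q. P p \<Longrightarrow> P q \<Longrightarrow> P (p + q)" "\<And>p q. P p \<Longrightarrow> P q \<Longrightarrow> P (p * q)"
  shows "P p"
proof (induction p rule: mpol_induct_single)
  case (single m c)
  show ?case
    by (induction m rule: exponent_induct)
      (unfold single_exponent_add Const_def[symmetric], rule assms(1), rule assms(4)[OF assms(2)])
qed (rule assms(3))

lemma comm_ring_homI:
  assumes "h 1 = 1" "\<And>x y. h (x + y) = h x + h y" "\<And>x y. h (x * y) = h x * h y"
  shows "comm_ring_hom (h :: 'a::comm_ring_1 \<Rightarrow> 'b::comm_ring_1)"
proof -
  have "h 0 = 0" using assms(2)[of 0 0] by simp
  then show ?thesis by unfold_locales (use assms in auto)
qed

lemma comm_ring_hom_zero_one:
  assumes "comm_ring_hom h"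
  shows "h 0 = 0" "h 1 = 1"
proof -
  interpret comm_ring_hom h by fact
  show "h 0 = 0" "h 1 = 1" by simp_all
qed

lemma comm_ring_hom_ident: "comm_ring_hom (\<lambda>x. x)"
  by (rule comm_ring_homI) auto

lemma comm_ring_hom_comp:
  assumes "comm_ring_hom g" "comm_ring_hom h"
  shows "comm_ring_hom (\<lambda>x. g (h x))"
proof -
  interpret g: comm_ring_hom g by fact
  interpret h: comm_ring_hom h by fact
  show ?thesis by (rule comm_ring_homI) (auto simp: g.hom_add h.hom_add g.hom_mult h.hom_mult)
qed

lemma Const_hom: "comm_ring_hom (Const :: 'a::comm_ring_1 \<Rightarrow> 'a mpol)"
  by (rule comm_ring_homI) (auto simp: Const_def single_add mult_single)

lemma poly_eval_hom: "comm_ring_hom (\<lambda>p. poly p c)"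
  by (rule comm_ring_homI) auto

lemma subst_hom_Const: "h 0 = 0 \<Longrightarrow> subst_hom h a (Const c) = h c"
  by (simp add: Const_def subst_hom_single monomial_value_def)

lemma subst_hom_Var: "h 0 = 0 \<Longrightarrow> h 1 = 1 \<Longrightarrow> subst_hom h a (Var i) = a i"
  by (simp add: Var_def subst_hom_single monomial_value_def)

lemma subst_hom_add:
  assumes "comm_ring_hom h"
  shows "subst_hom h a (p + q) = subst_hom h a p + subst_hom h a q"
proof -
  interpret h: comm_ring_hom h by fact
  let ?B = "Poly_Mapping.keys p \<union> Poly_Mapping.keys q"
  have "Poly_Mapping.keys (p + q) \<subseteq> ?B" by (rule keys_add)
  then show ?thesis
    by (simp add: subst_hom_superset[of ?B] lookup_add h.hom_add distrib_right sum.distrib)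
qed

lemma subst_hom_ring_hom:
  assumes "comm_ring_hom h"
  shows "comm_ring_hom (subst_hom h a)"
proof (rule comm_ring_homI)
  interpret h: comm_ring_hom h by fact
  show "subst_hom h a 1 = 1"
    using subst_hom_Const[of h a 1] by (simp add: Const_def)
  show add: "subst_hom h a (p + q) = subst_hom h a p + subst_hom h a q" for p q
    by (rule subst_hom_add[OF assms])
  have single_mult: "subst_hom h a (Poly_Mapping.single m c * q)
      = subst_hom h a (Poly_Mapping.single m c) * subst_hom h a q" for m c q
    by (induction q rule: mpol_induct_single)
      (auto simp: mult_single subst_hom_single h.hom_mult monomial_value_add algebra_simps add)
  show "subst_hom h a (p * q) = subst_hom h a p * subst_hom h a q" for p q
    by (induction p rule: mpol_induct_single) (auto simp: single_mult add distrib_right)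
qed

text \<open>
  A homomorphism is determined on constants and variables. All commutation rules between
  evaluations, shifts, permutations of variables and changes of the base ring come from
  comparing both sides there.
\<close>

lemma mpol_hom_eqI:
  assumes "comm_ring_hom f" "comm_ring_hom g"
    and "\<And>c. f (Const c) = g (Const c)" "\<And>i. f (Var i) = g (Var i)"
  shows "f p = g p"
proof -
  interpret f: comm_ring_hom f by fact
  interpret g: comm_ring_hom g by fact
  show ?thesis
    by (induction p rule: mpol_induct) (auto simp: assms f.hom_add g.hom_add f.hom_mult g.hom_mult)
qed

lemma hom_subst_hom:
  assumes g: "comm_ring_hom g" and h: "comm_ring_hom h"
  shows "g (subst_hom h a p) = subst_hom (\<lambda>c. g (h c)) (\<lambda>i. g (a i)) p"
proof (rule mpol_hom_eqI[where f = "\<lambda>p. g (subst_hom h a p)"])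
  interpret g: comm_ring_hom g by fact
  interpret h: comm_ring_hom h by fact
  have gh: "comm_ring_hom (\<lambda>c. g (h c))" by (rule comm_ring_hom_comp[OF g h])
  show "comm_ring_hom (\<lambda>p. g (subst_hom h a p))"
    by (rule comm_ring_hom_comp[OF g subst_hom_ring_hom[OF h]])
  show "comm_ring_hom (subst_hom (\<lambda>c. g (h c)) (\<lambda>i. g (a i)))"
    by (rule subst_hom_ring_hom[OF gh])
qed (simp_all add: subst_hom_Const subst_hom_Var comm_ring_hom_zero_one[OF g] comm_ring_hom_zero_one[OF h])

lemma substitute_ring_hom: "comm_ring_hom (substitute a :: 'a::comm_ring_1 mpol \<Rightarrow> 'a mpol)"
  unfolding substitute_def[abs_def] by (rule subst_hom_ring_hom[OF Const_hom])

lemma eval_at_ring_hom: "comm_ring_hom (eval_at a)"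
  unfolding eval_at_def[abs_def] by (rule subst_hom_ring_hom[OF comm_ring_hom_ident])

lemma substitute_Const [simp]: "substitute a (Const c) = Const c"
  unfolding substitute_def by (rule subst_hom_Const) (simp add: Const_def)

lemma substitute_Var [simp]: "substitute a (Var i) = a i"
  unfolding substitute_def by (rule subst_hom_Var) (auto simp: Const_def)

lemma substitute_Var_ident [simp]: "substitute Var p = p"
  by (rule mpol_hom_eqI[OF substitute_ring_hom comm_ring_hom_ident]) auto

lemma subst_hom_substitute:
  assumes "comm_ring_hom h"
  shows "subst_hom h a (substitute s p) = subst_hom h (\<lambda>i. subst_hom h a (s i)) p"
proof -
  interpret h: comm_ring_hom h by fact
  show ?thesis
    unfolding substitute_def
    by (subst hom_subst_hom[OF subst_hom_ring_hom[OF assms] Const_hom])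
      (simp add: subst_hom_Const)
qed

lemma subst_hom_cong_polys:
  assumes "p \<in> polys n" "\<And>i. i \<in> {1..n} \<Longrightarrow> a i = b i"
  shows "subst_hom h a p = subst_hom h b p"
  unfolding subst_hom_def
  by (intro sum.cong prod.cong refl arg_cong2[where f = "(*)"])
    (use assms in \<open>force simp: polys_def\<close>)

lemma polys_add: "p \<in> polys n \<Longrightarrow> q \<in> polys n \<Longrightarrow> p + q \<in> polys n"
  using keys_add[of p q] by (fastforce simp: polys_def)

lemma polys_mult:
  fixes p q :: "'a::comm_ring_1 mpol"
  assumes "p \<in> polys n" "q \<in> polys n"
  shows "p * q \<in> polys n"
  unfolding polys_def
proof (intro CollectI ballI)
  fix m
  assume "m \<in> Poly_Mapping.keys (p * q)"
  then obtain a b where "m = a + b" "a \<in> Poly_Mapping.keys p" "b \<in> Poly_Mapping.keys q"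
    using keys_mult[of p q] by auto
  then show "Poly_Mapping.keys m \<subseteq> {1..n}"
    using keys_add[of a b] assms by (fastforce simp: polys_def)
qed

lemma Const_polys: "Const c \<in> polys n"
  by (auto simp: polys_def Const_def split: if_splits)

lemma Var_polys: "i \<in> {1..n} \<Longrightarrow> (Var i :: 'a::comm_ring_1 mpol) \<in> polys n"
  by (auto simp: polys_def Var_def split: if_splits)

lemma zero_polys: "0 \<in> polys n"
  by (auto simp: polys_def)

lemma substitute_polys:
  fixes p :: "'a::comm_ring_1 mpol"
  assumes "\<And>i. a i \<in> polys n"
  shows "substitute a p \<in> polys n"
proof -
  interpret comm_ring_hom "substitute a :: 'a mpol \<Rightarrow> _" by (rule substitute_ring_hom)
  show ?thesis
    by (induction p rule: mpol_induct)
      (auto simp: hom_add hom_mult intro: polys_add polys_mult Const_polys assms)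
qed

text \<open>Membership in \<open>polys n\<close> as an equation, which can be cancelled from a product.\<close>

lemma polys_iff_truncate:
  fixes p :: "'a::comm_ring_1 mpol"
  shows "p \<in> polys n \<longleftrightarrow> substitute (\<lambda>i. if i \<in> {1..n} then Var i else 0) p = p"
    (is "_ \<longleftrightarrow> substitute ?t p = p")
proof
  assume "p \<in> polys n"
  then have "substitute ?t p = substitute Var p"
    unfolding substitute_def by (rule subst_hom_cong_polys) simp
  then show "substitute ?t p = p" by simp
next
  assume *: "substitute ?t p = p"
  have "?t i \<in> polys n" for i by (auto intro: Var_polys zero_polys)
  then have "substitute ?t p \<in> polys n" by (rule substitute_polys)
  with * show "p \<in> polys n" by simp
qed

lemma semisymmetric_subst_hom:
  assumes "p \<in> semisymmetric n" "\<pi> \<in> semisym_group n" "comm_ring_hom h"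
  shows "subst_hom h (\<lambda>i. a (\<pi> i)) p = subst_hom h a p"
proof -
  interpret h: comm_ring_hom h by fact
  have "subst_hom h a (substitute (\<lambda>i. Var (\<pi> i)) p) = subst_hom h (\<lambda>i. a (\<pi> i)) p"
    by (simp add: subst_hom_substitute[OF assms(3)] subst_hom_Var)
  with assms show ?thesis by (simp add: semisymmetric_def)
qed

text \<open>
  Both conditions defining semisymmetric polynomials are equations under substitutions, so they
  pass to the quotient by a factor that transforms by the same scalar as the product.
\<close>

lemma semisymmetric_cancel:
  fixes p q :: "'a::idom mpol"
  assumes "p \<noteq> 0" "p \<in> polys n" "p * q \<in> polys n"
    and \<epsilon>: "\<And>\<pi>. \<pi> \<in> semisym_group n \<Longrightarrow> \<epsilon> \<pi> \<noteq> 0"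
      "\<And>\<pi>. \<pi> \<in> semisym_group n \<Longrightarrow> substitute (\<lambda>i. Var (\<pi> i)) p = \<epsilon> \<pi> * p"
      "\<And>\<pi>. \<pi> \<in> semisym_group n \<Longrightarrow> substitute (\<lambda>i. Var (\<pi> i)) (p * q) = \<epsilon> \<pi> * (p * q)"
  shows "q \<in> semisymmetric n"
  unfolding semisymmetric_def
proof (intro CollectI conjI ballI)
  let ?tr = "\<lambda>i. if i \<in> {1..n} then Var i else (0 :: 'a mpol)"
  interpret comm_ring_hom "substitute ?tr" by (rule substitute_ring_hom)
  have "substitute ?tr p = p" "substitute ?tr (p * q) = p * q"
    using assms(2,3) unfolding polys_iff_truncate by blast+
  then have "p * substitute ?tr q = p * q" by (simp only: hom_mult)
  then show "q \<in> polys n" using assms(1) by (simp add: polys_iff_truncate)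
next
  fix \<pi>
  assume \<pi>: "\<pi> \<in> semisym_group n"
  interpret comm_ring_hom "substitute (\<lambda>i. Var (\<pi> i) :: 'a mpol)" by (rule substitute_ring_hom)
  have "(\<epsilon> \<pi> * p) * substitute (\<lambda>i. Var (\<pi> i)) q = (\<epsilon> \<pi> * p) * q"
    using \<epsilon>(2,3)[OF \<pi>] by (simp only: hom_mult mult.assoc)
  then show "substitute (\<lambda>i. Var (\<pi> i)) q = q" using assms(1) \<epsilon>(1)[OF \<pi>] by simp
qed

section \<open>Degree\<close>

text \<open>
  The bound is an integer because the difference operators lower degrees; a negative bound
  forces the polynomial to be 0.
\<close>

definition deg_le :: "int \<Rightarrow> 'a::zero mpol \<Rightarrow> bool" where
  "deg_le d p \<longleftrightarrow> (\<forall>m\<in>Poly_Mapping.keys p. int (mdegree m) \<le> d)"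

lemma deg_le_total_degree: "deg_le (int d) p \<longleftrightarrow> total_degree p \<le> d"
  by (auto simp: deg_le_def total_degree_def)

lemma deg_le_0 [simp]: "deg_le d 0"
  by (simp add: deg_le_def)

lemma deg_le_neg: "d < 0 \<Longrightarrow> deg_le d p \<longleftrightarrow> p = 0"
  by (force simp: deg_le_def poly_mapping_eq_iff fun_eq_iff in_keys_iff)

lemma deg_le_mono: "deg_le d p \<Longrightarrow> d \<le> e \<Longrightarrow> deg_le e p"
  by (force simp: deg_le_def)

lemma deg_le_add: "deg_le d p \<Longrightarrow> deg_le d q \<Longrightarrow> deg_le d (p + q)"
  using keys_add[of p q] by (fastforce simp: deg_le_def)

lemma deg_le_uminus: "deg_le d (p :: 'a::comm_ring_1 mpol) \<Longrightarrow> deg_le d (- p)"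
  by (simp add: deg_le_def in_keys_iff)

lemma deg_le_diff: "deg_le d p \<Longrightarrow> deg_le d q \<Longrightarrow> deg_le d (p - q :: 'a::comm_ring_1 mpol)"
  using deg_le_add[of d p "- q"] deg_le_uminus[of d q] by simp

lemma deg_le_mult:
  fixes p q :: "'a::comm_ring_1 mpol"
  shows "deg_le d p \<Longrightarrow> deg_le e q \<Longrightarrow> deg_le (d + e) (p * q)"
  using keys_mult[of p q] by (fastforce simp: deg_le_def mdegree_add)

lemma deg_le_sum: "(\<And>x. x \<in> S \<Longrightarrow> deg_le d (f x)) \<Longrightarrow> deg_le d (sum f S)"
  by (induction S rule: infinite_finite_induct) (auto intro: deg_le_add)

lemma deg_le_Const: "deg_le 0 (Const c)"
  by (auto simp: deg_le_def Const_def mdegree_def split: if_splits)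

lemma deg_le_Const_mult: "deg_le d (p :: 'a::comm_ring_1 mpol) \<Longrightarrow> deg_le d (Const c * p)"
  using deg_le_mult[OF deg_le_Const] by fastforce

lemma deg_le_Var: "deg_le 1 (Var i :: 'a::comm_ring_1 mpol)"
  by (auto simp: deg_le_def Var_def mdegree_def split: if_splits)

lemma deg_le_power: "deg_le d (p :: 'a::comm_ring_1 mpol) \<Longrightarrow> deg_le (int k * d) (p ^ k)"
proof (induction k)
  case 0
  show ?case using deg_le_Const[of "1::'a"] by (simp add: Const_def)
next
  case (Suc k)
  then show ?case using deg_le_mult[of d p "int k * d" "p ^ k"] by (simp add: algebra_simps)
qed

text \<open>
  Monomials span the polynomials of bounded degree, which reduces degree estimates for additive
  maps to monomials.
\<close>

lemma deg_le_induct [consumes 1, case_names single add zero]: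
  fixes p :: "'a::comm_ring_1 mpol"
  assumes "deg_le d p"
    and "\<And>m c. int (mdegree m) \<le> d \<Longrightarrow> P (Poly_Mapping.single m c)"
    and "\<And>p q. P p \<Longrightarrow> P q \<Longrightarrow> P (p + q)" and "P 0"
  shows "P p"
proof -
  have "P (\<Sum>m\<in>B. Poly_Mapping.single m (Poly_Mapping.lookup p m))"
    if "finite B" "B \<subseteq> Poly_Mapping.keys p" for B
    using that
  proof induction
    case (insert x B)
    then have "P (Poly_Mapping.single x (Poly_Mapping.lookup p x))"
      using assms(1,2) by (auto simp: deg_le_def)
    with insert show ?case using assms(3) by simp
  qed (simp add: assms(4))
  from this[of "Poly_Mapping.keys p"] show ?thesis by (simp add: sum_single_lookup)
qed

lemma deg_le_monomial_map:
  fixes F :: "'a::comm_ring_1 mpol \<Rightarrow> 'b::comm_ring_1 mpol"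
  assumes "deg_le d p" and "\<And>p q. F (p + q) = F p + F q" "F 0 = 0"
    and "\<And>m c. deg_le (int (mdegree m) + e) (F (Poly_Mapping.single m c))"
  shows "deg_le (d + e) (F p)"
  using assms(1)
proof (induction rule: deg_le_induct)
  case (single m c)
  then show ?case using deg_le_mono[OF assms(4)] by simp
next
  case (add p q)
  then show ?case unfolding assms(2) by (rule deg_le_add)
qed (simp add: assms(3))

lemma deg_le_substitute:
  fixes p :: "'a::comm_ring_1 mpol"
  assumes "deg_le d p" "\<And>i. deg_le 1 (a i)"
  shows "deg_le d (substitute a p)"
proof -
  interpret comm_ring_hom "substitute a :: 'a mpol \<Rightarrow> _" by (rule substitute_ring_hom)
  have "deg_le (d + 0) (substitute a p)"
  proof (rule deg_le_monomial_map[OF assms(1)])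
    fix m c
    have eq: "substitute a (Poly_Mapping.single m c) = Const c * (\<Prod>i\<in>Poly_Mapping.keys m. a i ^ Poly_Mapping.lookup m i)"
      by (simp add: substitute_def subst_hom_single Const_def monomial_value_def)
    have "deg_le (\<Sum>i\<in>S. int (Poly_Mapping.lookup m i)) (\<Prod>i\<in>S. a i ^ Poly_Mapping.lookup m i)"
      if "finite S" for S
      using that
    proof induction
      case empty
      show ?case using deg_le_Const[of "1::'a"] by (simp add: Const_def)
    next
      case (insert x S)
      then show ?case
        using deg_le_mult[OF deg_le_power[OF assms(2)[of x], of "Poly_Mapping.lookup m x"]] by simp
    qed
    from this[of "Poly_Mapping.keys m"]
    show "deg_le (int (mdegree m) + 0) (substitute a (Poly_Mapping.single m c))"
      unfolding eq by (intro deg_le_Const_mult) (simp add: mdegree_def)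
  qed (simp_all add: hom_add)
  then show ?thesis by simp
qed

text \<open>
  The degree is additive on products over a domain. To see this, mark the degree by an
  auxiliary variable: the substitution \<open>z\<^sub>i \<mapsto> s z\<^sub>i\<close> embeds \<open>A[z]\<close> into \<open>A[z][s]\<close> and
  turns the total degree into the degree in \<open>s\<close>.
\<close>

definition homogenize :: "'a::comm_ring_1 mpol \<Rightarrow> 'a mpol poly" where
  "homogenize = subst_hom (\<lambda>c. [:Const c:]) (\<lambda>i. monom (Var i) 1)"

lemma homogenize_ring_hom: "comm_ring_hom (homogenize :: 'a::comm_ring_1 mpol \<Rightarrow> _)"
  unfolding homogenize_def
proof (rule subst_hom_ring_hom)
  interpret comm_ring_hom "Const :: 'a \<Rightarrow> 'a mpol" by (rule Const_hom)
  show "comm_ring_hom (\<lambda>c. [:Const (c::'a):])"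
    by (rule comm_ring_homI) (auto simp: hom_add hom_mult)
qed

lemma homogenize_single:
  "homogenize (Poly_Mapping.single m c) = monom (Poly_Mapping.single m c) (mdegree m)"
proof (induction m rule: exponent_induct)
  case zero
  show ?case by (simp add: homogenize_def subst_hom_single monomial_value_def Const_def mdegree_def monom_0)
next
  case (add i m)
  interpret comm_ring_hom "homogenize :: 'a mpol \<Rightarrow> _" by (rule homogenize_ring_hom)
  have "homogenize (Var i :: 'a mpol) = monom (Var i) 1"
    unfolding homogenize_def by (rule subst_hom_Var) (auto simp: Const_def)
  then show ?case
    unfolding single_exponent_add hom_mult add by (simp add: mult_monom mdegree_add mdegree_single)
qed

lemma lookup_coeff_homogenize:
  fixes p :: "'a::comm_ring_1 mpol"
  shows "Poly_Mapping.lookup (coeff (homogenize p) k) m = (Poly_Mapping.lookup p m when mdegree m = k)"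
proof -
  interpret comm_ring_hom "homogenize :: 'a mpol \<Rightarrow> _" by (rule homogenize_ring_hom)
  show ?thesis
    by (induction p rule: mpol_induct_single)
      (auto simp: homogenize_single lookup_single when_def hom_add lookup_add)
qed

lemma homogenize_eq_0_iff: "homogenize p = 0 \<longleftrightarrow> p = (0 :: 'a::comm_ring_1 mpol)"
proof
  assume "homogenize p = 0"
  then have "(Poly_Mapping.lookup p m when mdegree m = k) = 0" for m k
    using lookup_coeff_homogenize[of p k m] by simp
  from this[of m "mdegree m" for m] show "p = 0"
    by (intro poly_mapping_eqI) simp
qed (simp add: homogenize_def subst_hom_def)

lemma deg_le_iff_degree_homogenize:
  "deg_le d p \<longleftrightarrow> p = 0 \<or> int (degree (homogenize (p :: 'a::comm_ring_1 mpol))) \<le> d"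
proof (cases "p = 0")
  case False
  show ?thesis
  proof
    assume *: "deg_le d p"
    have "coeff (homogenize p) (degree (homogenize p)) \<noteq> 0"
      using False by (simp add: homogenize_eq_0_iff)
    then obtain m where "Poly_Mapping.lookup (coeff (homogenize p) (degree (homogenize p))) m \<noteq> 0"
      by (metis poly_mapping_eqI lookup_zero)
    then show "p = 0 \<or> int (degree (homogenize p)) \<le> d"
      using * by (force simp: lookup_coeff_homogenize when_def deg_le_def in_keys_iff split: if_splits)
  next
    assume "p = 0 \<or> int (degree (homogenize p)) \<le> d"
    then have d: "int (degree (homogenize p)) \<le> d" using False by simp
    show "deg_le d p"
      unfolding deg_le_def
    proof
      fix m
      assume "m \<in> Poly_Mapping.keys p"
      then have "Poly_Mapping.lookup (coeff (homogenize p) (mdegree m)) m \<noteq> 0"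
        by (simp add: lookup_coeff_homogenize in_keys_iff)
      then have "coeff (homogenize p) (mdegree m) \<noteq> 0" by auto
      then have "mdegree m \<le> degree (homogenize p)" by (rule le_degree)
      with d show "int (mdegree m) \<le> d" by simp
    qed
  qed
qed simp

lemma deg_le_mult_cancel:
  fixes p q :: "'a::idom mpol"
  assumes "deg_le (d + int e) (p * q)" "degree (homogenize p) = e" "p \<noteq> 0"
  shows "deg_le d q"
proof (cases "q = 0")
  case False
  interpret comm_ring_hom "homogenize :: 'a mpol \<Rightarrow> _" by (rule homogenize_ring_hom)
  have "degree (homogenize (p * q)) = e + degree (homogenize q)"
    unfolding hom_mult assms(2)[symmetric]
    by (rule degree_mult_eq) (use False assms(3) in \<open>auto simp: homogenize_eq_0_iff\<close>)
  then show ?thesis using assms False by (simp add: deg_le_iff_degree_homogenize)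
qed simp

lemma deg_le_prod_cancel:
  fixes q :: "'a::idom mpol"
  assumes "finite S" "\<And>s. s \<in> S \<Longrightarrow> degree (homogenize (u s)) = 1"
    and "deg_le (d + int (card S)) ((\<Prod>s\<in>S. u s) * q)"
  shows "deg_le d q"
  using assms
proof (induction S arbitrary: d rule: finite_induct)
  case (insert s S)
  from insert.prems(2) insert.hyps
  have *: "deg_le ((d + int (card S)) + int 1) (u s * ((\<Prod>s\<in>S. u s) * q))"
    by (simp add: algebra_simps)
  have d: "degree (homogenize (u s)) = 1" by (rule insert.prems(1)) simp
  then have "u s \<noteq> 0"
    using homogenize_eq_0_iff[of "u s"] by auto
  then have "deg_le (d + int (card S)) ((\<Prod>s\<in>S. u s) * q)"
    by (rule deg_le_mult_cancel[OF * d])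
  then show ?case by (rule insert.IH[rotated]) (use insert.prems(1) in simp)
qed simp

lemma Var_eq_iff [simp]: "(Var i :: 'a::comm_ring_1 mpol) = Var j \<longleftrightarrow> i = j"
proof
  have keys: "Poly_Mapping.keys (Poly_Mapping.single k (1::nat)) = {k}" for k :: nat
    by simp
  assume "(Var i :: 'a mpol) = Var j"
  then have "Poly_Mapping.keys (Var i :: 'a mpol) = Poly_Mapping.keys (Var j :: 'a mpol)" by simp
  then have "Poly_Mapping.single i (1::nat) = Poly_Mapping.single j 1" by (simp add: Var_def)
  then show "i = j" using keys by (metis singleton_inject)
qed simp

lemma degree_homogenize_linear:
  fixes c :: "'a::idom"
  shows "degree (homogenize (Var i - Const c)) = 1"
    and "i \<noteq> j \<Longrightarrow> degree (homogenize (Var i - Var j :: 'a mpol)) = 1"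
proof -
  interpret comm_ring_hom "homogenize :: 'a mpol \<Rightarrow> _" by (rule homogenize_ring_hom)
  have V: "homogenize (Var i :: 'a mpol) = monom (Var i) 1" for i
    unfolding homogenize_def by (rule subst_hom_Var) (auto simp: Const_def)
  have C: "homogenize (Const c) = [:Const c:]"
    unfolding homogenize_def by (rule subst_hom_Const) (auto simp: Const_def)
  have nz: "(Var i :: 'a mpol) \<noteq> 0" for i
    by (simp add: Var_def flip: keys_eq_empty)
  have "homogenize (Var i - Const c) = [:- Const c, Var i:]"
    by (simp add: hom_minus V C monom_Suc monom_0)
  then show "degree (homogenize (Var i - Const c)) = 1" using nz by simp
  assume "i \<noteq> j"
  then have "(Var i :: 'a mpol) \<noteq> Var j" by simp
  moreover have "homogenize (Var i - Var j :: 'a mpol) = monom (Var i - Var j) 1"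
    by (simp add: hom_minus V diff_monom)
  ultimately show "degree (homogenize (Var i - Var j :: 'a mpol)) = 1"
    by (simp add: degree_monom_eq)
qed

text \<open>
  A shift only changes terms of lower degree. By the product rule
  \<open>p q - Tp Tq = p (q - Tq) + (p - Tp) Tq\<close> it suffices that \<open>Tz\<^sub>v = z\<^sub>v - 1\<close>.
\<close>

lemma deg_le_diff_shift:
  fixes p :: "'a::comm_ring_1 mpol"
  assumes "deg_le d p"
  shows "deg_le (d - 1) (p - substitute (\<lambda>j. if j = v then Var j - 1 else Var j) p)"
proof -
  let ?s = "\<lambda>j. if j = v then Var j - 1 else (Var j :: 'a mpol)"
  interpret comm_ring_hom "substitute ?s" by (rule substitute_ring_hom)
  have s: "deg_le 1 (?s j)" for j
    using deg_le_Var[of j] deg_le_mono[OF deg_le_Const, of 1 "1::'a"]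
    by (auto simp: Const_def intro: deg_le_diff)
  have single: "deg_le (int (mdegree m)) (Poly_Mapping.single m (c :: 'a))" for m c
    by (simp add: deg_le_def)
  have "deg_le (d + -1) (p - substitute ?s p)"
  proof (rule deg_le_monomial_map[OF assms])
    fix m and c :: 'a
    show "deg_le (int (mdegree m) + - 1) (Poly_Mapping.single m c - substitute ?s (Poly_Mapping.single m c))"
    proof (induction m rule: exponent_induct)
      case zero
      show ?case using substitute_Const[of ?s c] by (simp add: Const_def)
    next
      case (add i m)
      let ?p = "Poly_Mapping.single m c"
      have "Var i * ?p - substitute ?s (Var i * ?p) =
          Var i * (?p - substitute ?s ?p) + (Var i - ?s i) * substitute ?s ?p"
        by (simp add: hom_mult algebra_simps)
      moreover have "deg_le (1 + (int (mdegree m) + -1)) (Var i * (?p - substitute ?s ?p))"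
        by (rule deg_le_mult[OF deg_le_Var add])
      moreover have "deg_le 0 (Var i - ?s i)"
        using deg_le_Const[of "1::'a"] by (auto simp: Const_def)
      then have "deg_le (0 + int (mdegree m)) ((Var i - ?s i) * substitute ?s ?p)"
        by (rule deg_le_mult[OF _ deg_le_substitute[OF single s]])
      ultimately have "deg_le (int (mdegree m)) (Var i * ?p - substitute ?s (Var i * ?p))"
        by (auto intro: deg_le_add)
      then show ?case unfolding single_exponent_add by (simp add: mdegree_add mdegree_single)
    qed
  qed (auto simp: hom_add)
  then show ?thesis by simp
qed

section \<open>Divisibility by linear forms\<close>

text \<open>
  Modulo \<open>z\<^sub>i - q\<close> the variable \<open>z\<^sub>i\<close> and \<open>q\<close> agree, hence so do \<open>p\<close> and its specialisation.
\<close>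

lemma linear_dvd_diff_substitute:
  fixes p q :: "'a::comm_ring_1 mpol"
  shows "(Var i - q) dvd p - substitute (Var(i := q)) p"
proof (induction p rule: mpol_induct)
  interpret comm_ring_hom "substitute (Var(i := q))" by (rule substitute_ring_hom)
  let ?s = "substitute (Var(i := q))"
  {
    case (add p p')
    have "p + p' - ?s (p + p') = (p - ?s p) + (p' - ?s p')" by (simp add: hom_add)
    with add show ?case by (metis dvd_add)
  next
    case (mult p p')
    have "p * p' - ?s (p * p') = (p - ?s p) * p' + ?s p * (p' - ?s p')"
      by (simp add: hom_mult algebra_simps)
    with mult show ?case by (metis dvd_add dvd_mult dvd_mult2)
  }
qed auto

lemma linear_dvd_of_substitute_zero:
  fixes p q :: "'a::comm_ring_1 mpol"
  assumes "substitute (Var(i := q)) p = 0"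
  shows "(Var i - q) dvd p"
  using linear_dvd_diff_substitute[of i q p] assms by simp

text \<open>
  Distinct linear forms are coprime in the following sense: each \<open>u s\<close> generates the kernel
  of a map \<open>\<sigma> s\<close> to a domain that does not kill the other forms. Hence an element killed by all
  \<open>\<sigma> s\<close> is divisible by the product.
\<close>

lemma prod_dvd_of_specialisations:
  fixes p :: "'a::idom mpol"
  assumes "finite S" "\<And>s. s \<in> S \<Longrightarrow> comm_ring_hom (\<sigma> s :: 'a mpol \<Rightarrow> 'a mpol)"
    and "\<And>s p. s \<in> S \<Longrightarrow> \<sigma> s p = 0 \<Longrightarrow> u s dvd p"
    and "\<And>s s'. s \<in> S \<Longrightarrow> s' \<in> S \<Longrightarrow> s \<noteq> s' \<Longrightarrow> \<sigma> s (u s') \<noteq> 0"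
    and "\<And>s. s \<in> S \<Longrightarrow> \<sigma> s p = 0"
  shows "(\<Prod>s\<in>S. u s) dvd p"
  using assms
proof (induction S rule: finite_induct)
  case (insert s S)
  interpret comm_ring_hom "\<sigma> s" by (rule insert.prems(1)) simp
  have "(\<Prod>s\<in>S. u s) dvd p" by (rule insert.IH) (use insert.prems in auto)
  then obtain q where q: "p = (\<Prod>s\<in>S. u s) * q" by (elim dvdE)
  have "\<sigma> s p = (\<Prod>s'\<in>S. \<sigma> s (u s')) * \<sigma> s q"
    unfolding q by (simp add: hom_mult hom_prod)
  moreover have "\<sigma> s p = 0" by (rule insert.prems(4)) simp
  moreover have "(\<Prod>s'\<in>S. \<sigma> s (u s')) \<noteq> 0"
    using insert.hyps insert.prems(3)[of s] by (auto simp: prod_zero_iff)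
  ultimately have "\<sigma> s q = 0" by simp
  then have "u s dvd q" using insert.prems(2)[of s q] by simp
  then show ?case unfolding q using insert.hyps by (simp add: mult.commute mult_dvd_mono)
qed simp

section \<open>Leibniz determinants\<close>

definition leibniz :: "nat \<Rightarrow> (nat \<Rightarrow> nat \<Rightarrow> 'b) \<Rightarrow> 'b::comm_ring_1" where
  "leibniz n M = (\<Sum>\<sigma> | \<sigma> permutes {1..n}. of_int (sign \<sigma>) * (\<Prod>a\<in>{1..n}. M a (\<sigma> a)))"

lemma leibniz_cong:
  assumes "\<And>a b. a \<in> {1..n} \<Longrightarrow> b \<in> {1..n} \<Longrightarrow> M a b = M' a b"
  shows "leibniz n M = leibniz n M'"
  unfolding leibniz_def
proof (intro sum.cong refl arg_cong2[where f = "(*)"] prod.cong)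
  fix \<sigma> a
  assume "\<sigma> \<in> {\<sigma>. \<sigma> permutes {1..n}}" "a \<in> {1..n}"
  then have "\<sigma> a \<in> {1..n}" using permutes_in_image[of \<sigma> "{1..n}" a] by blast
  then show "M a (\<sigma> a) = M' a (\<sigma> a)" using assms \<open>a \<in> {1..n}\<close> by blast
qed

lemma leibniz_permute_rows:
  assumes "\<pi> permutes {1..n}"
  shows "leibniz n (\<lambda>a. M (\<pi> a)) = of_int (sign \<pi>) * leibniz n M"
proof -
  have p: "permutation \<sigma>" if "\<sigma> permutes {1..n}" for \<sigma>
    using that by (auto simp: permutation_permutes)
  have "leibniz n (\<lambda>a. M (\<pi> a)) =
      (\<Sum>\<sigma> | \<sigma> permutes {1..n}. of_int (sign (\<sigma> \<circ> \<pi>)) * (\<Prod>a\<in>{1..n}. M (\<pi> a) ((\<sigma> \<circ> \<pi>) a)))"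
    unfolding leibniz_def
    using sum_permutations_compose_right[OF assms,
      of "\<lambda>\<sigma>. of_int (sign \<sigma>) * (\<Prod>a\<in>{1..n}. M (\<pi> a) (\<sigma> a))"] by simp
  also have "\<dots> = (\<Sum>\<sigma> | \<sigma> permutes {1..n}. of_int (sign \<pi>) * (of_int (sign \<sigma>) * (\<Prod>a\<in>{1..n}. M a (\<sigma> a))))"
  proof (rule sum.cong[OF refl])
    fix \<sigma>
    assume "\<sigma> \<in> {\<sigma>. \<sigma> permutes {1..n}}"
    then have "sign (\<sigma> \<circ> \<pi>) = sign \<sigma> * sign \<pi>"
      using p assms by (intro sign_compose) auto
    moreover have "(\<Prod>a\<in>{1..n}. M (\<pi> a) (\<sigma> (\<pi> a))) = (\<Prod>a\<in>{1..n}. M a (\<sigma> a))"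
      using prod.permute[OF assms, of "\<lambda>a. M a (\<sigma> a)"] by (simp add: o_def)
    ultimately show "of_int (sign (\<sigma> \<circ> \<pi>)) * (\<Prod>a\<in>{1..n}. M (\<pi> a) ((\<sigma> \<circ> \<pi>) a)) =
        of_int (sign \<pi>) * (of_int (sign \<sigma>) * (\<Prod>a\<in>{1..n}. M a (\<sigma> a)))"
      by (simp add: mult_ac)
  qed
  also have "\<dots> = of_int (sign \<pi>) * leibniz n M"
    by (simp add: leibniz_def sum_distrib_left)
  finally show ?thesis .
qed

lemma leibniz_zero_row:
  assumes "a \<in> {1..n}" "\<And>b. b \<in> {1..n} \<Longrightarrow> M a b = 0"
  shows "leibniz n M = 0"
  unfolding leibniz_def
proof (rule sum.neutral, rule ballI)
  fix \<sigma>
  assume "\<sigma> \<in> {\<sigma>. \<sigma> permutes {1..n}}"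
  then have "\<sigma> a \<in> {1..n}" using assms(1) permutes_in_image[of \<sigma> "{1..n}" a] by blast
  then have "M a (\<sigma> a) = 0" by (rule assms(2))
  then have "(\<Prod>a\<in>{1..n}. M a (\<sigma> a)) = 0" using assms(1) by (intro prod_zero) blast+
  then show "of_int (sign \<sigma>) * (\<Prod>a\<in>{1..n}. M a (\<sigma> a)) = 0" by simp
qed

text \<open>
  After pulling out the factors, swapping the two rows changes nothing and also changes the sign;
  in characteristic 0 the determinant is therefore 0.
\<close>

lemma leibniz_proportional_rows:
  fixes M :: "nat \<Rightarrow> nat \<Rightarrow> 'b::{idom,ring_char_0}"
  assumes a: "a \<in> {1..n}" "a' \<in> {1..n}" "a \<noteq> a'"
    and M: "\<And>b. b \<in> {1..n} \<Longrightarrow> M a b = p * u b" "\<And>b. b \<in> {1..n} \<Longrightarrow> M a' b = q * u b"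
  shows "leibniz n M = 0"
proof -
  define M1 where "M1 = M(a := u, a' := u)"
  have "leibniz n M = p * q * leibniz n M1"
    unfolding leibniz_def sum_distrib_left
  proof (rule sum.cong[OF refl])
    fix \<sigma>
    assume "\<sigma> \<in> {\<sigma>. \<sigma> permutes {1..n}}"
    then have \<sigma>: "\<sigma> i \<in> {1..n}" if "i \<in> {1..n}" for i
      using that permutes_in_image[of \<sigma> "{1..n}" i] by blast
    have split: "(\<Prod>i\<in>{1..n}. F i) = F a * (F a' * (\<Prod>i\<in>{1..n} - {a} - {a'}. F i))" for F :: "nat \<Rightarrow> 'b"
      using a by (simp add: prod.remove[of _ a] prod.remove[of _ a'])
    have "(\<Prod>i\<in>{1..n} - {a} - {a'}. M i (\<sigma> i)) = (\<Prod>i\<in>{1..n} - {a} - {a'}. M1 i (\<sigma> i))"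
      by (rule prod.cong) (auto simp: M1_def)
    then have "(\<Prod>i\<in>{1..n}. M i (\<sigma> i)) = p * q * (\<Prod>i\<in>{1..n}. M1 i (\<sigma> i))"
      unfolding split using a M \<sigma> by (simp add: M1_def)
    then show "of_int (sign \<sigma>) * (\<Prod>i\<in>{1..n}. M i (\<sigma> i)) =
        p * q * (of_int (sign \<sigma>) * (\<Prod>i\<in>{1..n}. M1 i (\<sigma> i)))" by simp
  qed
  moreover have "leibniz n (\<lambda>i. M1 (transpose a a' i)) = of_int (sign (transpose a a')) * leibniz n M1"
    by (rule leibniz_permute_rows) (use a in \<open>auto intro: permutes_swap_id\<close>)
  moreover have "(\<lambda>i. M1 (transpose a a' i)) = M1"
    by (auto simp: M1_def transpose_def fun_eq_iff)
  ultimately show ?thesis using a by (simp add: sign_swap_id)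
qed

text \<open>
  By the pigeonhole principle every permutation sends one of the rows in \<open>R\<close> to a column
  beyond the \<open>N\<close>-th, so that every term of the Leibniz formula is 0.
\<close>

lemma leibniz_rows_supported:
  assumes "R \<subseteq> {1..n}" "N < card R" "\<And>a b. a \<in> R \<Longrightarrow> b \<in> {1..n} \<Longrightarrow> N < b \<Longrightarrow> M a b = 0"
  shows "leibniz n M = 0"
  unfolding leibniz_def
proof (rule sum.neutral, rule ballI)
  fix \<sigma>
  assume "\<sigma> \<in> {\<sigma>. \<sigma> permutes {1..n}}"
  then have \<sigma>: "\<sigma> permutes {1..n}" by simp
  have "\<exists>a\<in>R. N < \<sigma> a"
  proof (rule ccontr)
    assume "\<not> (\<exists>a\<in>R. N < \<sigma> a)"
    then have "\<sigma> ` R \<subseteq> {1..N}"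
      using assms(1) permutes_in_image[OF \<sigma>] by fastforce
    then have "card R \<le> N"
      using card_mono[of "{1..N}" "\<sigma> ` R"] card_image[of \<sigma> R] permutes_inj_on[OF \<sigma>] by simp
    with assms(2) show False by simp
  qed
  then obtain a where "a \<in> R" "N < \<sigma> a" by blast
  then have "M a (\<sigma> a) = 0" "a \<in> {1..n}"
    using assms permutes_in_image[OF \<sigma>] by blast+
  then have "(\<Prod>a\<in>{1..n}. M a (\<sigma> a)) = 0" by (intro prod_zero) blast+
  then show "of_int (sign \<sigma>) * (\<Prod>a\<in>{1..n}. M a (\<sigma> a)) = 0" by simp
qed

lemma leibniz_eq_det:
  "leibniz n M = det (mat n n (\<lambda>(i, j). M (Suc i) (Suc j)))"
proof -
  have Suc: "bij_betw Suc {0..<n} {1..n}"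
    by (rule bij_betw_imageI) (auto simp: image_Suc_atLeastLessThan)
  have "det (mat n n (\<lambda>(i, j). M (Suc i) (Suc j))) =
      (\<Sum>p | p permutes {0..<n}. signof p * (\<Prod>i = 0..<n. M (Suc i) (Suc (p i))))"
    unfolding det_def
    by (auto intro!: sum.cong prod.cong arg_cong2[where f = "(*)"] simp: permutes_in_image)
  also have "\<dots> = leibniz n M"
    unfolding leibniz_def
  proof (rule sum.reindex_bij_witness[where i = "map_permutation {1..n} (\<lambda>i. i - 1)"
        and j = "map_permutation {0..<n} Suc"])
    have pred: "bij_betw (\<lambda>i. i - 1) {1..n} {0..<n}"
      by (rule bij_betw_byWitness[where f' = Suc]) auto
    show "map_permutation {1..n} (\<lambda>i. i - 1) (map_permutation {0..<n} Suc p) = p"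
      if "p \<in> {p. p permutes {0..<n}}" for p
      by (rule map_permutation_compose_inv[OF Suc]) (use that in auto)
    show "map_permutation {0..<n} Suc (map_permutation {1..n} (\<lambda>i. i - 1) p) = p"
      if "p \<in> {p. p permutes {1..n}}" for p
      by (rule map_permutation_compose_inv[OF pred]) (use that in auto)
    show "map_permutation {0..<n} Suc p \<in> {p. p permutes {1..n}}"
      if "p \<in> {p. p permutes {0..<n}}" for p
      using that map_permutation_permutes[OF Suc] by auto
    show "map_permutation {1..n} (\<lambda>i. i - 1) p \<in> {p. p permutes {0..<n}}"
      if "p \<in> {p. p permutes {1..n}}" for p
      using that map_permutation_permutes[OF pred] by auto
    fix p
    assume p: "p \<in> {p. p permutes {0..<n}}"
    have sgn: "sign (map_permutation {0..<n} Suc p) = sign p"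
      using p by (intro sign_map_permutation) auto
    have "(\<Prod>a = 1..n. M a (map_permutation {0..<n} Suc p a))
        = (\<Prod>i = 0..<n. M (Suc i) (map_permutation {0..<n} Suc p (Suc i)))"
      by (rule prod.reindex_bij_betw[OF Suc, symmetric])
    also have "\<dots> = (\<Prod>i = 0..<n. M (Suc i) (Suc (p i)))"
      by (intro prod.cong refl) (simp add: map_permutation_apply)
    finally show "of_int (sign (map_permutation {0..<n} Suc p)) *
        (\<Prod>a = 1..n. M a (map_permutation {0..<n} Suc p a)) =
        of_int (sign p) * (\<Prod>i = 0..<n. M (Suc i) (Suc (p i)))"
      by (simp add: sgn)
  qed
  finally show ?thesis by simp
qed

lemma leibniz_lower_left_zero:
  fixes M :: "nat \<Rightarrow> nat \<Rightarrow> 'b::idom"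
  assumes "\<And>a b. a \<in> {N<..N + m} \<Longrightarrow> b \<in> {1..N} \<Longrightarrow> M a b = 0"
  shows "leibniz (N + m) M = leibniz N M * leibniz m (\<lambda>a b. M (N + a) (N + b))"
proof -
  let ?f = "\<lambda>(i, j). M (Suc i) (Suc j)"
  let ?A = "mat N N ?f" and ?B = "mat N m (\<lambda>(i, j). M (Suc i) (Suc (N + j)))"
    and ?D = "mat m m (\<lambda>(i, j). M (N + Suc i) (N + Suc j))"
  have "mat (N + m) (N + m) ?f = four_block_mat ?A ?B (0\<^sub>m m N) ?D"
    by (rule eq_matI) (use assms in auto)
  then show ?thesis
    unfolding leibniz_eq_det
    by (simp add: det_four_block_mat_lower_left_zero[of _ N _ m])
qed

text \<open>
  The column operation is the multiplication by a unitriangular matrix.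
\<close>

lemma leibniz_subtract_columns:
  fixes M :: "nat \<Rightarrow> nat \<Rightarrow> 'b::comm_ring_1"
  assumes "N \<noteq> 0"
  shows "leibniz n (\<lambda>a b. if N < b then M a b - M a (b - N) else M a b) = leibniz n M"
proof -
  define U :: "'b mat" where "U = mat n n (\<lambda>(i, j). (if i = j then 1 else 0) - (if N \<le> j \<and> i = j - N then 1 else 0))"
  let ?M = "mat n n (\<lambda>(i, j). M (Suc i) (Suc j))"
  have "mat n n (\<lambda>(i, j). if N < Suc j then M (Suc i) (Suc j) - M (Suc i) (Suc j - N) else M (Suc i) (Suc j))
      = ?M * U"
  proof (rule eq_matI)
    fix i j
    assume "i < dim_row (?M * U)" "j < dim_col (?M * U)"
    then have i: "i < n" and j: "j < n" by (auto simp: U_def)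
    have "(?M * U) $$ (i, j) = (\<Sum>k = 0..<n. M (Suc i) (Suc k) *
        ((if k = j then 1 else 0) - (if N \<le> j \<and> k = j - N then 1 else 0)))"
      using i j by (simp add: U_def scalar_prod_def)
    also have "\<dots> = (\<Sum>k = 0..<n. if k = j then M (Suc i) (Suc k) else 0)
        - (\<Sum>k = 0..<n. if k = j - N then (if N \<le> j then M (Suc i) (Suc k) else 0) else 0)"
      unfolding sum_subtractf[symmetric] by (rule sum.cong) (auto simp: algebra_simps)
    also have "\<dots> = M (Suc i) (Suc j) - (if N \<le> j then M (Suc i) (Suc (j - N)) else 0)"
      using i j less_imp_diff_less[OF j] by (auto simp: sum.delta)
    finally show "mat n n (\<lambda>(i, j). if N < Suc j then M (Suc i) (Suc j) - M (Suc i) (Suc j - N)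
        else M (Suc i) (Suc j)) $$ (i, j) = (?M * U) $$ (i, j)"
      using i j by (auto simp: Suc_diff_le)
  qed (auto simp: U_def)
  moreover have "det U = 1"
  proof -
    have "upper_triangular U" by (auto simp: U_def upper_triangular_def)
    then have "det U = prod_list (diag_mat U)"
      by (rule det_upper_triangular[of _ n]) (auto simp: U_def)
    also have "\<dots> = (\<Prod>i = 0..<n. U $$ (i, i))"
      by (simp add: prod_list_diag_prod) (simp add: U_def)
    also have "\<dots> = 1"
      by (rule prod.neutral) (use assms in \<open>auto simp: U_def\<close>)
    finally show ?thesis .
  qed
  ultimately show ?thesis
    unfolding leibniz_eq_det using det_mult[of ?M n U] by (auto simp: U_def)
qed

text \<open>
  Multiplying by the unitriangular matrix of the coefficients of the Newton polynomials
  \<open>q j = (X - x\<^sub>j\<^sub>+\<^sub>2) \<cdots> (X - x\<^sub>n)\<close>, where \<open>j\<close> counts from 0, makes the matrix triangular, since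
  \<open>q j\<close> vanishes at \<open>x\<^sub>i\<^sub>+\<^sub>1\<close> for \<open>i > j\<close>.
\<close>

lemma vandermonde:
  fixes x :: "nat \<Rightarrow> 'b::idom"
  shows "leibniz n (\<lambda>i j. x i ^ (n - j)) = (\<Prod>i\<in>{1..n}. \<Prod>j\<in>{i<..n}. x i - x j)"
proof -
  define q where "q j = (\<Prod>k\<in>{Suc j<..n}. [:- x k, 1:])" for j
  have deg_q: "degree (q j) = n - Suc j" for j
    unfolding q_def by (subst degree_prod_eq_sum_degree) auto
  have monic: "coeff (q j) (n - Suc j) = 1" for j
    using lead_coeff_prod[of "\<lambda>k. [:- x k, 1:]" "{Suc j<..n}"] deg_q[of j] by (simp add: q_def)
  let ?V = "mat n n (\<lambda>(i, j). x (Suc i) ^ (n - Suc j))"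
  define C where "C = mat n n (\<lambda>(l, j). coeff (q j) (n - Suc l))"
  define Q where "Q = mat n n (\<lambda>(i, j). poly (q j) (x (Suc i)))"
  have "Q = ?V * C"
  proof (rule eq_matI)
    fix i j
    assume "i < dim_row (?V * C)" "j < dim_col (?V * C)"
    then have i: "i < n" and j: "j < n" by (auto simp: C_def)
    have "(?V * C) $$ (i, j) = (\<Sum>l = 0..<n. x (Suc i) ^ (n - Suc l) * coeff (q j) (n - Suc l))"
      using i j by (simp add: C_def scalar_prod_def)
    also have "\<dots> = (\<Sum>k<n. coeff (q j) k * x (Suc i) ^ k)"
      by (subst sum.nat_diff_reindex[symmetric]) (simp add: mult.commute atLeast0LessThan)
    also have "\<dots> = poly (q j) (x (Suc i))"
      unfolding poly_altdef
      by (rule sum.mono_neutral_right) (use deg_q[of j] j in \<open>auto simp: coeff_eq_0\<close>)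
    finally show "Q $$ (i, j) = (?V * C) $$ (i, j)" using i j by (simp add: Q_def)
  qed (auto simp: Q_def C_def)
  then have "det Q = det ?V * det C"
    by (simp add: det_mult[of _ n] C_def)
  moreover have "det C = (\<Prod>i = 0..<n. C $$ (i, i))"
    by (subst det_lower_triangular[of n]) (auto simp: C_def prod_list_diag_prod intro!: coeff_eq_0 simp: deg_q)
  then have "det C = 1" by (simp add: C_def monic)
  moreover have "upper_triangular Q"
    by (auto simp: upper_triangular_def Q_def q_def poly_prod)
  then have "det Q = (\<Prod>i = 0..<n. Q $$ (i, i))"
    by (subst det_upper_triangular[of _ n]) (auto simp: Q_def prod_list_diag_prod)
  then have "det Q = (\<Prod>i = 0..<n. \<Prod>k\<in>{Suc i<..n}. x (Suc i) - x k)"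
    by (simp add: Q_def q_def poly_prod)
  moreover have "\<dots> = (\<Prod>i\<in>{1..n}. \<Prod>j\<in>{i<..n}. x i - x j)"
    by (rule prod.reindex_bij_witness[where i = "\<lambda>i. i - 1" and j = Suc]) auto
  ultimately show ?thesis by (simp add: leibniz_eq_det)
qed

section \<open>The difference operators as sums over sets of shifts\<close>

abbreviation nx :: "nat \<Rightarrow> nat" where "nx n \<equiv> (n + 1) div 2"
abbreviation ny :: "nat \<Rightarrow> nat" where "ny n \<equiv> n div 2"

lemma nx_ny: "nx n + ny n = n" "ny n \<le> nx n" "nx n \<le> ny n + 1"
  by auto

text \<open>
  The rows of the matrices list the odd variables first and then the even ones.
\<close>

definition row_var :: "nat \<Rightarrow> nat \<Rightarrow> nat" where
  "row_var n a = (if a \<le> nx n then 2 * a - 1 else 2 * (a - nx n))"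

definition var_row :: "nat \<Rightarrow> nat \<Rightarrow> nat" where
  "var_row n i = (if odd i then (i + 1) div 2 else nx n + i div 2)"

lemma row_var_var_row: "i \<in> {1..n} \<Longrightarrow> row_var n (var_row n i) = i"
  by (auto simp: row_var_def var_row_def elim!: oddE evenE)

lemma var_row_row_var: "a \<in> {1..n} \<Longrightarrow> var_row n (row_var n a) = a"
  by (auto simp: row_var_def var_row_def)

lemma row_var_in: "a \<in> {1..n} \<Longrightarrow> row_var n a \<in> {1..n}"
  by (auto simp: row_var_def)

lemma var_row_in: "i \<in> {1..n} \<Longrightarrow> var_row n i \<in> {1..n}"
  by (auto simp: var_row_def elim!: oddE evenE)

lemma odd_row_var: "a \<in> {1..n} \<Longrightarrow> odd (row_var n a) \<longleftrightarrow> a \<le> nx n"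
  by (auto simp: row_var_def)

lemma bij_row_var: "bij_betw (row_var n) {1..n} {1..n}"
  by (rule bij_betw_byWitness[where f' = "var_row n"])
    (use row_var_var_row var_row_row_var row_var_in var_row_in in blast)+

lemma row_var_eq_iff: "a \<in> {1..n} \<Longrightarrow> b \<in> {1..n} \<Longrightarrow> row_var n a = row_var n b \<longleftrightarrow> a = b"
  using bij_row_var[of n] by (metis bij_betw_def inj_onD)

lemma bij_var_row: "bij_betw (var_row n) {1..n} {1..n}"
  by (rule bij_betw_byWitness[where f' = "row_var n"])
    (use row_var_var_row var_row_row_var row_var_in var_row_in in blast)+

lemma mem_image_row_var_iff:
  assumes "i \<in> {1..n}" "S \<subseteq> {1..n}"
  shows "i \<in> row_var n ` S \<longleftrightarrow> var_row n i \<in> S"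
proof
  assume "i \<in> row_var n ` S"
  then obtain a where a: "a \<in> S" "i = row_var n a" by blast
  then have "a \<in> {1..n}" using assms(2) by blast
  from var_row_row_var[OF this] show "var_row n i \<in> S" using a by simp
next
  assume "var_row n i \<in> S"
  with row_var_var_row[OF assms(1)] show "i \<in> row_var n ` S" by (metis imageI)
qed

text \<open>
  The coefficients of the two operators in one formula that makes sense in every commutative
  ring: \<open>coef e n r t s a b v\<close> is the coefficient in row \<open>a\<close> and column \<open>b\<close> of \<open>T\<close> (if \<open>s\<close>) or of
  the identity (if \<open>\<not> s\<close>) of the matrix of \<open>X\<close> (if \<open>e\<close>) or \<open>Y\<close> (if \<open>\<not> e\<close>). Being polynomial in
  \<open>r\<close>, \<open>t\<close> and \<open>v\<close>, it commutes with all ring homomorphisms.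
\<close>

definition coef :: "bool \<Rightarrow> nat \<Rightarrow> 'b::comm_ring_1 \<Rightarrow> 'b \<Rightarrow> bool \<Rightarrow> nat \<Rightarrow> nat \<Rightarrow> 'b \<Rightarrow> 'b" where
  "coef e n r t s a b v =
    (if e then
       (if a \<le> nx n then
          (if b \<le> nx n then (if s then - (v ^ (nx n + 1 - b)) else (v + t) * (v + r) ^ (nx n - b))
           else (if s then - (v ^ (nx n - (b - nx n))) else 0))
        else
          (if b \<le> nx n then (if s then - (v ^ (ny n + 1 - b)) else (v + r) ^ (ny n + 1 - b))
           else (if s then 0 else (v + r) ^ (ny n - (b - nx n)))))
     else
       (if a \<le> nx n then
          (if b \<le> nx n then (if s then 0 else (v + r) ^ (nx n - b))
           else (if s then - (v ^ (nx n - (b - nx n))) else (v + r) ^ (nx n - (b - nx n))))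
        else
          (if b \<le> nx n then (if s then - (v ^ (ny n + 1 - b)) else 0)
           else (if s then - (v ^ (ny n + 1 - (b - nx n)))
                 else (v + t) * (v + r) ^ (ny n - (b - nx n))))))"

lemma hom_coef:
  assumes "comm_ring_hom h"
  shows "h (coef e n r t s a b v) = coef e n (h r) (h t) s a b (h v)"
proof -
  interpret comm_ring_hom h by fact
  show ?thesis by (simp add: coef_def hom_mult hom_add hom_power hom_uminus)
qed

lemma coef_row_class:
  "(a \<le> nx n \<longleftrightarrow> a' \<le> nx n) \<Longrightarrow> s = s' \<Longrightarrow> coef e n r t s a b v = coef e n r t s' a' b v"
  by (simp add: coef_def)

definition backshift :: "nat \<Rightarrow> 'a::comm_ring_1 mpol \<Rightarrow> 'a mpol" where
  "backshift v = substitute (\<lambda>j. if j = v then Var j - 1 else Var j)"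

lemma subst_hom_backshift:
  assumes "comm_ring_hom h"
  shows "subst_hom h z (backshift v p) = subst_hom h (\<lambda>i. z i - (if i = v then 1 else 0)) p"
proof -
  interpret comm_ring_hom "subst_hom h z" by (rule subst_hom_ring_hom[OF assms])
  have "subst_hom h z (if i = v then Var i - 1 else Var i) = z i - (if i = v then 1 else 0)" for i
    by (simp add: hom_minus subst_hom_Var comm_ring_hom_zero_one[OF assms])
  then show ?thesis
    unfolding backshift_def by (simp add: subst_hom_substitute[OF assms])
qed

definition entry :: "bool \<Rightarrow> nat \<Rightarrow> 'a::comm_ring_1 \<Rightarrow> 'a \<Rightarrow> nat \<Rightarrow> nat \<Rightarrow> 'a mpol \<Rightarrow> 'a mpol" where
  "entry e n r t a b f =
     coef e n (Const r) (Const t) False a b (Var (row_var n a)) * f +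
     coef e n (Const r) (Const t) True a b (Var (row_var n a)) * backshift (row_var n a) f"

text \<open>\<open>\<phi> X(t)\<close> or \<open>\<phi> Y(t)\<close>, with \<open>t\<close> specialised to an element of the base ring.\<close>

definition det_op :: "bool \<Rightarrow> nat \<Rightarrow> 'a::comm_ring_1 \<Rightarrow> 'a \<Rightarrow> 'a mpol \<Rightarrow> 'a mpol" where
  "det_op e n r t = op_det n (entry e n r t)"

definition coef_matrix ::
    "bool \<Rightarrow> nat \<Rightarrow> 'b::comm_ring_1 \<Rightarrow> 'b \<Rightarrow> nat set \<Rightarrow> (nat \<Rightarrow> 'b) \<Rightarrow> nat \<Rightarrow> nat \<Rightarrow> 'b" where
  "coef_matrix e n r t S z a b = coef e n r t (a \<in> S) a b (z (row_var n a))"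

definition shifted :: "nat \<Rightarrow> nat set \<Rightarrow> (nat \<Rightarrow> 'b::comm_ring_1) \<Rightarrow> nat \<Rightarrow> 'b" where
  "shifted n S z i = z i - (if i \<in> row_var n ` S then 1 else 0)"

lemma shifted_insert:
  assumes "insert a S \<subseteq> {1..n}" "a \<notin> S"
  shows "shifted n S (\<lambda>i. z i - (if i = row_var n a then 1 else 0)) = shifted n (insert a S) z"
proof -
  have "row_var n a \<notin> row_var n ` S"
    using assms row_var_eq_iff[of a n] by blast
  then show ?thesis by (auto simp: shifted_def fun_eq_iff)
qed

lemma foldr_entries_expansion:
  assumes h: "comm_ring_hom h" and xs: "distinct xs" "set xs \<subseteq> {1..n}"
  shows "subst_hom h z (foldr (\<lambda>a F. entry e n r t a (\<sigma> a) \<circ> F) xs id f) =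
    (\<Sum>S\<in>Pow (set xs). (\<Prod>a\<in>set xs. coef_matrix e n (h r) (h t) S z a (\<sigma> a)) *
       subst_hom h (shifted n S z) f)"
  using xs
proof (induction xs arbitrary: z)
  case Nil
  show ?case by (simp add: shifted_def)
next
  case (Cons a xs)
  interpret h: comm_ring_hom h by (rule h)
  interpret H: comm_ring_hom "subst_hom h z" by (rule subst_hom_ring_hom[OF h])
  let ?G = "foldr (\<lambda>a F. entry e n r t a (\<sigma> a) \<circ> F) xs id f"
  let ?z' = "\<lambda>i. z i - (if i = row_var n a then 1 else 0)"
  let ?c = "\<lambda>s. coef e n (h r) (h t) s a (\<sigma> a) (z (row_var n a))"
  let ?term = "\<lambda>z S. (\<Prod>a\<in>set xs. coef_matrix e n (h r) (h t) S z a (\<sigma> a)) * subst_hom h (shifted n S z) f"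
  let ?full = "\<lambda>S. (\<Prod>a\<in>set (a # xs). coef_matrix e n (h r) (h t) S z a (\<sigma> a)) *
    subst_hom h (shifted n S z) f"
  have a: "a \<notin> set xs" "a \<in> {1..n}" and xs: "distinct xs" "set xs \<subseteq> {1..n}"
    using Cons.prems by auto
  have coef: "subst_hom h z (coef e n (Const r) (Const t) s a (\<sigma> a) (Var (row_var n a))) = ?c s" for s
    by (simp add: hom_coef[OF subst_hom_ring_hom[OF h]] subst_hom_Const subst_hom_Var)
  have "subst_hom h z (entry e n r t a (\<sigma> a) ?G) =
      ?c False * subst_hom h z ?G + ?c True * subst_hom h ?z' ?G"
    by (simp add: entry_def H.hom_add H.hom_mult coef subst_hom_backshift[OF h])
  also have "\<dots> = (\<Sum>S\<in>Pow (set xs). ?c False * ?term z S) + (\<Sum>S\<in>Pow (set xs). ?c True * ?term ?z' S)"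
    by (simp add: Cons.IH[OF xs] sum_distrib_left)
  also have "(\<Sum>S\<in>Pow (set xs). ?c False * ?term z S) =
      (\<Sum>S\<in>Pow (set xs). ?full S)"
  proof (rule sum.cong[OF refl])
    fix S
    assume "S \<in> Pow (set xs)"
    then have "a \<notin> S" using a by auto
    then show "?c False * ?term z S = ?full S"
      using a by (simp add: coef_matrix_def mult.assoc)
  qed
  also have "(\<Sum>S\<in>Pow (set xs). ?c True * ?term ?z' S) =
      (\<Sum>S\<in>insert a ` Pow (set xs). ?full S)"
  proof (subst sum.reindex)
    show "inj_on (insert a) (Pow (set xs))"
      using a(1) by (intro inj_onI) (metis Pow_iff insert_ident subsetD)
    have "?c True * ?term ?z' S = ?full (insert a S)" if S: "S \<subseteq> set xs" for S
    proof -
      have "(\<Prod>a\<in>set xs. coef_matrix e n (h r) (h t) S ?z' a (\<sigma> a)) =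
          (\<Prod>a'\<in>set xs. coef_matrix e n (h r) (h t) (insert a S) z a' (\<sigma> a'))"
      proof (rule prod.cong[OF refl])
        fix a'
        assume "a' \<in> set xs"
        then have "a' \<noteq> a" "row_var n a' \<noteq> row_var n a"
          using a xs row_var_eq_iff[of a' n a] by blast+
        then show "coef_matrix e n (h r) (h t) S ?z' a' (\<sigma> a') =
            coef_matrix e n (h r) (h t) (insert a S) z a' (\<sigma> a')"
          by (simp add: coef_matrix_def)
      qed
      moreover have "shifted n S ?z' = shifted n (insert a S) z"
        by (rule shifted_insert) (use S a xs in auto)
      ultimately show ?thesis using a by (simp add: coef_matrix_def mult.assoc)
    qed
    then show "(\<Sum>S\<in>Pow (set xs). ?c True * ?term ?z' S) = sum (?full \<circ> insert a) (Pow (set xs))"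
      by (intro sum.cong) auto
  qed
  also have "(\<Sum>S\<in>Pow (set xs). ?full S) +
      (\<Sum>S\<in>insert a ` Pow (set xs). ?full S) =
      (\<Sum>S\<in>Pow (set (a # xs)). ?full S)"
    by (simp add: Pow_insert, rule sum.union_disjoint[symmetric]) (use a in auto)
  finally show ?case by simp
qed

text \<open>
  Expanding the product of the rows over the choice, in every row, of the identity or the shift
  gives \<open>\<Sum>\<^sub>S c\<^sub>S T\<^sub>S\<close> where \<open>c\<^sub>S\<close> is an ordinary determinant. The formula is evaluated in an
  arbitrary ring: with scalar values it gives the values of \<open>det_op f\<close>, with polynomial values
  its behaviour under substitutions, and with a non-identical \<open>h\<close> under a change of base ring.
\<close>

lemma det_op_expansion:
  assumes h: "comm_ring_hom h"
  shows "subst_hom h z (det_op e n r t f) =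
    (\<Sum>S\<in>Pow {1..n}. leibniz n (coef_matrix e n (h r) (h t) S z) * subst_hom h (shifted n S z) f)"
proof -
  interpret H: comm_ring_hom "subst_hom h z" by (rule subst_hom_ring_hom[OF h])
  have set: "set [1..<Suc n] = {1..n}" by auto
  have sgn: "subst_hom h z (of_int (sign \<sigma>)) = of_int (sign \<sigma>)" for \<sigma> :: "nat \<Rightarrow> nat"
    by (simp add: sign_def H.hom_uminus)
  have "subst_hom h z (det_op e n r t f) =
      (\<Sum>\<sigma> | \<sigma> permutes {1..n}. of_int (sign \<sigma>) *
        (\<Sum>S\<in>Pow {1..n}. (\<Prod>a\<in>{1..n}. coef_matrix e n (h r) (h t) S z a (\<sigma> a)) *
          subst_hom h (shifted n S z) f))"
    unfolding det_op_def op_det_def H.hom_sum H.hom_mult sgn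
    using foldr_entries_expansion[OF h, of "[1..<Suc n]" n, unfolded set] by simp
  also have "\<dots> = (\<Sum>S\<in>Pow {1..n}. \<Sum>\<sigma> | \<sigma> permutes {1..n}. of_int (sign \<sigma>) *
      (\<Prod>a\<in>{1..n}. coef_matrix e n (h r) (h t) S z a (\<sigma> a)) * subst_hom h (shifted n S z) f)"
    unfolding sum_distrib_left by (subst sum.swap) (simp add: mult.assoc)
  also have "\<dots> = (\<Sum>S\<in>Pow {1..n}. leibniz n (coef_matrix e n (h r) (h t) S z) * subst_hom h (shifted n S z) f)"
    by (simp add: leibniz_def sum_distrib_right)
  finally show ?thesis .
qed

lemma poly_map_poly_hom_fixed:
  assumes "comm_ring_hom T" "T c = c"
  shows "poly (map_poly T F) c = T (poly F c)"
proof -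
  interpret comm_ring_hom T by fact
  show ?thesis
    by (induction F) (auto simp: map_poly_pCons hom_add hom_mult assms(2))
qed

lemma poly_op_det:
  assumes "\<And>a b F. a \<in> {1..n} \<Longrightarrow> b \<in> {1..n} \<Longrightarrow> poly (A a b F) c = B a b (poly F c)"
  shows "poly (op_det n A F) c = op_det n B (poly F c)"
proof -
  interpret comm_ring_hom "\<lambda>F. poly F c" by (rule poly_eval_hom)
  have sgn: "poly (of_int (sign \<sigma>)) c = of_int (sign \<sigma>)" for \<sigma> :: "nat \<Rightarrow> nat"
    by (simp add: sign_def)
  have foldr: "poly (foldr (\<lambda>a F. A a (\<sigma> a) \<circ> F) xs id F) c = foldr (\<lambda>a F. B a (\<sigma> a) \<circ> F) xs id (poly F c)"
    if "set xs \<subseteq> {1..n}" "\<sigma> permutes {1..n}" for xs \<sigma>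
    using that(1)
  proof (induction xs)
    case (Cons a xs)
    moreover have "\<sigma> a \<in> {1..n}" using Cons.prems permutes_in_image[OF that(2), of a] by simp
    ultimately show ?case using assms by simp
  qed simp
  show ?thesis
    unfolding op_det_def hom_sum hom_mult sgn
    by (rule sum.cong[OF refl]) (subst foldr, auto)
qed

lemma poly_shift: "poly (shift i F) (Const c) = backshift i (poly F (Const c))"
  unfolding shift_def backshift_def by (rule poly_map_poly_hom_fixed[OF substitute_ring_hom]) simp

lemma poly_det_matX: "poly (op_det n (matX n r) F) (Const c) = det_op True n r c (poly F (Const c))"
  unfolding det_op_def
proof (rule poly_op_det)
  fix a b :: nat and F
  show "poly (matX n r a b F) (Const c) = entry True n r c a b (poly F (Const c))"
    by (simp add: matX_def entry_def coef_def row_var_def Let_def poly_shift algebra_simps)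
qed

lemma poly_det_matY: "poly (op_det n (matY n r) F) (Const c) = det_op False n r c (poly F (Const c))"
  unfolding det_op_def
proof (rule poly_op_det)
  fix a b :: nat and F
  show "poly (matY n r a b F) (Const c) = entry False n r c a b (poly F (Const c))"
    by (simp add: matY_def entry_def coef_def row_var_def Let_def poly_shift algebra_simps)
qed

lemma det_op_cong:
  assumes h: "comm_ring_hom h" and f: "f \<in> polys n" and z: "\<And>i. i \<in> {1..n} \<Longrightarrow> z i = z' i"
  shows "subst_hom h z (det_op e n r t f) = subst_hom h z' (det_op e n r t f)"
  unfolding det_op_expansion[OF h]
proof (intro sum.cong refl arg_cong2[where f = "(*)"])
  fix S
  show "leibniz n (coef_matrix e n (h r) (h t) S z) = leibniz n (coef_matrix e n (h r) (h t) S z')"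
    by (rule leibniz_cong) (unfold coef_matrix_def, subst z[OF row_var_in], auto)
  show "subst_hom h (shifted n S z) f = subst_hom h (shifted n S z') f"
    by (rule subst_hom_cong_polys[OF f]) (simp add: shifted_def z)
qed

lemma det_op_polys:
  assumes "f \<in> polys n"
  shows "det_op e n r t f \<in> polys n"
proof -
  have "substitute (\<lambda>i. if i \<in> {1..n} then Var i else 0) (det_op e n r t f) =
      substitute Var (det_op e n r t f)"
    unfolding substitute_def by (rule det_op_cong[OF Const_hom assms]) simp
  then show ?thesis by (simp add: polys_iff_truncate)
qed

section \<open>The operators do not raise degrees beyond that of \<open>\<phi>\<close>\<close>

lemma deg_le_diff_powers:
  fixes v :: "'a::comm_ring_1 mpol"
  assumes "deg_le 1 v"
  shows "deg_le (int m - 1) ((v + Const c) ^ m - v ^ m)"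
proof (induction m)
  case (Suc m)
  have w: "deg_le 1 (v + Const c)"
    using assms deg_le_mono[OF deg_le_Const, of 1 c] by (auto intro: deg_le_add)
  have "deg_le (1 + (int m - 1)) (v * ((v + Const c) ^ m - v ^ m))"
    by (rule deg_le_mult[OF assms Suc])
  moreover have "deg_le (int m * 1) (Const c * (v + Const c) ^ m)"
    by (rule deg_le_Const_mult[OF deg_le_power[OF w]])
  moreover have "(v + Const c) ^ Suc m - v ^ Suc m =
      v * ((v + Const c) ^ m - v ^ m) + Const c * (v + Const c) ^ m"
    by (simp add: algebra_simps)
  ultimately show ?case using deg_le_add[of "int m"] by simp
qed simp

lemma deg_le_linear_mult_diff_power:
  fixes v :: "'a::comm_ring_1 mpol"
  assumes "deg_le 1 v"
  shows "deg_le (int m) ((v + Const t) * (v + Const c) ^ m - v ^ Suc m)"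
proof -
  have w: "deg_le 1 (v + Const c)"
    using assms deg_le_mono[OF deg_le_Const, of 1 c] by (auto intro: deg_le_add)
  have "deg_le (1 + (int m - 1)) (v * ((v + Const c) ^ m - v ^ m))"
    by (rule deg_le_mult[OF assms deg_le_diff_powers[OF assms]])
  moreover have "deg_le (int m * 1) (Const t * (v + Const c) ^ m)"
    by (rule deg_le_Const_mult[OF deg_le_power[OF w]])
  moreover have "(v + Const t) * (v + Const c) ^ m - v ^ Suc m =
      v * ((v + Const c) ^ m - v ^ m) + Const t * (v + Const c) ^ m"
    by (simp add: algebra_simps)
  ultimately show ?thesis using deg_le_add[of "int m"] by simp
qed

text \<open>
  The degree of an entry splits into a contribution of the row and one of the column. For \<open>Y\<close>
  the entries below the diagonal blocks have a degree that is one too large, which is made up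
  for by the entries above them: the sum over a permutation does not depend on the permutation.
\<close>

definition row_weight :: "bool \<Rightarrow> nat \<Rightarrow> nat \<Rightarrow> int" where
  "row_weight e n a = (if a \<le> nx n then int (nx n) else int (ny n) + (if e then 0 else 1))"

definition col_weight :: "bool \<Rightarrow> nat \<Rightarrow> nat \<Rightarrow> int" where
  "col_weight e n b = (if b \<le> nx n then - int b else - int (b - nx n) - (if e then 0 else 1))"

lemma deg_le_entry:
  fixes f :: "'a::comm_ring_1 mpol"
  assumes a: "a \<in> {1..n}" and b: "b \<in> {1..n}" and f: "deg_le d f"
  shows "deg_le (d + (row_weight e n a + col_weight e n b)) (entry e n r t a b f)"
proof -
  define v where "v = (Var (row_var n a) :: 'a mpol)"
  have v: "deg_le 1 v" by (simp add: v_def deg_le_Var)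
  have w: "deg_le 1 (v + Const r)"
    using v deg_le_mono[OF deg_le_Const, of 1 r] by (auto intro: deg_le_add)
  let ?c = "\<lambda>s. coef e n (Const r) (Const t) s a b v"
  define k where "k = row_weight e n a + col_weight e n b"
  have pw: "deg_le (int m) (v ^ m)" "deg_le (int m) ((v + Const r) ^ m)" for m
    using deg_le_power[OF v, of m] deg_le_power[OF w, of m] by simp_all
  have c1: "deg_le (k + 1) (?c True)"
    using a b by (auto simp: coef_def k_def row_weight_def col_weight_def
        intro!: deg_le_uminus deg_le_mono[OF pw(1)])
  note y = deg_le_diff_powers[OF v, where c = r] and x = deg_le_linear_mult_diff_power[OF v, where c = r and t = t]
  note weights = k_def row_weight_def col_weight_def of_nat_diff if_True if_False
  have le: "b \<le> nx n \<Longrightarrow> b \<le> ny n + 1" "\<not> b \<le> nx n \<Longrightarrow> b - nx n \<le> ny n" and MN: "ny n \<le> nx n"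
    using b nx_ny[of n] unfolding atLeastAtMost_iff by linarith+
  have c0I: "deg_le k (?c False + ?c True)" if "?c False + ?c True = p" "deg_le j p" "j \<le> k" for p j
    unfolding that(1) by (rule deg_le_mono[OF that(2,3)])
  have c0: "deg_le k (?c False + ?c True)"
  proof (cases "a \<le> nx n"; cases "b \<le> nx n"; cases e)
    assume *: "a \<le> nx n" "b \<le> nx n" "e"
    then have s: "nx n + 1 - b = Suc (nx n - b)" by linarith
    show ?thesis
      by (rule c0I[OF _ x[of "nx n - b"]])
        (use * in \<open>simp only: coef_def if_True if_False s, simp\<close>, use * le(1)[OF *(2)] MN in \<open>simp only: weights; linarith\<close>)
  next
    assume *: "a \<le> nx n" "b \<le> nx n" "\<not> e"
    show ?thesis
      by (rule c0I[OF _ pw(2)[of "nx n - b"]])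
        (use * in \<open>simp only: coef_def if_True if_False, simp\<close>, use * le(1)[OF *(2)] MN in \<open>simp only: weights; linarith\<close>)
  next
    assume *: "a \<le> nx n" "\<not> b \<le> nx n" "e"
    show ?thesis
      by (rule c0I[OF _ deg_le_uminus[OF pw(1)[of "nx n - (b - nx n)"]]])
        (use * in \<open>simp only: coef_def if_True if_False, simp\<close>, use * le(2)[OF *(2)] MN in \<open>simp only: weights; linarith\<close>)
  next
    assume *: "a \<le> nx n" "\<not> b \<le> nx n" "\<not> e"
    show ?thesis
      by (rule c0I[OF _ y[of "nx n - (b - nx n)"]])
        (use * in \<open>simp only: coef_def if_True if_False, simp\<close>, use * le(2)[OF *(2)] MN in \<open>simp only: weights; linarith\<close>)
  next
    assume *: "\<not> a \<le> nx n" "b \<le> nx n" "e"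
    show ?thesis
      by (rule c0I[OF _ y[of "ny n + 1 - b"]])
        (use * in \<open>simp only: coef_def if_True if_False, simp\<close>, use * le(1)[OF *(2)] MN in \<open>simp only: weights; linarith\<close>)
  next
    assume *: "\<not> a \<le> nx n" "b \<le> nx n" "\<not> e"
    show ?thesis
      by (rule c0I[OF _ deg_le_uminus[OF pw(1)[of "ny n + 1 - b"]]])
        (use * in \<open>simp only: coef_def if_True if_False, simp\<close>, use * le(1)[OF *(2)] MN in \<open>simp only: weights; linarith\<close>)
  next
    assume *: "\<not> a \<le> nx n" "\<not> b \<le> nx n" "e"
    show ?thesis
      by (rule c0I[OF _ pw(2)[of "ny n - (b - nx n)"]])
        (use * in \<open>simp only: coef_def if_True if_False, simp\<close>, use * le(2)[OF *(2)] MN in \<open>simp only: weights; linarith\<close>)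
  next
    assume *: "\<not> a \<le> nx n" "\<not> b \<le> nx n" "\<not> e"
    have s: "ny n + 1 - (b - nx n) = Suc (ny n - (b - nx n))" using le(2)[OF *(2)] by linarith
    show ?thesis
      by (rule c0I[OF _ x[of "ny n - (b - nx n)"]])
        (use * in \<open>simp only: coef_def if_True if_False s, simp\<close>, use * le(2)[OF *(2)] MN in \<open>simp only: weights; linarith\<close>)
  qed
  \<comment> \<open>Split the entry as \<open>(c\<^sub>0 + c\<^sub>1) f - c\<^sub>1 (f - T f)\<close>: the leading terms of the coefficients
    cancel in the first summand, and \<open>f - T f\<close> has lower degree than \<open>f\<close>.\<close>
  have "deg_le (k + d) ((?c False + ?c True) * f)"
    by (rule deg_le_mult[OF c0 f])
  moreover have "deg_le ((k + 1) + (d - 1)) (?c True * (f - backshift (row_var n a) f))"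
    unfolding backshift_def by (rule deg_le_mult[OF c1 deg_le_diff_shift[OF f]])
  moreover have "entry e n r t a b f =
      (?c False + ?c True) * f - ?c True * (f - backshift (row_var n a) f)"
    by (simp add: entry_def v_def algebra_simps)
  ultimately show ?thesis
    using deg_le_diff[of "k + d"] by (simp add: k_def add.commute)
qed

lemma sum_rows:
  fixes g :: "nat \<Rightarrow> int"
  shows "(\<Sum>a\<in>{1..n}. g a) = (\<Sum>i\<in>{1..nx n}. g i) + (\<Sum>j\<in>{1..ny n}. g (nx n + j))"
proof -
  have "{1..n} = {1..nx n} \<union> {nx n + 1..nx n + ny n}" using nx_ny(1)[of n] by auto
  moreover have "(\<Sum>a\<in>{nx n + 1..nx n + ny n}. g a) = (\<Sum>j\<in>{1..ny n}. g (nx n + j))"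
    by (rule sum.reindex_bij_witness[where i = "\<lambda>j. nx n + j" and j = "\<lambda>a. a - nx n"]) auto
  ultimately show ?thesis by (simp add: sum.union_disjoint)
qed

definition same_parity_pairs :: "nat \<Rightarrow> (nat \<times> nat) set" where
  "same_parity_pairs n = {(i, j). 1 \<le> i \<and> i < j \<and> j \<le> n \<and> even (j - i)}"

lemma finite_same_parity_pairs [simp]: "finite (same_parity_pairs n)"
  by (rule finite_subset[of _ "{1..n} \<times> {1..n}"]) (auto simp: same_parity_pairs_def)

lemma prod_same_parity_pairs:
  fixes g :: "nat \<Rightarrow> nat \<Rightarrow> 'b::comm_monoid_mult"
  shows "(\<Prod>(i, j)\<in>same_parity_pairs n. g i j) =
    (\<Prod>i\<in>{1..nx n}. \<Prod>j\<in>{i<..nx n}. g (2 * i - 1) (2 * j - 1)) *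
    (\<Prod>i\<in>{1..ny n}. \<Prod>j\<in>{i<..ny n}. g (2 * i) (2 * j))"
proof -
  let ?O = "{(i, j). (i, j) \<in> same_parity_pairs n \<and> odd i}"
  let ?E = "{(i, j). (i, j) \<in> same_parity_pairs n \<and> even i}"
  have "same_parity_pairs n = ?O \<union> ?E" "?O \<inter> ?E = {}" by auto
  moreover have "finite ?O" "finite ?E"
    by (auto intro: finite_subset[OF _ finite_same_parity_pairs[of n]])
  ultimately have "(\<Prod>(i, j)\<in>same_parity_pairs n. g i j) = (\<Prod>(i, j)\<in>?O. g i j) * (\<Prod>(i, j)\<in>?E. g i j)"
    using prod.union_disjoint[of ?O ?E "\<lambda>(i, j). g i j"] by simp
  also have "(\<Prod>(i, j)\<in>?O. g i j) = (\<Prod>(i, j)\<in>Sigma {1..nx n} (\<lambda>i. {i<..nx n}). g (2 * i - 1) (2 * j - 1))"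
    by (rule prod.reindex_bij_witness[where i = "\<lambda>(i, j). (2 * i - 1, 2 * j - 1)"
          and j = "\<lambda>(i, j). ((i + 1) div 2, (j + 1) div 2)"])
      (auto simp: same_parity_pairs_def elim!: oddE)
  also have "(\<Prod>(i, j)\<in>?E. g i j) = (\<Prod>(i, j)\<in>Sigma {1..ny n} (\<lambda>i. {i<..ny n}). g (2 * i) (2 * j))"
    by (rule prod.reindex_bij_witness[where i = "\<lambda>(i, j). (2 * i, 2 * j)"
          and j = "\<lambda>(i, j). (i div 2, j div 2)"])
      (auto simp: same_parity_pairs_def elim!: evenE)
  finally show ?thesis by (simp add: prod.Sigma)
qed

lemma card_same_parity_pairs:
  "card (same_parity_pairs n) = (\<Sum>i\<in>{1..nx n}. nx n - i) + (\<Sum>i\<in>{1..ny n}. ny n - i)"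
proof -
  \<comment> \<open>count by taking all factors in the product formula equal to 2\<close>
  have "(2::nat) ^ card (same_parity_pairs n) = (\<Prod>(i, j)\<in>same_parity_pairs n. 2)"
    by (simp add: case_prod_unfold)
  also have "\<dots> = (\<Prod>i\<in>{1..nx n}. 2 ^ (nx n - i)) * (\<Prod>i\<in>{1..ny n}. 2 ^ (ny n - i))"
    unfolding prod_same_parity_pairs by simp
  also have "\<dots> = 2 ^ ((\<Sum>i\<in>{1..nx n}. nx n - i) + (\<Sum>i\<in>{1..ny n}. ny n - i))"
    by (simp add: power_add power_sum)
  finally show ?thesis by simp
qed

lemma total_weight:
  "(\<Sum>a\<in>{1..n}. row_weight e n a) + (\<Sum>b\<in>{1..n}. col_weight e n b) = int (card (same_parity_pairs n))"
proof -
  define N where "N = nx n"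
  define M where "M = ny n"
  define \<delta> :: int where "\<delta> = (if e then 0 else 1)"
  have 1: "(\<Sum>a\<in>{1..n}. row_weight e n a) = (\<Sum>i\<in>{1..N}. int N) + (\<Sum>i\<in>{1..M}. int M + \<delta>)"
  proof -
    have "(\<Sum>i\<in>{1..N}. row_weight e n i) = (\<Sum>i\<in>{1..N}. int N)"
      by (rule sum.cong) (simp_all add: row_weight_def N_def)
    moreover have "(\<Sum>i\<in>{1..M}. row_weight e n (N + i)) = (\<Sum>i\<in>{1..M}. int M + \<delta>)"
      by (rule sum.cong) (simp_all add: row_weight_def N_def M_def \<delta>_def)
    ultimately show ?thesis unfolding sum_rows[of _ n] N_def M_def by simp
  qed
  have 2: "(\<Sum>a\<in>{1..n}. col_weight e n a) = (\<Sum>i\<in>{1..N}. - int i) + (\<Sum>i\<in>{1..M}. - int i - \<delta>)"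
  proof -
    have "(\<Sum>i\<in>{1..N}. col_weight e n i) = (\<Sum>i\<in>{1..N}. - int i)"
      by (rule sum.cong) (simp_all add: col_weight_def N_def)
    moreover have "(\<Sum>i\<in>{1..M}. col_weight e n (N + i)) = (\<Sum>i\<in>{1..M}. - int i - \<delta>)"
      by (rule sum.cong) (simp_all add: col_weight_def N_def M_def \<delta>_def)
    ultimately show ?thesis unfolding sum_rows[of _ n] N_def M_def by simp
  qed
  have diff: "(\<Sum>i\<in>{1..k}. int k) + (\<Sum>i\<in>{1..k}. - int i) = int (\<Sum>i\<in>{1..k}. k - i)" for k
    unfolding sum.distrib[symmetric] of_nat_sum by (rule sum.cong) (auto simp: of_nat_diff)
  have "(\<Sum>i\<in>{1..M}. int M + \<delta>) + (\<Sum>i\<in>{1..M}. - int i - \<delta>) = (\<Sum>i\<in>{1..M}. int M) + (\<Sum>i\<in>{1..M}. - int i)"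
    unfolding sum.distrib[symmetric] by (rule sum.cong) auto
  then show ?thesis
    unfolding 1 2 card_same_parity_pairs N_def[symmetric] M_def[symmetric] of_nat_add
    using diff[of N] diff[of M] by linarith
qed

lemma deg_le_foldr_entries:
  fixes f :: "'a::comm_ring_1 mpol"
  assumes f: "deg_le d f" and \<sigma>: "\<And>a. a \<in> {1..n} \<Longrightarrow> \<sigma> a \<in> {1..n}"
    and xs: "set xs \<subseteq> {1..n}" "distinct xs"
  shows "deg_le (d + (\<Sum>a\<in>set xs. row_weight e n a + col_weight e n (\<sigma> a)))
    (foldr (\<lambda>a F. entry e n r t a (\<sigma> a) \<circ> F) xs id f)"
  using xs
proof (induction xs)
  case Nil
  show ?case using f by simp
next
  case (Cons a xs)
  let ?w = "\<lambda>a. row_weight e n a + col_weight e n (\<sigma> a)"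
  have a: "a \<in> {1..n}" "a \<notin> set xs" and xs: "set xs \<subseteq> {1..n}" "distinct xs"
    using Cons.prems by auto
  have "(d + sum ?w (set xs)) + ?w a = d + sum ?w (set (a # xs))"
    using a(2) by simp
  with deg_le_entry[OF a(1) \<sigma>[OF a(1)] Cons.IH[OF xs], of e r t] show ?case
    by (simp only: foldr.simps o_apply)
qed

lemma deg_le_det_op:
  fixes f :: "'a::comm_ring_1 mpol"
  assumes "deg_le d f"
  shows "deg_le (d + int (card (same_parity_pairs n))) (det_op e n r t f)"
  unfolding det_op_def op_det_def
proof (rule deg_le_sum)
  fix \<sigma>
  assume "\<sigma> \<in> {\<sigma>. \<sigma> permutes {1..n}}"
  then have \<sigma>: "\<sigma> permutes {1..n}" by simp
  have set: "set [1..<Suc n] = {1..n}" by auto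
  have "deg_le (d + (\<Sum>a\<in>set [1..<Suc n]. row_weight e n a + col_weight e n (\<sigma> a)))
      (foldr (\<lambda>a F. entry e n r t a (\<sigma> a) \<circ> F) [1..<Suc n] id f)"
    by (rule deg_le_foldr_entries[OF assms])
      (use permutes_in_image[OF \<sigma>] in \<open>simp_all only: set order_refl distinct_upt\<close>)
  moreover have "(\<Sum>a\<in>{1..n}. row_weight e n a + col_weight e n (\<sigma> a)) = int (card (same_parity_pairs n))"
    using total_weight[where n = n and e = e] sum.permute[OF \<sigma>, of "col_weight e n"]
    by (simp only: sum.distrib o_def)
  ultimately have *: "deg_le (d + int (card (same_parity_pairs n)))
      (foldr (\<lambda>a F. entry e n r t a (\<sigma> a) \<circ> F) [1..<Suc n] id f)"
    by (simp only: set)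
  have "deg_le k (of_int (sign \<sigma>) * p)" if "deg_le k p" for k and p :: "'a mpol"
    using that deg_le_uminus[OF that] by (cases "evenperm \<sigma>") (simp_all add: sign_def)
  from this[OF *] show "deg_le (d + int (card (same_parity_pairs n)))
      (of_int (sign \<sigma>) * foldr (\<lambda>a F. entry e n r t a (\<sigma> a) \<circ> F) [1..<Suc n] id f)" .
qed

section \<open>The quotient by \<open>\<phi>\<close>\<close>

definition vandermonde_product :: "nat \<Rightarrow> (nat \<Rightarrow> 'b::comm_ring_1) \<Rightarrow> 'b" where
  "vandermonde_product n z = (\<Prod>(i, j)\<in>same_parity_pairs n. z i - z j)"

lemma vandermonde_product_eq:
  "vandermonde_product n z =
    (\<Prod>i\<in>{1..nx n}. \<Prod>j\<in>{i<..nx n}. z (2 * i - 1) - z (2 * j - 1)) *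
    (\<Prod>i\<in>{1..ny n}. \<Prod>j\<in>{i<..ny n}. z (2 * i) - z (2 * j))"
  unfolding vandermonde_product_def by (rule prod_same_parity_pairs)

lemma hom_vandermonde_product:
  assumes "comm_ring_hom h"
  shows "h (vandermonde_product n z) = vandermonde_product n (\<lambda>i. h (z i))"
proof -
  interpret comm_ring_hom h by fact
  show ?thesis unfolding vandermonde_product_def by (simp add: hom_prod hom_minus case_prod_unfold)
qed

lemma varphi_eq: "varphi n = vandermonde_product n Var"
  by (simp add: varphi_def vandermonde_product_def same_parity_pairs_def)

text \<open>
  In this form \<open>\<phi>\<close> has the symmetry that it shares with the operators: a row depends on its
  index only through its block and its variable.
\<close>

lemma vandermonde_product_leibniz:
  fixes z :: "nat \<Rightarrow> 'b::idom"
  shows "vandermonde_product n z = leibniz n (\<lambda>a b.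
    if a \<le> nx n then if b \<le> nx n then z (row_var n a) ^ (nx n - b) else 0
    else if b \<le> nx n then 0 else z (row_var n a) ^ (ny n - (b - nx n)))"
    (is "_ = leibniz n ?M")
proof -
  have "leibniz n ?M = leibniz (nx n + ny n) ?M" by (simp only: nx_ny)
  also have "\<dots> = leibniz (nx n) ?M * leibniz (ny n) (\<lambda>a b. ?M (nx n + a) (nx n + b))"
    by (rule leibniz_lower_left_zero) auto
  also have "leibniz (nx n) ?M = leibniz (nx n) (\<lambda>a b. z (2 * a - 1) ^ (nx n - b))"
    by (rule leibniz_cong) (auto simp: row_var_def)
  also have "leibniz (ny n) (\<lambda>a b. ?M (nx n + a) (nx n + b)) = leibniz (ny n) (\<lambda>a b. z (2 * a) ^ (ny n - b))"
    by (rule leibniz_cong) (auto simp: row_var_def)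
  finally show ?thesis by (simp add: vandermonde vandermonde_product_eq)
qed

definition row_perm :: "nat \<Rightarrow> (nat \<Rightarrow> nat) \<Rightarrow> nat \<Rightarrow> nat" where
  "row_perm n \<pi> = map_permutation {1..n} (var_row n) \<pi>"

lemma row_perm:
  assumes \<pi>: "\<pi> permutes {1..n}"
  shows "row_perm n \<pi> permutes {1..n}" "sign (row_perm n \<pi>) = sign \<pi>"
    "i \<in> {1..n} \<Longrightarrow> row_perm n \<pi> (var_row n i) = var_row n (\<pi> i)"
    "a \<in> {1..n} \<Longrightarrow> row_var n (row_perm n \<pi> a) = \<pi> (row_var n a)"
proof -
  have inj: "inj_on (var_row n) {1..n}" using bij_var_row by (rule bij_betw_imp_inj_on)
  show "row_perm n \<pi> permutes {1..n}"
    unfolding row_perm_def by (rule map_permutation_permutes[OF bij_var_row \<pi>])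
  show "sign (row_perm n \<pi>) = sign \<pi>"
    unfolding row_perm_def by (rule sign_map_permutation[OF inj \<pi>]) simp
  show *: "row_perm n \<pi> (var_row n i) = var_row n (\<pi> i)" if "i \<in> {1..n}" for i
    unfolding row_perm_def by (rule map_permutation_apply[OF inj that])
  show "row_var n (row_perm n \<pi> a) = \<pi> (row_var n a)" if a: "a \<in> {1..n}"
    using *[OF row_var_in[OF a]] row_var_var_row[of "\<pi> (row_var n a)" n] row_var_in[OF a]
      permutes_in_image[OF \<pi>] by (metis var_row_row_var[OF a])
qed

text \<open>
  Permuting the variables within the parity classes permutes the rows within the blocks. The
  sets \<open>S\<close> and \<open>S'\<close> mark the rows that get shifted.
\<close>

lemma leibniz_permute_variables:
  assumes \<pi>: "\<pi> \<in> semisym_group n"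
    and M: "\<And>a a' b v. a \<in> {1..n} \<Longrightarrow> a' \<in> {1..n} \<Longrightarrow> b \<in> {1..n} \<Longrightarrow> (a \<le> nx n \<longleftrightarrow> a' \<le> nx n) \<Longrightarrow>
      (a \<in> S \<longleftrightarrow> a' \<in> S') \<Longrightarrow> M a b v = M' a' b v"
    and S: "\<And>i. i \<in> {1..n} \<Longrightarrow> var_row n i \<in> S \<longleftrightarrow> var_row n (\<pi> i) \<in> S'"
  shows "leibniz n (\<lambda>a b. M a b (z (\<pi> (row_var n a)))) =
    of_int (sign \<pi>) * leibniz n (\<lambda>a b. M' a b (z (row_var n a)))"
proof -
  have perm: "\<pi> permutes {1..n}" and par: "\<And>i. i \<in> {1..n} \<Longrightarrow> \<pi> i mod 2 = i mod 2"
    using \<pi> by (auto simp: semisym_group_def)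
  let ?\<tau> = "row_perm n \<pi>"
  note \<tau> = row_perm(1)[OF perm]
  have "leibniz n (\<lambda>a b. M a b (z (\<pi> (row_var n a)))) =
      leibniz n (\<lambda>a. (\<lambda>a b. M' a b (z (row_var n a))) (?\<tau> a))"
  proof (rule leibniz_cong)
    fix a b
    assume a: "a \<in> {1..n}" and b: "b \<in> {1..n}"
    have \<tau>a: "?\<tau> a \<in> {1..n}" using permutes_in_image[OF \<tau>] a by blast
    have "odd (row_var n (?\<tau> a)) \<longleftrightarrow> odd (row_var n a)"
      using par[OF row_var_in[OF a]] by (simp only: row_perm(4)[OF perm a] odd_iff_mod_2_eq_one)
    then have "a \<le> nx n \<longleftrightarrow> ?\<tau> a \<le> nx n"
      using odd_row_var[OF a] odd_row_var[OF \<tau>a] by blast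
    moreover have "a \<in> S \<longleftrightarrow> ?\<tau> a \<in> S'"
      using S[OF row_var_in[OF a]] row_perm(3)[OF perm row_var_in[OF a]]
      by (simp only: var_row_row_var[OF a])
    ultimately show "M a b (z (\<pi> (row_var n a))) = M' (?\<tau> a) b (z (row_var n (?\<tau> a)))"
      using M[OF a \<tau>a b] by (simp only: row_perm(4)[OF perm a])
  qed
  also have "\<dots> = of_int (sign ?\<tau>) * leibniz n (\<lambda>a b. M' a b (z (row_var n a)))"
    by (rule leibniz_permute_rows[OF \<tau>])
  also have "sign ?\<tau> = sign \<pi>"
    by (rule row_perm(2)[OF perm])
  finally show ?thesis .
qed

lemma vandermonde_product_permute:
  fixes z :: "nat \<Rightarrow> 'b::idom"
  assumes "\<pi> \<in> semisym_group n"
  shows "vandermonde_product n (\<lambda>i. z (\<pi> i)) = of_int (sign \<pi>) * vandermonde_product n z"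
  unfolding vandermonde_product_leibniz
  by (rule leibniz_permute_variables[OF assms, where S = "{}" and S' = "{}"
      and M = "\<lambda>a b v. if a \<le> nx n then if b \<le> nx n then v ^ (nx n - b) else 0
        else if b \<le> nx n then 0 else v ^ (ny n - (b - nx n))"]) auto

lemma det_op_permute:
  assumes h: "comm_ring_hom h" and f: "f \<in> semisymmetric n" and \<pi>: "\<pi> \<in> semisym_group n"
  shows "subst_hom h (\<lambda>i. z (\<pi> i)) (det_op e n r t f) =
    of_int (sign \<pi>) * subst_hom h z (det_op e n r t f)"
proof -
  have perm: "\<pi> permutes {1..n}" using \<pi> by (simp add: semisym_group_def)
  define \<tau> where "\<tau> = row_perm n \<pi>"
  note \<tau> = row_perm(1)[OF perm, folded \<tau>_def] and \<tau>_var = row_perm(3)[OF perm, folded \<tau>_def]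
  have mem: "var_row n i \<in> S \<longleftrightarrow> var_row n (\<pi> i) \<in> \<tau> ` S" if "i \<in> {1..n}" for i S
    using permutes_inj[OF \<tau>] by (simp add: \<tau>_var[OF that, symmetric] inj_image_mem_iff)
  let ?t = "\<lambda>z S. leibniz n (coef_matrix e n (h r) (h t) S z) * subst_hom h (shifted n S z) f"
  have "?t (\<lambda>i. z (\<pi> i)) S = of_int (sign \<pi>) * ?t z (\<tau> ` S)" if S: "S \<in> Pow {1..n}" for S
  proof -
    let ?M = "\<lambda>S a. coef e n (h r) (h t) (a \<in> S) a"
    have "leibniz n (\<lambda>a b. ?M S a b (z (\<pi> (row_var n a)))) =
        of_int (sign \<pi>) * leibniz n (\<lambda>a b. ?M (\<tau> ` S) a b (z (row_var n a)))"
    proof (rule leibniz_permute_variables[OF \<pi>])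
      fix a a' b :: nat and v
      assume "(a \<le> nx n) = (a' \<le> nx n)" "(a \<in> S) = (a' \<in> \<tau> ` S)"
      then show "?M S a b v = ?M (\<tau> ` S) a' b v" by (rule coef_row_class)
    next
      fix i
      assume "i \<in> {1..n}"
      then show "var_row n i \<in> S \<longleftrightarrow> var_row n (\<pi> i) \<in> \<tau> ` S" by (rule mem)
    qed
    then have "leibniz n (coef_matrix e n (h r) (h t) S (\<lambda>i. z (\<pi> i))) =
        of_int (sign \<pi>) * leibniz n (coef_matrix e n (h r) (h t) (\<tau> ` S) z)"
      unfolding coef_matrix_def .
    moreover have "subst_hom h (shifted n S (\<lambda>i. z (\<pi> i))) f =
        subst_hom h (\<lambda>i. shifted n (\<tau> ` S) z (\<pi> i)) f"
    proof (rule subst_hom_cong_polys)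
      show "f \<in> polys n" using f by (simp add: semisymmetric_def)
      fix i
      assume i: "i \<in> {1..n}"
      then have "\<pi> i \<in> {1..n}" using permutes_in_image[OF perm] by blast
      moreover have "\<tau> ` S \<subseteq> {1..n}" using S permutes_in_image[OF \<tau>] by auto
      ultimately show "shifted n S (\<lambda>i. z (\<pi> i)) i = shifted n (\<tau> ` S) z (\<pi> i)"
        using mem_image_row_var_iff[OF i, of S] mem_image_row_var_iff[of "\<pi> i" n "\<tau> ` S"] mem[OF i, of S] S
        unfolding shifted_def by (simp only: Pow_iff)
    qed
    moreover have "\<dots> = subst_hom h (shifted n (\<tau> ` S) z) f"
      by (rule semisymmetric_subst_hom[OF f \<pi> h])
    ultimately show ?thesis by (simp add: mult.assoc)
  qed
  then have "subst_hom h (\<lambda>i. z (\<pi> i)) (det_op e n r t f) =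
      (\<Sum>S\<in>Pow {1..n}. of_int (sign \<pi>) * ?t z (\<tau> ` S))"
    unfolding det_op_expansion[OF h] by (rule sum.cong[OF refl])
  also have "\<dots> = (\<Sum>S\<in>Pow {1..n}. of_int (sign \<pi>) * ?t z S)"
  proof (rule sum.reindex_bij_betw)
    show "bij_betw ((`) \<tau>) (Pow {1..n}) (Pow {1..n})"
      by (rule bij_betw_Pow[OF permutes_imp_bij[OF \<tau>]])
  qed
  also have "\<dots> = of_int (sign \<pi>) * subst_hom h z (det_op e n r t f)"
    unfolding det_op_expansion[OF h] sum_distrib_left ..
  finally show ?thesis .
qed

lemma varphi_polys: "(varphi n :: 'a::comm_ring_1 mpol) \<in> polys n"
proof -
  have "substitute (\<lambda>i. if i \<in> {1..n} then Var i else 0) (varphi n) = (varphi n :: 'a mpol)"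
    unfolding varphi_eq hom_vandermonde_product[OF substitute_ring_hom]
    unfolding vandermonde_product_def by (rule prod.cong) (auto simp: same_parity_pairs_def)
  then show ?thesis by (simp add: polys_iff_truncate)
qed

lemma varphi_nonzero: "varphi n \<noteq> (0 :: 'a::idom mpol)"
proof -
  have "Var (fst s) - Var (snd s) \<noteq> (0 :: 'a mpol)" if "s \<in> same_parity_pairs n" for s
    using that by (auto simp: same_parity_pairs_def)
  then show ?thesis
    unfolding varphi_eq vandermonde_product_def case_prod_unfold by (simp add: prod_zero_iff)
qed

text \<open>
  The image of a semisymmetric polynomial is alternating, hence vanishes for \<open>z\<^sub>i = z\<^sub>j\<close> and is
  divisible by \<open>\<phi>\<close>; the quotient is again semisymmetric.
\<close>

lemma det_op_divisible:
  fixes f :: "'a::{idom,ring_char_0} mpol"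
  assumes f: "f \<in> semisymmetric n" "deg_le d f"
  obtains q where "det_op e n r t f = varphi n * q" "q \<in> semisymmetric n" "deg_le d q"
proof -
  let ?F = "det_op e n r t f"
  have f_polys: "f \<in> polys n" using f by (simp add: semisymmetric_def)
  have "(\<Prod>s\<in>same_parity_pairs n. Var (fst s) - Var (snd s)) dvd ?F"
  proof (rule prod_dvd_of_specialisations[where \<sigma> = "\<lambda>s. substitute (Var(fst s := Var (snd s)))"])
    fix s p
    assume "substitute (Var(fst s := Var (snd s))) p = (0 :: 'a mpol)"
    then show "Var (fst s) - Var (snd s) dvd p" by (rule linear_dvd_of_substitute_zero)
  next
    fix s s' :: "nat \<times> nat"
    assume s: "s \<in> same_parity_pairs n" "s' \<in> same_parity_pairs n" "s \<noteq> s'"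
    obtain i j k l where ij: "s = (i, j)" "s' = (k, l)" by (cases s, cases s')
    interpret comm_ring_hom "substitute (Var(i := Var j) :: nat \<Rightarrow> 'a mpol)"
      by (rule substitute_ring_hom)
    have "i < j" "k < l" "(i, j) \<noteq> (k, l)"
      using s by (auto simp: ij same_parity_pairs_def)
    then have "(if k = i then j else k) \<noteq> (if l = i then j else l)" by auto
    then have "(Var(i := Var j)) k \<noteq> ((Var(i := Var j)) l :: 'a mpol)"
      by (auto split: if_splits)
    then show "substitute (Var(fst s := Var (snd s))) (Var (fst s') - Var (snd s') :: 'a mpol) \<noteq> 0"
      by (simp add: ij hom_minus del: fun_upd_apply)
  next
    fix s
    assume s: "s \<in> same_parity_pairs n"
    obtain i j where ij: "s = (i, j)" by (cases s)
    let ?z = "Var(i := Var j) :: nat \<Rightarrow> 'a mpol"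
    have le: "1 \<le> i" "i < j" "j \<le> n" "even (j - i)" using s by (auto simp: ij same_parity_pairs_def)
    have "i mod 2 = j mod 2" using le(2,4) by presburger
    moreover have "transpose i j permutes {1..n}" by (rule permutes_swap_id) (use le in auto)
    ultimately have "transpose i j \<in> semisym_group n"
      by (simp add: semisym_group_def transpose_def)
    from det_op_permute[OF Const_hom f(1) this, of ?z e r t]
    have "subst_hom Const (\<lambda>k. ?z (transpose i j k)) ?F = - subst_hom Const ?z ?F"
      using le by (simp add: sign_swap_id)
    moreover have "(\<lambda>k. ?z (transpose i j k)) = ?z"
      by (auto simp: transpose_def fun_eq_iff)
    ultimately show "substitute (Var(fst s := Var (snd s))) ?F = 0"
      by (simp add: ij substitute_def)
  qed (use substitute_ring_hom in simp_all)
  then obtain q where q: "?F = varphi n * q"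
    unfolding varphi_eq vandermonde_product_def case_prod_unfold by (elim dvdE)
  have \<phi>: "varphi n \<noteq> (0 :: 'a mpol)"
    by (rule varphi_nonzero)
  have deg: "deg_le d q"
  proof (rule deg_le_prod_cancel)
    show "deg_le (d + int (card (same_parity_pairs n)))
        ((\<Prod>s\<in>same_parity_pairs n. Var (fst s) - Var (snd s)) * q)"
      using deg_le_det_op[OF f(2), of n e r t] unfolding q
      by (simp add: varphi_eq vandermonde_product_def case_prod_unfold)
  next
    fix s
    assume "s \<in> same_parity_pairs n"
    then have "fst s \<noteq> snd s" by (auto simp: same_parity_pairs_def)
    then show "degree (homogenize (Var (fst s) - Var (snd s) :: 'a mpol)) = 1"
      by (rule degree_homogenize_linear(2))
  qed simp
  have sym: "q \<in> semisymmetric n"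
  proof (rule semisymmetric_cancel[OF \<phi> varphi_polys, where \<epsilon> = "\<lambda>\<pi>. of_int (sign \<pi>)"])
    show "varphi n * q \<in> polys n" using det_op_polys[OF f_polys, of e r t] unfolding q .
  next
    fix \<pi>
    assume \<pi>: "\<pi> \<in> semisym_group n"
    show "of_int (sign \<pi>) \<noteq> (0 :: 'a mpol)" by (simp add: sign_def)
    show "substitute (\<lambda>i. Var (\<pi> i)) (varphi n) = of_int (sign \<pi>) * (varphi n :: 'a mpol)"
      unfolding varphi_eq hom_vandermonde_product[OF substitute_ring_hom] substitute_Var
      by (rule vandermonde_product_permute[OF \<pi>])
    show "substitute (\<lambda>i. Var (\<pi> i)) (varphi n * q) = of_int (sign \<pi>) * (varphi n * q)"
      using det_op_permute[OF Const_hom f(1) \<pi>, of Var e r t]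
        substitute_Var_ident[of ?F] unfolding q substitute_def by simp
  qed
  show ?thesis using that q sym deg by blast
qed

section \<open>Coefficients of the operators at the points \<open>\<rho> + \<mu>\<close>\<close>

lemma leibniz_scale_rows:
  "leibniz n (\<lambda>a b. c a * M a b) = (\<Prod>a\<in>{1..n}. c a) * leibniz n M"
  by (simp add: leibniz_def prod.distrib sum_distrib_left mult_ac)

lemma leibniz_upper_right_zero:
  fixes M :: "nat \<Rightarrow> nat \<Rightarrow> 'b::idom"
  assumes "\<And>a b. a \<in> {1..N} \<Longrightarrow> b \<in> {N<..N + m} \<Longrightarrow> M a b = 0"
  shows "leibniz (N + m) M = leibniz N M * leibniz m (\<lambda>a b. M (N + a) (N + b))"
proof -
  let ?f = "\<lambda>(i, j). M (Suc i) (Suc j)"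
  let ?A = "mat N N ?f" and ?C = "mat m N (\<lambda>(i, j). M (N + Suc i) (Suc j))"
    and ?D = "mat m m (\<lambda>(i, j). M (N + Suc i) (N + Suc j))"
  have "mat (N + m) (N + m) ?f = four_block_mat ?A (0\<^sub>m N m) ?C ?D"
    by (rule eq_matI) (use assms in auto)
  then show ?thesis
    unfolding leibniz_eq_det
    by (simp add: det_four_block_mat_upper_right_zero[of _ N _ m])
qed

lemma var_row_le_nx_iff: "i \<in> {1..n} \<Longrightarrow> var_row n i \<le> nx n \<longleftrightarrow> odd i"
  by (auto simp: var_row_def elim!: oddE evenE)

text \<open>
  In the shifted row of the last variable all exponents are positive: the exponent 0 would occur
  one column beyond each block.
\<close>

lemma coef_matrix_last_zero:
  fixes z :: "nat \<Rightarrow> 'b::{idom,ring_char_0}"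
  assumes "1 \<le> n" "z n = 0" "var_row n n \<in> S"
  shows "leibniz n (coef_matrix e n r t S z) = 0"
proof (rule leibniz_zero_row)
  have n: "n \<in> {1..n}" using assms by simp
  show "var_row n n \<in> {1..n}" by (rule var_row_in[OF n])
  fix b
  assume b: "b \<in> {1..n}"
  have "odd n \<Longrightarrow> nx n = ny n + 1" "even n \<Longrightarrow> nx n = ny n"
    by (auto elim!: oddE evenE)
  with b nx_ny(1)[of n]
  have *: "odd n \<Longrightarrow> \<not> b \<le> nx n \<Longrightarrow> 0 < nx n - (b - nx n)"
    "even n \<Longrightarrow> b \<le> nx n \<Longrightarrow> 0 < ny n + 1 - b"
    "even n \<Longrightarrow> \<not> b \<le> nx n \<Longrightarrow> 0 < ny n + 1 - (b - nx n)"
    "b \<le> nx n \<Longrightarrow> 0 < nx n + 1 - b"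
    unfolding atLeastAtMost_iff by linarith+
  have "coef e n r t True (var_row n n) b 0 = 0"
  proof (cases "odd n")
    case True
    then show ?thesis
      unfolding coef_def var_row_le_nx_iff[OF n] using * by (simp add: zero_power)
  next
    case False
    then show ?thesis
      unfolding coef_def var_row_le_nx_iff[OF n] using * by (simp add: zero_power)
  qed
  then show "coef_matrix e n r t S z (var_row n n) b = 0"
    using assms by (simp add: coef_matrix_def row_var_var_row[OF n])
qed

text \<open>
  If \<open>z\<^sub>i = z\<^sub>i\<^sub>+\<^sub>1 + r\<close>, then the shifted row of \<open>z\<^sub>i\<close> and the unshifted row of \<open>z\<^sub>i\<^sub>+\<^sub>1\<close> are
  both multiples of the same vector of powers of \<open>z\<^sub>i\<close>.
\<close>

lemma coef_matrix_proportional: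
  fixes z :: "nat \<Rightarrow> 'b::{idom,ring_char_0}"
  assumes i: "i \<in> {1..<n}" and z: "z i = z (Suc i) + r"
    and S: "var_row n i \<in> S" "var_row n (Suc i) \<notin> S"
  shows "leibniz n (coef_matrix e n r t S z) = 0"
proof -
  define N where "N = nx n"
  define M where "M = ny n"
  let ?a = "var_row n i" and ?a' = "var_row n (Suc i)"
  have i1: "i \<in> {1..n}" and i2: "Suc i \<in> {1..n}" using i by auto
  have NM: "N + M = n" "M \<le> N" "N \<le> M + 1" using nx_ny[of n] by (auto simp: N_def M_def)
  have a: "?a \<le> N \<longleftrightarrow> odd i" and a': "?a' \<le> N \<longleftrightarrow> even i"
    using var_row_le_nx_iff[OF i1] var_row_le_nx_iff[OF i2] by (simp_all add: N_def)
  have ne: "?a \<noteq> ?a'" using a a' by auto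
  have Ma: "coef_matrix e n r t S z ?a b = coef e n r t True ?a b (z i)" for b
    using S by (simp add: coef_matrix_def row_var_var_row[OF i1])
  have Ma': "coef_matrix e n r t S z ?a' b = coef e n r t False ?a' b (z (Suc i))" for b
    using S by (simp add: coef_matrix_def row_var_var_row[OF i2])
  note coef = coef_def[where n = n, folded N_def M_def]
  define d where "d = (if odd i then N - M else M + 1 - N)"
  define u where "u b = (if odd i then if b \<le> N then if e then z i ^ (M + 1 - b) else 0 else z i ^ (M - (b - N))
     else if b \<le> N then z i ^ (N - b) else if e then 0 else z i ^ (N - (b - N)))" for b
  define q where "q = (if odd i = e then 1 else z (Suc i) + t)"
  show ?thesis
  proof (rule leibniz_proportional_rows[OF var_row_in[OF i1] var_row_in[OF i2] ne])
    fix b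
    assume b: "b \<in> {1..n}"
    have le: "b \<le> N \<Longrightarrow> b \<le> M + 1" "\<not> b \<le> N \<Longrightarrow> b - N \<le> M" using b NM by auto
    have pow: "z i ^ k = z i ^ d * z i ^ m" if "k = d + m" for k m
      using that by (simp add: power_add)
    show "coef_matrix e n r t S z ?a b = (- (z i ^ d)) * u b"
    proof (cases "odd i")
      case True
      have "b \<le> N \<Longrightarrow> N + 1 - b = d + (M + 1 - b)" "\<not> b \<le> N \<Longrightarrow> N - (b - N) = d + (M - (b - N))"
        using le NM True by (auto simp: d_def)
      from this[THEN pow] True a show ?thesis unfolding Ma coef u_def by simp
    next
      case False
      have "b \<le> N \<Longrightarrow> M + 1 - b = d + (N - b)" "\<not> b \<le> N \<Longrightarrow> M + 1 - (b - N) = d + (N - (b - N))"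
        using le NM False by (auto simp: d_def)
      from this[THEN pow] False a show ?thesis unfolding Ma coef u_def by simp
    qed
    show "coef_matrix e n r t S z ?a' b = q * u b"
      using a' unfolding Ma' coef u_def q_def by (simp add: z)
  qed
qed

text \<open>
  The unshifted rows of the odd variables and the shifted rows of the even variables only meet
  the columns of the left block (for \<open>Y\<close>, after subtracting the left columns from the right
  ones). If no odd variable and some even variable is shifted, these are too many rows.
\<close>

lemma coef_matrix_even_shifts:
  fixes z :: "nat \<Rightarrow> 'b::{idom,ring_char_0}"
  assumes S: "S \<subseteq> {1..n}" "S \<noteq> {}" "\<And>a. a \<in> S \<Longrightarrow> nx n < a"
  shows "leibniz n (coef_matrix e n r t S z) = 0"
proof -
  define N where "N = nx n"
  have S': "\<And>a. a \<in> S \<Longrightarrow> N < a" using S(3) by (simp add: N_def)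
  have "n \<noteq> 0" using S by auto
  then have N: "N \<noteq> 0" "N \<le> n" by (auto simp: N_def)
  let ?R = "{1..N} \<union> S"
  have "finite S" using S(1) finite_subset by blast
  moreover have "{1..N} \<inter> S = {}" using S' by fastforce
  ultimately have card: "N < card ?R"
    using S(2) by (simp add: card_Un_disjoint card_gt_0_iff)
  have R: "?R \<subseteq> {1..n}" using S(1) N by auto
  have mem: "a \<in> S \<longleftrightarrow> \<not> a \<le> N" if "a \<in> ?R" for a
    using that S'[of a] by auto
  note coef = coef_def[where n = n, folded N_def]
  show ?thesis
  proof (cases e)
    case True
    show ?thesis
      by (rule leibniz_rows_supported[OF R card])
        (use True in \<open>simp add: coef_matrix_def coef mem\<close>)
  next
    case False
    let ?M = "coef_matrix e n r t S z"
    have "leibniz n (\<lambda>a b. if N < b then ?M a b - ?M a (b - N) else ?M a b) = 0"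
    proof (rule leibniz_rows_supported[OF R card])
      fix a b
      assume a: "a \<in> ?R" and b: "b \<in> {1..n}" "N < b"
      have "b - N \<le> N" using b nx_ny[of n] by (auto simp: N_def)
      then show "(if N < b then ?M a b - ?M a (b - N) else ?M a b) = 0"
        using False b(2) mem[OF a] by (cases "a \<le> N") (simp_all add: coef_matrix_def coef)
    qed
    then show ?thesis by (simp add: leibniz_subtract_columns[OF N(1)])
  qed
qed

abbreviation parity_class :: "nat \<Rightarrow> bool \<Rightarrow> nat set" where
  "parity_class n e \<equiv> {i\<in>{1..n}. odd i \<longleftrightarrow> e}"

lemma prod_parity_class:
  fixes g :: "nat \<Rightarrow> 'b::comm_monoid_mult"
  shows "(\<Prod>i\<in>parity_class n e. g i) =
    (if e then \<Prod>i\<in>{1..nx n}. g (2 * i - 1) else \<Prod>i\<in>{1..ny n}. g (2 * i))"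
proof (cases e)
  case True
  have "(\<Prod>i\<in>{i\<in>{1..n}. odd i}. g i) = (\<Prod>i\<in>{1..nx n}. g (2 * i - 1))"
    by (rule prod.reindex_bij_witness[where i = "\<lambda>i. 2 * i - 1" and j = "\<lambda>i. (i + 1) div 2"])
      (auto elim!: oddE)
  with True show ?thesis by simp
next
  case False
  have "(\<Prod>i\<in>{i\<in>{1..n}. even i}. g i) = (\<Prod>i\<in>{1..ny n}. g (2 * i))"
    by (rule prod.reindex_bij_witness[where i = "\<lambda>i. 2 * i" and j = "\<lambda>i. i div 2"])
      (auto elim!: evenE)
  with False show ?thesis by simp
qed

text \<open>
  Without shifts the matrix is block triangular, and the diagonal blocks are Vandermonde matrices
  in \<open>z\<^sub>i + r\<close> up to factors \<open>z\<^sub>i + t\<close> in the rows of one of the blocks.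
\<close>

lemma coef_matrix_no_shift:
  fixes z :: "nat \<Rightarrow> 'b::{idom,ring_char_0}"
  shows "leibniz n (coef_matrix e n r t {} z) =
    (\<Prod>i\<in>parity_class n e. z i + t) * vandermonde_product n z"
proof -
  define N where "N = nx n"
  define M where "M = ny n"
  have n: "N + M = n" using nx_ny[of n] by (simp add: N_def M_def)
  note coef = coef_def[where n = n, folded N_def M_def]
  note row = row_var_def[where n = n, folded N_def]
  let ?C = "coef_matrix e n r t {} z"
  have "leibniz (N + M) ?C = leibniz N ?C * leibniz M (\<lambda>a b. ?C (N + a) (N + b))"
  proof (cases e)
    case True
    show ?thesis
      by (rule leibniz_upper_right_zero) (use True in \<open>simp add: coef_matrix_def coef\<close>)
  next
    case False
    show ?thesis
      by (rule leibniz_lower_left_zero) (use False in \<open>simp add: coef_matrix_def coef\<close>)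
  qed
  moreover have "leibniz N ?C = leibniz N (\<lambda>a b. (if e then z (2 * a - 1) + t else 1) * (z (2 * a - 1) + r) ^ (N - b))"
    by (rule leibniz_cong) (simp add: coef_matrix_def coef row)
  moreover have "leibniz M (\<lambda>a b. ?C (N + a) (N + b)) =
      leibniz M (\<lambda>a b. (if e then 1 else z (2 * a) + t) * (z (2 * a) + r) ^ (M - b))"
    by (rule leibniz_cong) (simp add: coef_matrix_def coef row)
  ultimately show ?thesis
    unfolding n leibniz_scale_rows vandermonde vandermonde_product_eq prod_parity_class
      N_def[symmetric] M_def[symmetric] by (cases e) (simp_all add: mult_ac)
qed

lemma rho_step: "i < n \<Longrightarrow> rho n r i = rho n r (Suc i) + r"
  by (simp add: rho_def Suc_diff_Suc[symmetric] algebra_simps)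

text \<open>
  If the shifted tuple is not a partition, then either the last entry is 0 and gets lowered, or
  \<open>\<mu>\<^sub>i = \<mu>\<^sub>i\<^sub>+\<^sub>1\<close> for some \<open>i\<close> and only \<open>\<mu>\<^sub>i\<close> gets lowered. In the first case \<open>z\<^sub>n = 0\<close>, in the
  second \<open>z\<^sub>i = z\<^sub>i\<^sub>+\<^sub>1 + r\<close>.
\<close>

lemma coef_matrix_cutoff:
  fixes r t :: "'a::{idom,ring_char_0}"
  assumes \<mu>: "\<mu> \<in> Partitions n" and S: "S \<subseteq> {1..n}"
    and nz: "leibniz n (coef_matrix e n r t S (\<lambda>i. rho n r i + of_nat (\<mu> i))) \<noteq> 0"
  obtains \<nu> where "\<nu> \<in> Partitions n" "\<And>i. \<mu> i = \<nu> i + (if i \<in> row_var n ` S then 1 else 0)"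
proof -
  let ?z = "\<lambda>i. rho n r i + of_nat (\<mu> i)"
  have img: "i \<in> row_var n ` S \<longleftrightarrow> var_row n i \<in> S" if "i \<in> {1..n}" for i
    using mem_image_row_var_iff[OF that S] .
  have step: "\<mu> (Suc i) \<le> \<mu> i" if "i \<in> {1..<n}" for i using \<mu> that by (auto simp: Partitions_def)
  have adj: "Suc i \<in> row_var n ` S" if "i \<in> {1..<n}" "\<mu> i = \<mu> (Suc i)" "i \<in> row_var n ` S" for i
  proof (rule ccontr)
    assume "Suc i \<notin> row_var n ` S"
    moreover have "i \<in> {1..n}" "Suc i \<in> {1..n}" "i < n" using that(1) by auto
    ultimately have "var_row n i \<in> S" "var_row n (Suc i) \<notin> S" "?z i = ?z (Suc i) + r"
      using that img by (simp_all add: rho_step)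
    then have "leibniz n (coef_matrix e n r t S ?z) = 0"
      by (intro coef_matrix_proportional[OF that(1)])
    with nz show False by simp
  qed
  have pos: "\<mu> i \<noteq> 0" if "i \<in> {1..n}" "i \<in> row_var n ` S" for i
    using that
  proof (induction "n - i" arbitrary: i)
    case 0
    then have i: "i = n" by simp
    show ?case
    proof
      assume "\<mu> i = 0"
      then have "leibniz n (coef_matrix e n r t S ?z) = 0"
        using 0 i img[of n] by (intro coef_matrix_last_zero) (simp_all add: rho_def)
      with nz show False by simp
    qed
  next
    case (Suc k)
    then have i: "i \<in> {1..<n}" by auto
    show ?case
    proof
      assume *: "\<mu> i = 0"
      then have 0: "\<mu> (Suc i) = 0" using step[OF i] by simp
      have "Suc i \<in> row_var n ` S" by (rule adj[OF i _ Suc.prems(2)]) (simp add: * 0)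
      moreover have "k = n - Suc i" "Suc i \<in> {1..n}" using Suc.hyps(2) i by auto
      ultimately show False using Suc.hyps(1)[of "Suc i"] 0 by blast
    qed
  qed
  have sub: "row_var n ` S \<subseteq> {1..n}" using S row_var_in by blast
  define \<nu> where "\<nu> i = \<mu> i - (if i \<in> row_var n ` S then 1 else 0)" for i
  have eq: "\<mu> i = \<nu> i + (if i \<in> row_var n ` S then 1 else 0)" for i
    using pos[of i] sub by (auto simp: \<nu>_def)
  have "\<nu> \<in> Partitions n"
    unfolding Partitions_def
  proof (intro CollectI conjI ballI allI impI)
    fix i
    assume i: "i \<in> {1..<n}"
    show "\<nu> (Suc i) \<le> \<nu> i"
    proof (cases "i \<in> row_var n ` S \<and> Suc i \<notin> row_var n ` S")
      case True
      then have "\<mu> i \<noteq> \<mu> (Suc i)" using adj[OF i] by blast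
      with step[OF i] True show ?thesis by (simp add: \<nu>_def)
    next
      case False
      with step[OF i] show ?thesis
        by (cases "i \<in> row_var n ` S"; cases "Suc i \<in> row_var n ` S") (simp_all add: \<nu>_def diff_le_mono)
    qed
  next
    fix i
    assume "i \<notin> {1..n}"
    then show "\<nu> i = 0" using \<mu> by (simp add: \<nu>_def Partitions_def)
  qed
  with eq show ?thesis using that by blast
qed

section \<open>Uniqueness of interpolation\<close>

lemma Partitions_Suc_zero:
  assumes "\<mu> \<in> Partitions n"
  shows "\<mu> \<in> Partitions (Suc n)" "\<mu> (Suc n) = 0" "odd_size (Suc n) \<mu> = odd_size n \<mu>"
proof -
  show 0: "\<mu> (Suc n) = 0" using assms by (simp add: Partitions_def)
  show "\<mu> \<in> Partitions (Suc n)"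
    using assms 0 by (auto simp: Partitions_def less_Suc_eq)
  have "{i \<in> {1..Suc n}. odd i} = {i \<in> {1..n}. odd i} \<union> (if odd (Suc n) then {Suc n} else {})"
    by (auto simp: le_Suc_eq)
  then show "odd_size (Suc n) \<mu> = odd_size n \<mu>"
    using 0 by (simp add: odd_size_def)
qed

lemma Partitions_Suc_zeroD:
  assumes "\<mu> \<in> Partitions (Suc n)" "\<mu> (Suc n) = 0"
  shows "\<mu> \<in> Partitions n"
  unfolding Partitions_def
proof (intro CollectI conjI ballI allI impI)
  fix i
  assume "i \<in> {1..<n}"
  then show "\<mu> (Suc i) \<le> \<mu> i" using assms(1) by (auto simp: Partitions_def)
next
  fix i
  assume "i \<notin> {1..n}"
  then show "\<mu> i = 0" using assms by (cases "i = Suc n") (auto simp: Partitions_def)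
qed

text \<open>
  The orbit of \<open>n\<close>: a semisymmetric polynomial divisible by \<open>z\<^sub>n - c\<close> is divisible by
  \<open>z\<^sub>i - c\<close> for all these \<open>i\<close>.
\<close>

definition last_class :: "nat \<Rightarrow> nat set" where
  "last_class n = {i \<in> {1..n}. even (n - i)}"

lemma finite_last_class [simp]: "finite (last_class n)"
  by (simp add: last_class_def)

definition incr :: "nat \<Rightarrow> (nat \<Rightarrow> nat) \<Rightarrow> nat \<Rightarrow> nat" where
  "incr n \<mu> i = (if i \<in> {1..n} then Suc (\<mu> i) else 0)"

lemma incr_Partitions:
  assumes "\<mu> \<in> Partitions n"
  shows "incr n \<mu> \<in> Partitions n" "odd_size n (incr n \<mu>) = odd_size n \<mu> + card (last_class n)"
proof -
  show "incr n \<mu> \<in> Partitions n" using assms by (auto simp: Partitions_def incr_def)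
  have "odd_size n (incr n \<mu>) = odd_size n \<mu> + card {i \<in> {1..n}. odd i}"
  proof -
    have "odd_size n (incr n \<mu>) = (\<Sum>i\<in>{i \<in> {1..n}. odd i}. \<mu> i + 1)"
      unfolding odd_size_def by (rule sum.cong) (auto simp: incr_def)
    then show ?thesis unfolding odd_size_def sum.distrib by simp
  qed
  also have "card {i \<in> {1..n}. odd i} = card (last_class n)"
  proof (cases "odd n")
    case True
    then show ?thesis
      by (intro arg_cong[where f = card]) (auto simp: last_class_def)
  next
    case False
    have "Suc i \<le> n" if "i \<le> n" "odd i" for i
      using that False by (metis Suc_leI le_neq_implies_less)
    then have "bij_betw Suc {i \<in> {1..n}. odd i} (last_class n)"
      by (intro bij_betw_byWitness[where f' = "\<lambda>i. i - 1"])
        (use False in \<open>auto simp: last_class_def odd_pos\<close>)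
    then show ?thesis by (rule bij_betw_same_card)
  qed
  finally show "odd_size n (incr n \<mu>) = odd_size n \<mu> + card (last_class n)" .
qed

lemma Partitions_mono:
  assumes "\<mu> \<in> Partitions n" "1 \<le> i" "i \<le> j" "j \<le> n"
  shows "\<mu> j \<le> \<mu> i"
  using assms(3,4)
proof (induction j rule: dec_induct)
  case (step j)
  then have "\<mu> (Suc j) \<le> \<mu> j" using assms(1,2) by (simp add: Partitions_def)
  with step show ?case by simp
qed simp

lemma Partitions_incrE:
  assumes "\<mu> \<in> Partitions n" "\<mu> n \<noteq> 0"
  obtains \<nu> where "\<nu> \<in> Partitions n" "\<mu> = incr n \<nu>"
proof
  have pos: "\<mu> i \<noteq> 0" if "i \<in> {1..n}" for i
    using Partitions_mono[OF assms(1), of i n] assms(2) that by simp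
  show "(\<lambda>i. \<mu> i - 1) \<in> Partitions n"
    using assms(1) by (auto simp: Partitions_def intro: diff_le_mono)
  show "\<mu> = incr n (\<lambda>i. \<mu> i - 1)"
    using assms(1) pos by (auto simp: incr_def Partitions_def fun_eq_iff)
qed

lemma eval_at_cong_polys:
  "p \<in> polys n \<Longrightarrow> (\<And>i. i \<in> {1..n} \<Longrightarrow> a i = b i) \<Longrightarrow> eval_at a p = eval_at b p"
  unfolding eval_at_def by (rule subst_hom_cong_polys)

lemma eval_at_Const [simp]: "eval_at a (Const c) = c"
  by (simp add: eval_at_def subst_hom_Const)

lemma eval_at_Var [simp]: "eval_at a (Var i) = a i"
  by (simp add: eval_at_def subst_hom_Var)

lemma eval_at_substitute: "eval_at a (substitute s p) = eval_at (\<lambda>i. eval_at a (s i)) p"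
  unfolding eval_at_def by (rule subst_hom_substitute[OF comm_ring_hom_ident])

lemma substitute_substitute: "substitute a (substitute s p) = substitute (\<lambda>i. substitute a (s i)) p"
  using subst_hom_substitute[OF Const_hom, of a s p] by (simp add: substitute_def)

lemma semisym_group_extend:
  "\<pi> \<in> semisym_group n \<Longrightarrow> \<pi> \<in> semisym_group (Suc n)"
  unfolding semisym_group_def
  by (auto intro: permutes_subset simp: le_Suc_eq permutes_not_in)

lemma semisym_group_transpose:
  "i \<in> {1..n} \<Longrightarrow> j \<in> {1..n} \<Longrightarrow> i mod 2 = j mod 2 \<Longrightarrow> transpose i j \<in> semisym_group n"
  unfolding semisym_group_def by (auto simp: transpose_def intro: permutes_swap_id)

lemma restrict_last_semisymmetric:
  fixes f :: "'a::comm_ring_1 mpol"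
  assumes "f \<in> semisymmetric (Suc n)"
  shows "substitute (Var(Suc n := Const c)) f \<in> semisymmetric n"
  unfolding semisymmetric_def
proof (intro CollectI conjI ballI)
  let ?s = "Var(Suc n := Const c) :: nat \<Rightarrow> 'a mpol"
  have f: "f \<in> polys (Suc n)" using assms by (simp add: semisymmetric_def)
  let ?s' = "\<lambda>i. if i \<in> {1..n} then Var i else Const c :: 'a mpol"
  have "substitute ?s f = substitute ?s' f"
    unfolding substitute_def by (rule subst_hom_cong_polys[OF f]) auto
  also have "\<dots> \<in> polys n" by (rule substitute_polys) (auto intro: Var_polys Const_polys)
  finally show "substitute ?s f \<in> polys n" .
  fix \<pi>
  assume \<pi>: "\<pi> \<in> semisym_group n"
  then have perm: "\<pi> permutes {1..n}" by (simp add: semisym_group_def)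
  have last: "\<pi> (Suc n) = Suc n" using perm by (simp add: permutes_not_in)
  have ne: "\<pi> i \<noteq> Suc n" if "i \<noteq> Suc n" for i
    using permutes_inj[OF perm] last that by (metis injD)
  have "substitute (\<lambda>i. Var (\<pi> i)) (substitute ?s f) = substitute (\<lambda>i. ?s (\<pi> i)) f"
    unfolding substitute_substitute
    by (intro arg_cong[where f = "\<lambda>a. substitute a f"]) (use ne last in \<open>auto simp: fun_eq_iff\<close>)
  also have "\<dots> = substitute ?s f"
    unfolding substitute_def
    by (rule semisymmetric_subst_hom[OF assms semisym_group_extend[OF \<pi>] Const_hom])
  finally show "substitute (\<lambda>i. Var (\<pi> i)) (substitute ?s f) = substitute ?s f" .
qed

lemma substitute_prod_last_class:
  assumes \<pi>: "\<pi> \<in> semisym_group n"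
  shows "substitute (\<lambda>i. Var (\<pi> i)) (\<Prod>i\<in>last_class n. Var i - Const c) =
    (\<Prod>i\<in>last_class n. Var i - Const c :: 'a::comm_ring_1 mpol)"
proof -
  interpret comm_ring_hom "substitute (\<lambda>i. Var (\<pi> i) :: 'a mpol)" by (rule substitute_ring_hom)
  have perm: "\<pi> permutes {1..n}" and par: "\<And>i. i \<in> {1..n} \<Longrightarrow> \<pi> i mod 2 = i mod 2"
    using \<pi> by (auto simp: semisym_group_def)
  have mem: "\<pi> i \<in> last_class n" if "i \<in> last_class n" for i
  proof -
    have i: "i \<in> {1..n}" "even (n - i)" using that by (auto simp: last_class_def)
    then have "\<pi> i \<in> {1..n}" using permutes_in_image[OF perm] by blast
    moreover have "even (n - \<pi> i)" using par[OF i(1)] i calculation by presburger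
    ultimately show ?thesis by (simp add: last_class_def)
  qed
  have inj: "inj_on \<pi> (last_class n)" using permutes_inj[OF perm] by (rule inj_on_subset) simp
  have "\<pi> ` last_class n = last_class n"
    by (rule card_subset_eq) (use mem card_image[OF inj] in auto)
  then have "(\<Prod>i\<in>last_class n. Var i - Const c) = (\<Prod>i\<in>last_class n. Var (\<pi> i) - Const c :: 'a mpol)"
    using prod.reindex[OF inj, of "\<lambda>i. Var i - Const c :: 'a mpol"] by simp
  then show ?thesis unfolding hom_prod hom_minus by simp
qed

lemma prod_last_class_polys:
  "(\<Prod>i\<in>last_class n. Var i - Const c :: 'a::comm_ring_1 mpol) \<in> polys n"
proof -
  let ?tr = "\<lambda>i. if i \<in> {1..n} then Var i else (0 :: 'a mpol)"
  interpret comm_ring_hom "substitute ?tr" by (rule substitute_ring_hom)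
  have "substitute ?tr (\<Prod>i\<in>last_class n. Var i - Const c) = (\<Prod>i\<in>last_class n. Var i - Const c)"
    unfolding hom_prod hom_minus by (rule prod.cong) (auto simp: last_class_def)
  then show ?thesis by (simp add: polys_iff_truncate)
qed

lemma prod_last_class_nonzero: "(\<Prod>i\<in>last_class n. Var i - Const c :: 'a::idom mpol) \<noteq> 0"
proof -
  have "Var i - Const c \<noteq> (0 :: 'a mpol)" for i
    using degree_homogenize_linear(1)[of i c] homogenize_eq_0_iff[of "Var i - Const c"] by auto
  then show ?thesis by (simp add: prod_zero_iff)
qed

text \<open>
  The group carries the hyperplane \<open>z\<^sub>n = c\<close> to the hyperplanes \<open>z\<^sub>i = c\<close> of the same parity
  class, whose equations are coprime.
\<close>

lemma semisymmetric_divide_last_class: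
  fixes f :: "'a::idom mpol"
  assumes n: "n \<noteq> 0" and f: "f \<in> semisymmetric n" and zero: "substitute (Var(n := Const c)) f = 0"
    and deg: "deg_le d f"
  obtains g where "f = (\<Prod>i\<in>last_class n. Var i - Const c) * g" "g \<in> semisymmetric n"
    "deg_le (d - int (card (last_class n))) g"
proof -
  let ?u = "\<Prod>i\<in>last_class n. Var i - Const c :: 'a mpol"
  have "?u dvd f"
  proof (rule prod_dvd_of_specialisations[where \<sigma> = "\<lambda>i. substitute (Var(i := Const c))"])
    fix s p
    assume "substitute (Var(s := Const c)) p = (0 :: 'a mpol)"
    then show "Var s - Const c dvd p" by (rule linear_dvd_of_substitute_zero)
  next
    fix s s' :: nat
    assume "s \<noteq> s'"
    interpret comm_ring_hom "substitute (Var(s := Const c) :: nat \<Rightarrow> 'a mpol)"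
      by (rule substitute_ring_hom)
    have "Var s' - Const c \<noteq> (0 :: 'a mpol)"
      using degree_homogenize_linear(1)[of s' c] homogenize_eq_0_iff[of "Var s' - Const c"] by auto
    then show "substitute (Var(s := Const c)) (Var s' - Const c) \<noteq> (0 :: 'a mpol)"
      using \<open>s \<noteq> s'\<close> by (simp add: hom_minus)
  next
    fix i
    assume i: "i \<in> last_class n"
    then have "i \<in> {1..n}" "i mod 2 = n mod 2" by (auto simp: last_class_def) presburger
    then have \<pi>: "transpose i n \<in> semisym_group n"
      using n by (intro semisym_group_transpose) auto
    have "substitute (Var(i := Const c)) f = substitute (\<lambda>k. (Var(i := Const c)) (transpose i n k)) f"
      unfolding substitute_def by (rule semisymmetric_subst_hom[OF f \<pi> Const_hom, symmetric])
    also have "\<dots> = substitute (Var(i := Var n)) (substitute (Var(n := Const c)) f)"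
      unfolding substitute_substitute
      by (intro arg_cong[where f = "\<lambda>a. substitute a f"]) (auto simp: fun_eq_iff transpose_def)
    also have "\<dots> = 0" using zero by (simp add: substitute_def subst_hom_def)
    finally show "substitute (Var(i := Const c)) f = 0" .
  qed (use substitute_ring_hom in simp_all)
  then obtain g where g: "f = ?u * g" by (elim dvdE)
  have "deg_le (d - int (card (last_class n))) g"
    by (rule deg_le_prod_cancel[of "last_class n" "\<lambda>i. Var i - Const c"])
      (use deg g in \<open>simp_all add: degree_homogenize_linear\<close>)
  moreover have "g \<in> semisymmetric n"
    by (rule semisymmetric_cancel[OF prod_last_class_nonzero[where c = c] prod_last_class_polys, where \<epsilon> = "\<lambda>\<pi>. 1"])
      (use f in \<open>simp_all only: g[symmetric] substitute_prod_last_class semisymmetric_def mem_Collect_eq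
        mult_1_left one_neq_zero not_False_eq_True\<close>)
  ultimately show ?thesis using that g by blast
qed

abbreviation node :: "nat \<Rightarrow> 'a::comm_ring_1 \<Rightarrow> 'a \<Rightarrow> (nat \<Rightarrow> nat) \<Rightarrow> nat \<Rightarrow> 'a" where
  "node n r c \<mu> \<equiv> \<lambda>i. c + rho n r i + of_nat (\<mu> i)"

lemma eval_restrict_last:
  fixes f :: "'a::comm_ring_1 mpol"
  assumes f: "f \<in> polys (Suc n)" and \<mu>: "\<mu> (Suc n) = 0"
  shows "eval_at (node n r (c + r) \<mu>) (substitute (Var(Suc n := Const c)) f) = eval_at (node (Suc n) r c \<mu>) f"
  unfolding eval_at_substitute
proof (rule eval_at_cong_polys[OF f])
  fix i
  assume i: "i \<in> {1..Suc n}"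
  show "eval_at (node n r (c + r) \<mu>) ((Var(Suc n := Const c)) i) = node (Suc n) r c \<mu> i"
    using i \<mu> by (cases "i = Suc n") (auto simp: rho_def Suc_diff_le algebra_simps)
qed

lemma eval_node_incr:
  fixes g :: "'a::comm_ring_1 mpol"
  assumes "g \<in> polys n"
  shows "eval_at (node n r c (incr n \<mu>)) g = eval_at (node n r (c + 1) \<mu>) g"
  by (rule eval_at_cong_polys[OF assms]) (auto simp: incr_def)

lemma eval_prod_last_class:
  "eval_at a (\<Prod>i\<in>last_class n. Var i - Const c) = (\<Prod>i\<in>last_class n. a i - c)"
proof -
  interpret comm_ring_hom "eval_at a" by (rule eval_at_ring_hom)
  show ?thesis by (simp add: hom_prod hom_minus)
qed

lemma card_last_class_pos: "n \<noteq> 0 \<Longrightarrow> 0 < card (last_class n)"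
  by (subst card_gt_0_iff) (auto simp: last_class_def intro!: exI[of _ n])

lemma polys_0_eq_Const:
  fixes f :: "'a::comm_ring_1 mpol"
  assumes "f \<in> polys 0"
  shows "f = Const (eval_at a f)"
proof -
  have C0: "Const 0 = (0 :: 'a mpol)" by (simp add: Const_def)
  have "f = substitute (\<lambda>i. 0) f" using assms by (simp add: polys_iff_truncate)
  also have "\<dots> = subst_hom (\<lambda>c. Const c) (\<lambda>i. Const 0) f"
    by (simp add: substitute_def C0)
  also have "\<dots> = Const (eval_at (\<lambda>i. 0) f)"
    unfolding eval_at_def by (rule hom_subst_hom[OF Const_hom comm_ring_hom_ident, symmetric])
  also have "eval_at (\<lambda>i. 0) f = eval_at a f"
    by (rule eval_at_cong_polys[OF assms]) simp
  finally show ?thesis .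
qed

lemma zero_Partitions: "(\<lambda>i. 0) \<in> Partitions n"
  by (simp add: Partitions_def)

lemma Partitions_0: "\<mu> \<in> Partitions 0 \<Longrightarrow> \<mu> = (\<lambda>i. 0)"
  by (auto simp: Partitions_def)

text \<open>
  Restricting to \<open>z\<^sub>n = c\<close> gives the same problem in one variable less. A solution
  therefore vanishes there, and dividing by the conjugates of \<open>z\<^sub>n - c\<close> shifts all nodes by
  one and lowers the degree. The offset \<open>c\<close> of the nodes makes this an induction.
\<close>

theorem interpolation_unique:
  fixes f :: "'a::{idom,ring_char_0} mpol"
  assumes r: "\<And>m j. of_nat m * r + of_nat (Suc j) \<noteq> 0"
    and f: "f \<in> semisymmetric n" "deg_le (int d) f"
    and zero: "\<And>\<mu>. \<mu> \<in> Partitions n \<Longrightarrow> odd_size n \<mu> \<le> d \<Longrightarrow> eval_at (node n r c \<mu>) f = 0"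
  shows "f = 0"
  using f zero
proof (induction n arbitrary: f c d)
  case 0
  have "eval_at (node 0 r c (\<lambda>i. 0)) f = 0"
    by (rule 0(3)) (auto simp: zero_Partitions odd_size_def)
  moreover have "f \<in> polys 0" using 0(1) by (simp add: semisymmetric_def)
  ultimately show ?case using polys_0_eq_Const[of f "node 0 r c (\<lambda>i. 0)"] by (simp add: Const_def)
next
  case (Suc n)
  let ?N = "Suc n"
  note IH_n = Suc.IH
  show ?case
    using Suc.prems
  proof (induction d arbitrary: f c rule: less_induct)
    case (less d)
    have f_polys: "f \<in> polys ?N" using less.prems(1) by (simp add: semisymmetric_def)
    let ?K = "card (last_class ?N)"
    let ?u = "\<Prod>i\<in>last_class ?N. Var i - Const c :: 'a mpol"
    have K: "0 < ?K" by (rule card_last_class_pos) simp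
    have "substitute (Var(?N := Const c)) f = 0"
    proof (rule IH_n[where c = "c + r" and d = d])
      show "substitute (Var(?N := Const c)) f \<in> semisymmetric n"
        by (rule restrict_last_semisymmetric[OF less.prems(1)])
      show "deg_le (int d) (substitute (Var(?N := Const c)) f)"
        by (rule deg_le_substitute[OF less.prems(2)])
          (auto simp: deg_le_Var intro: deg_le_mono[OF deg_le_Const])
      fix \<mu>
      assume "\<mu> \<in> Partitions n" "odd_size n \<mu> \<le> d"
      then show "eval_at (node n r (c + r) \<mu>) (substitute (Var(?N := Const c)) f) = 0"
        using less.prems(3)[of \<mu>] Partitions_Suc_zero[of \<mu> n] by (simp add: eval_restrict_last[OF f_polys])
    qed
    then obtain g where g: "f = ?u * g" "g \<in> semisymmetric ?N" "deg_le (int d - int ?K) g"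
      using semisymmetric_divide_last_class[of ?N f c "int d"] less.prems(1,2) by blast
    have "g = 0"
    proof (cases "d < ?K")
      case True
      then show ?thesis using g(3) by (simp add: deg_le_neg)
    next
      case False
      show ?thesis
      proof (rule less.IH[of "d - ?K" g "c + 1"])
        show "d - ?K < d" using K False by simp
        show "deg_le (int (d - ?K)) g" using g(3) False by (simp add: of_nat_diff)
        fix \<mu>
        assume \<mu>: "\<mu> \<in> Partitions ?N" "odd_size ?N \<mu> \<le> d - ?K"
        interpret comm_ring_hom "eval_at (node ?N r c (incr ?N \<mu>))" by (rule eval_at_ring_hom)
        have "eval_at (node ?N r c (incr ?N \<mu>)) f = 0"
          by (rule less.prems(3)) (use \<mu> False incr_Partitions[OF \<mu>(1)] in simp_all)
        moreover have "eval_at (node ?N r c (incr ?N \<mu>)) ?u \<noteq> 0"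
        proof -
          have "node ?N r c (incr ?N \<mu>) i - c = of_nat (?N - i) * r + of_nat (Suc (\<mu> i))"
            if "i \<in> last_class ?N" for i
            using that by (simp add: rho_def incr_def last_class_def)
          then show ?thesis
            unfolding eval_prod_last_class using r by (simp only: prod_zero_iff finite_last_class) metis
        qed
        ultimately have "eval_at (node ?N r c (incr ?N \<mu>)) g = 0"
          unfolding g(1) hom_mult by simp
        then show "eval_at (node ?N r (c + 1) \<mu>) g = 0"
          using g(2) by (simp add: eval_node_incr semisymmetric_def)
      qed (rule g(2))
    qed
    then show ?case using g(1) by simp
  qed
qed

section \<open>Lifting semisymmetric polynomials to one more variable\<close>

lemma semisym_group_inj: "\<pi> \<in> semisym_group n \<Longrightarrow> inj \<pi>"
  by (auto simp: semisym_group_def intro: permutes_inj)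

lemma semisym_group_id: "id \<in> semisym_group n"
  by (simp add: semisym_group_def permutes_id)

lemma semisym_group_compose:
  assumes "\<pi> \<in> semisym_group n" "\<sigma> \<in> semisym_group n"
  shows "\<pi> \<circ> \<sigma> \<in> semisym_group n"
  using assms permutes_in_image[of \<sigma> "{1..n}"]
  by (auto simp: semisym_group_def intro: permutes_compose simp del: atLeastAtMost_iff)

lemma semisym_group_inv:
  assumes "\<pi> \<in> semisym_group n"
  shows "inv_into UNIV \<pi> \<in> semisym_group n"
proof -
  have perm: "\<pi> permutes {1..n}" and par: "\<And>i. i \<in> {1..n} \<Longrightarrow> \<pi> i mod 2 = i mod 2"
    using assms by (auto simp: semisym_group_def)
  have "inv_into UNIV \<pi> i mod 2 = i mod 2" if i: "i \<in> {1..n}" for i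
  proof -
    have "inv_into UNIV \<pi> i \<in> {1..n}" using permutes_in_image[OF permutes_inv[OF perm]] i by blast
    from par[OF this] show ?thesis using permutes_inverses(1)[OF perm] by simp
  qed
  then show ?thesis using permutes_inv[OF perm] by (simp add: semisym_group_def)
qed

lemma finite_semisym_group: "finite (semisym_group n)"
  by (rule finite_subset[OF _ finite_permutations[of "{1..n}"]]) (auto simp: semisym_group_def)

abbreviation act :: "(nat \<Rightarrow> nat) \<Rightarrow> (nat \<Rightarrow>\<^sub>0 nat) \<Rightarrow> (nat \<Rightarrow>\<^sub>0 nat)" where
  "act \<pi> m \<equiv> Poly_Mapping.map_key \<pi> m"

lemma lookup_act: "inj \<pi> \<Longrightarrow> Poly_Mapping.lookup (act \<pi> m) i = Poly_Mapping.lookup m (\<pi> i)"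
  by (simp add: map_key.rep_eq)

lemma act_act: "inj \<pi> \<Longrightarrow> inj \<sigma> \<Longrightarrow> act \<sigma> (act \<pi> m) = act (\<pi> \<circ> \<sigma>) m"
  by (rule poly_mapping_eqI) (simp add: lookup_act inj_compose)

lemma act_id: "act id m = m"
  by (rule poly_mapping_eqI) (simp add: lookup_act)

lemma keys_act: "bij \<pi> \<Longrightarrow> Poly_Mapping.keys m = \<pi> ` Poly_Mapping.keys (act \<pi> m)"
  by (simp add: keys_map_key bij_is_inj surj_image_vimage_eq bij_is_surj)

lemma mdegree_act: "bij \<pi> \<Longrightarrow> mdegree (act \<pi> m) = mdegree m"
proof -
  assume \<pi>: "bij \<pi>"
  have "mdegree m = (\<Sum>i\<in>\<pi> ` Poly_Mapping.keys (act \<pi> m). Poly_Mapping.lookup m i)"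
    unfolding mdegree_def keys_act[OF \<pi>, of m, symmetric] ..
  also have "\<dots> = mdegree (act \<pi> m)"
    unfolding mdegree_def
    by (subst sum.reindex)
      (auto simp: lookup_act[OF bij_is_inj[OF \<pi>]] intro: inj_on_subset[OF bij_is_inj[OF \<pi>]])
  finally show ?thesis by simp
qed

lemma substitute_permute_single:
  assumes "bij \<pi>"
  shows "substitute (\<lambda>i. Var (\<pi> i)) (Poly_Mapping.single m c) =
    Poly_Mapping.single (act (inv_into UNIV \<pi>) m) (c :: 'a::comm_ring_1)"
proof (induction m rule: exponent_induct)
  case zero
  have "act (inv_into UNIV \<pi>) 0 = 0"
    by (rule poly_mapping_eqI) (use assms in \<open>simp add: lookup_act bij_imp_bij_inv bij_is_inj\<close>)
  then show ?case using substitute_Const[of "\<lambda>i. Var (\<pi> i)" c] by (simp add: Const_def)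
next
  case (add i m)
  interpret comm_ring_hom "substitute (\<lambda>i. Var (\<pi> i) :: 'a mpol)" by (rule substitute_ring_hom)
  have inj: "inj (inv_into UNIV \<pi>)" using assms by (simp add: bij_imp_bij_inv bij_is_inj)
  have "act (inv_into UNIV \<pi>) (Poly_Mapping.single i 1 + m) = Poly_Mapping.single (\<pi> i) 1 + act (inv_into UNIV \<pi>) m"
    by (rule poly_mapping_eqI)
      (use assms in \<open>auto simp: lookup_act[OF inj] lookup_add lookup_single when_def bij_inv_eq_iff\<close>)
  then show ?case
    by (simp only: single_exponent_add hom_mult substitute_Var add)
qed

lemma lookup_substitute_permute:
  fixes p :: "'a::comm_ring_1 mpol"
  assumes "bij \<pi>"
  shows "Poly_Mapping.lookup (substitute (\<lambda>i. Var (\<pi> i)) p) m = Poly_Mapping.lookup p (act \<pi> m)"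
proof -
  interpret comm_ring_hom "substitute (\<lambda>i. Var (\<pi> i) :: 'a mpol)" by (rule substitute_ring_hom)
  have inj: "inj \<pi>" "inj (inv_into UNIV \<pi>)" using assms by (simp_all add: bij_imp_bij_inv bij_is_inj)
  have "act (inv_into UNIV \<pi>) m' = m \<longleftrightarrow> m' = act \<pi> m" for m'
    using act_act[OF inj, of m] act_act[OF inj(2,1), of m'] assms
    by (auto simp: act_id bij_is_surj surj_iff[THEN iffD1] inj_iff[THEN iffD1] bij_is_inj)
  then show ?thesis
    by (induction p rule: mpol_induct_single)
      (auto simp: substitute_permute_single[OF assms] lookup_single when_def hom_add lookup_add)
qed

lemma lookup_substitute_zero:
  fixes p :: "'a::comm_ring_1 mpol"
  shows "Poly_Mapping.lookup (substitute (Var(N := 0)) p) m =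
    (Poly_Mapping.lookup p m when Poly_Mapping.lookup m N = 0)"
proof -
  interpret comm_ring_hom "substitute (Var(N := 0) :: nat \<Rightarrow> 'a mpol)" by (rule substitute_ring_hom)
  have single: "substitute (Var(N := 0)) (Poly_Mapping.single m' c) =
      (Poly_Mapping.single m' c when Poly_Mapping.lookup m' N = 0)" for m' and c :: 'a
  proof (induction m' rule: exponent_induct)
    case zero
    show ?case using substitute_Const[of "Var(N := 0)" c] by (simp add: Const_def del: fun_upd_apply)
  next
    case (add i m)
    show ?case
      unfolding single_exponent_add hom_mult add
      by (auto simp: lookup_add lookup_single when_def)
  qed
  show ?thesis
    by (induction p rule: mpol_induct_single)
      (auto simp: single lookup_single when_def hom_add lookup_add simp del: fun_upd_apply)
qed

text \<open>
  Every exponent vector with a zero in the parity class of \<open>N = n + 1\<close> is conjugate to one with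
  a zero at \<open>N\<close>, unique up to the group of \<open>n\<close> variables. Taking the coefficient of \<open>g\<close> there
  (and 0 for the other exponent vectors) gives a semisymmetric extension of \<open>g\<close>. This is the
  linear extension of \<open>m\<^sub>\<alpha> \<mapsto> m\<^sub>\<alpha>\<close> on orbit sums of monomials.
\<close>

lemma semisymmetric_lift_zero:
  fixes g :: "'a::comm_ring_1 mpol"
  assumes g: "g \<in> semisymmetric n" "deg_le d g"
  obtains G where "G \<in> semisymmetric (Suc n)" "deg_le d G" "substitute (Var(Suc n := 0)) G = g"
proof -
  let ?N = "Suc n"
  let ?G = "semisym_group ?N"
  let ?lk = Poly_Mapping.lookup
  have bij: "bij \<pi>" if "\<pi> \<in> ?G" for \<pi>
    using that permutes_bij[of \<pi> "{1..?N}"] by (simp add: semisym_group_def)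
  note inj = semisym_group_inj
  have g_polys: "g \<in> polys n" using g(1) by (simp add: semisymmetric_def)
  have g_inv: "?lk g (act \<sigma> m) = ?lk g m" if "\<sigma> \<in> semisym_group n" for \<sigma> m
  proof -
    have "bij \<sigma>" using that permutes_bij[of \<sigma> "{1..n}"] by (simp add: semisym_group_def)
    moreover have "substitute (\<lambda>i. Var (\<sigma> i)) g = g" using g(1) that by (simp add: semisymmetric_def)
    ultimately show ?thesis using lookup_substitute_permute[of \<sigma> g m] by simp
  qed
  define W where "W m = {\<pi> \<in> ?G. ?lk m (\<pi> ?N) = 0}" for m :: "nat \<Rightarrow>\<^sub>0 nat"
  have indep: "?lk g (act \<pi> m) = ?lk g (act \<pi>' m)" if "\<pi> \<in> W m" "\<pi>' \<in> W m" for \<pi> \<pi>' m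
  proof -
    have \<pi>: "\<pi> \<in> ?G" "\<pi>' \<in> ?G" and zero: "?lk m (\<pi> ?N) = 0" "?lk m (\<pi>' ?N) = 0"
      using that by (auto simp: W_def)
    let ?\<tau> = "transpose (\<pi> ?N) (\<pi>' ?N)"
    have N: "?N \<in> {1..?N}" by simp
    have "\<rho> ?N \<in> {1..?N}" "\<rho> ?N mod 2 = ?N mod 2" if "\<rho> \<in> ?G" for \<rho>
      using that N permutes_in_image[of \<rho> "{1..?N}" ?N] unfolding semisym_group_def by blast+
    then have \<tau>: "?\<tau> \<in> ?G" using \<pi> by (intro semisym_group_transpose) simp_all
    have "act ?\<tau> m = m"
      by (rule poly_mapping_eqI) (use zero in \<open>auto simp: lookup_act inj[OF \<tau>] transpose_def\<close>)
    then have eq1: "act \<pi>' m = act (?\<tau> \<circ> \<pi>') m"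
      using act_act[OF inj[OF \<tau>] inj[OF \<pi>(2)], of m] by simp
    define \<sigma> where "\<sigma> = inv_into UNIV \<pi> \<circ> (?\<tau> \<circ> \<pi>')"
    have \<sigma>G: "\<sigma> \<in> ?G"
      unfolding \<sigma>_def by (intro semisym_group_compose semisym_group_inv \<pi> \<tau>)
    have \<sigma>N: "\<sigma> ?N = ?N"
      using bij[OF \<pi>(1)] by (simp add: \<sigma>_def inv_f_f bij_is_inj)
    have "\<sigma> permutes {1..n}"
    proof (rule permutes_superset)
      show "\<sigma> permutes {1..?N}" using \<sigma>G by (simp add: semisym_group_def)
      fix i
      assume "i \<in> {1..?N} - {1..n}"
      then have "i = ?N" by auto
      then show "\<sigma> i = i" using \<sigma>N by simp
    qed
    then have \<sigma>: "\<sigma> \<in> semisym_group n" using \<sigma>G by (simp add: semisym_group_def)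
    have "\<pi> \<circ> \<sigma> = ?\<tau> \<circ> \<pi>'"
      using bij[OF \<pi>(1)] by (auto simp: \<sigma>_def fun_eq_iff surj_f_inv_f bij_is_surj)
    then have "act \<pi>' m = act \<sigma> (act \<pi> m)"
      using eq1 act_act[OF inj[OF \<pi>(1)] inj[OF \<sigma>G], of m] by simp
    then show ?thesis using g_inv[OF \<sigma>] by simp
  qed
  define L where "L m = (if W m = {} then 0 else ?lk g (act (SOME \<pi>. \<pi> \<in> W m) m))" for m
  have L: "L m = ?lk g (act \<pi> m)" if "\<pi> \<in> W m" for \<pi> m
    using that indep[OF someI[of "\<lambda>\<pi>. \<pi> \<in> W m" \<pi>] that] by (auto simp: L_def)
  have supp: "\<exists>\<pi>\<in>?G. act \<pi> m \<in> Poly_Mapping.keys g" if "L m \<noteq> 0" for m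
  proof -
    have "W m \<noteq> {}" using that by (simp add: L_def split: if_splits)
    then obtain \<pi> where "\<pi> \<in> W m" by blast
    with L[OF this] that show ?thesis by (auto simp: W_def in_keys_iff)
  qed
  have "finite {m. L m \<noteq> 0}"
  proof (rule finite_subset)
    show "{m. L m \<noteq> 0} \<subseteq> (\<Union>\<pi>\<in>?G. (\<lambda>m. act (inv_into UNIV \<pi>) m) ` Poly_Mapping.keys g)"
    proof
      fix m
      assume "m \<in> {m. L m \<noteq> 0}"
      then obtain \<pi> where \<pi>: "\<pi> \<in> ?G" "act \<pi> m \<in> Poly_Mapping.keys g" using supp by blast
      have "\<pi> \<circ> inv_into UNIV \<pi> = id"
        using bij_is_surj[OF bij[OF \<pi>(1)]] by (simp add: surj_iff)
      then have "m = act (inv_into UNIV \<pi>) (act \<pi> m)"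
        using act_act[OF inj[OF \<pi>(1)] inj[OF semisym_group_inv[OF \<pi>(1)]], of m] by (simp add: act_id)
      with \<pi> show "m \<in> (\<Union>\<pi>\<in>?G. (\<lambda>m. act (inv_into UNIV \<pi>) m) ` Poly_Mapping.keys g)" by blast
    qed
  qed (simp add: finite_semisym_group)
  then have lookup_G: "?lk (Abs_poly_mapping L) = L" by simp
  define G where "G = Abs_poly_mapping L"
  have keys_G: "\<exists>\<pi>\<in>?G. act \<pi> m \<in> Poly_Mapping.keys g" if "m \<in> Poly_Mapping.keys G" for m
    using that supp by (simp add: G_def in_keys_iff lookup_G)
  show ?thesis
  proof
    show "deg_le d G"
      unfolding deg_le_def
    proof
      fix m
      assume "m \<in> Poly_Mapping.keys G"
      then obtain \<pi> where \<pi>: "\<pi> \<in> ?G" "act \<pi> m \<in> Poly_Mapping.keys g" using keys_G by blast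
      then have "int (mdegree (act \<pi> m)) \<le> d" using g(2) by (simp add: deg_le_def)
      then show "int (mdegree m) \<le> d" by (simp add: mdegree_act[OF bij[OF \<pi>(1)]])
    qed
    show "substitute (Var(Suc n := 0)) G = g"
    proof (rule poly_mapping_eqI)
      fix m
      show "?lk (substitute (Var(Suc n := 0)) G) m = ?lk g m"
      proof (cases "?lk m ?N = 0")
        case True
        then have "id \<in> W m" by (simp add: W_def semisym_group_id)
        from L[OF this] True show ?thesis
          unfolding lookup_substitute_zero G_def lookup_G by (simp add: act_id)
      next
        case False
        then have "m \<notin> Poly_Mapping.keys g"
        proof -
          have "?N \<in> Poly_Mapping.keys m" using False by (simp add: in_keys_iff)
          then have "\<not> Poly_Mapping.keys m \<subseteq> {1..n}" by auto
          then show ?thesis using g_polys unfolding polys_def by blast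
        qed
        with False show ?thesis
          unfolding lookup_substitute_zero by (simp add: in_keys_iff)
      qed
    qed
    show "G \<in> semisymmetric (Suc n)"
      unfolding semisymmetric_def
    proof (intro CollectI conjI ballI)
      show "G \<in> polys ?N"
        unfolding polys_def
      proof (intro CollectI ballI)
        fix m
        assume "m \<in> Poly_Mapping.keys G"
        then obtain \<pi> where \<pi>: "\<pi> \<in> ?G" "act \<pi> m \<in> Poly_Mapping.keys g" using keys_G by blast
        have "\<pi> permutes {1..?N}" using \<pi>(1) by (simp add: semisym_group_def)
        moreover have "Poly_Mapping.keys (act \<pi> m) \<subseteq> {1..?N}"
          using \<pi>(2) g_polys by (force simp: polys_def)
        ultimately show "Poly_Mapping.keys m \<subseteq> {1..?N}"
          unfolding keys_act[OF bij[OF \<pi>(1)], of m] by (metis image_mono permutes_image)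
      qed
      fix \<tau>
      assume \<tau>: "\<tau> \<in> ?G"
      show "substitute (\<lambda>i. Var (\<tau> i)) G = G"
      proof (rule poly_mapping_eqI)
        fix m
        have W_comp: "\<tau> \<circ> \<pi> \<in> W m" if "\<pi> \<in> W (act \<tau> m)" for \<pi>
          using that semisym_group_compose[OF \<tau>, of \<pi>] by (simp add: W_def lookup_act[OF inj[OF \<tau>]])
        have W': "inv_into UNIV \<tau> \<circ> \<pi> \<in> W (act \<tau> m)" if "\<pi> \<in> W m" for \<pi>
          using that semisym_group_compose[OF semisym_group_inv[OF \<tau>], of \<pi>]
          by (simp add: W_def lookup_act[OF inj[OF \<tau>]] surj_f_inv_f[OF bij_is_surj[OF bij[OF \<tau>]]])
        have "L (act \<tau> m) = L m"
        proof (cases "W (act \<tau> m) = {}")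
          case True
          then have "W m = {}" using W' by blast
          with True show ?thesis by (simp add: L_def)
        next
          case False
          then obtain \<pi> where \<pi>: "\<pi> \<in> W (act \<tau> m)" by blast
          then have "\<pi> \<in> ?G" by (simp add: W_def)
          then show ?thesis
            using L[OF \<pi>] L[OF W_comp[OF \<pi>]] act_act[OF inj[OF \<tau>] inj[OF \<open>\<pi> \<in> ?G\<close>], of m] by simp
        qed
        then show "?lk (substitute (\<lambda>i. Var (\<tau> i)) G) m = ?lk G m"
          by (simp add: lookup_substitute_permute[OF bij[OF \<tau>]] G_def lookup_G)
      qed
    qed
  qed
qed

lemma semisymmetric_translate:
  fixes f :: "'a::comm_ring_1 mpol"
  assumes f: "f \<in> semisymmetric n" "deg_le d f"
  shows "substitute (\<lambda>i. Var i + Const c) f \<in> semisymmetric n"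
    and "deg_le d (substitute (\<lambda>i. Var i + Const c) f)"
proof -
  have f_polys: "f \<in> polys n" using f by (simp add: semisymmetric_def)
  show "deg_le d (substitute (\<lambda>i. Var i + Const c) f)"
  proof (rule deg_le_substitute[OF f(2)])
    show "deg_le 1 (Var i + Const c)" for i
      by (rule deg_le_add[OF deg_le_Var deg_le_mono[OF deg_le_Const]]) simp
  qed
  have "substitute (\<lambda>i. Var i + Const c) f = substitute (\<lambda>i. if i \<in> {1..n} then Var i + Const c else 0) f"
    unfolding substitute_def by (rule subst_hom_cong_polys[OF f_polys]) simp
  also have "\<dots> \<in> polys n"
    by (rule substitute_polys) (simp add: zero_polys polys_add Var_polys Const_polys del: atLeastAtMost_iff)
  finally have "substitute (\<lambda>i. Var i + Const c) f \<in> polys n" .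
  moreover have "substitute (\<lambda>i. Var (\<pi> i)) (substitute (\<lambda>i. Var i + Const c) f) =
      substitute (\<lambda>i. Var i + Const c) f" if \<pi>: "\<pi> \<in> semisym_group n" for \<pi>
  proof -
    interpret comm_ring_hom "substitute (\<lambda>i. Var (\<pi> i) :: 'a mpol)" by (rule substitute_ring_hom)
    have "substitute (\<lambda>i. Var (\<pi> i)) (substitute (\<lambda>i. Var i + Const c) f) =
        substitute (\<lambda>i. Var (\<pi> i) + Const c) f"
      by (simp add: substitute_substitute hom_add)
    also have "\<dots> = substitute (\<lambda>i. Var i + Const c) f"
      unfolding substitute_def
      using semisymmetric_subst_hom[OF f(1) \<pi> Const_hom, of "\<lambda>i. Var i + Const c"] .
    finally show ?thesis .
  qed
  ultimately show "substitute (\<lambda>i. Var i + Const c) f \<in> semisymmetric n"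
    by (simp add: semisymmetric_def)
qed

lemma semisymmetric_lift:
  fixes g :: "'a::comm_ring_1 mpol"
  assumes g: "g \<in> semisymmetric n" "deg_le d g"
  obtains G where "G \<in> semisymmetric (Suc n)" "deg_le d G" "substitute (Var(Suc n := Const c)) G = g"
proof -
  have Const_add: "Const c + Const (- c) = (0 :: 'a mpol)"
    by (simp add: Const_def single_add[symmetric])
  obtain G where G: "G \<in> semisymmetric (Suc n)" "deg_le d G"
    "substitute (Var(Suc n := 0)) G = substitute (\<lambda>i. Var i + Const c) g"
    by (rule semisymmetric_lift_zero[OF semisymmetric_translate[OF g]])
  interpret A: comm_ring_hom "substitute (Var(Suc n := Const c) :: nat \<Rightarrow> 'a mpol)" by (rule substitute_ring_hom)
  interpret B: comm_ring_hom "substitute (\<lambda>i. Var i + Const (- c) :: 'a mpol)" by (rule substitute_ring_hom)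
  have "substitute (Var(Suc n := Const c)) (substitute (\<lambda>i. Var i + Const (- c)) G) =
      substitute (\<lambda>i. Var i + Const (- c)) (substitute (Var(Suc n := 0)) G)"
    unfolding substitute_substitute
    by (intro arg_cong[where f = "\<lambda>a. substitute a G"])
      (auto simp: fun_eq_iff A.hom_add Const_add)
  also have "\<dots> = substitute (\<lambda>i. Var i + (Const c + Const (- c))) g"
    unfolding G(3) substitute_substitute by (simp add: B.hom_add add_ac)
  also have "\<dots> = g" by (simp add: Const_add)
  finally show ?thesis using that semisymmetric_translate[OF G(1,2)] by blast
qed

section \<open>Existence of interpolation polynomials\<close>

lemma semisymmetric_Const: "Const c \<in> semisymmetric n"
  by (simp add: semisymmetric_def Const_polys)

lemma semisymmetric_add:
  fixes p q :: "'a::comm_ring_1 mpol"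
  assumes "p \<in> semisymmetric n" "q \<in> semisymmetric n"
  shows "p + q \<in> semisymmetric n"
proof -
  have "substitute a (p + q) = substitute a p + substitute a q" for a :: "nat \<Rightarrow> 'a mpol"
    unfolding substitute_def by (rule subst_hom_add[OF Const_hom])
  with assms show ?thesis by (simp add: semisymmetric_def polys_add)
qed

lemma semisymmetric_mult:
  fixes p q :: "'a::comm_ring_1 mpol"
  assumes "p \<in> semisymmetric n" "q \<in> semisymmetric n"
  shows "p * q \<in> semisymmetric n"
proof -
  have "substitute a (p * q) = substitute a p * substitute a q" for a :: "nat \<Rightarrow> 'a mpol"
  proof -
    interpret comm_ring_hom "substitute a" by (rule substitute_ring_hom)
    show ?thesis by (rule hom_mult)
  qed
  with assms show ?thesis by (simp add: semisymmetric_def polys_mult)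
qed

lemma semisymmetric_Const_mult:
  "p \<in> semisymmetric n \<Longrightarrow> Const c * p \<in> semisymmetric n"
  by (rule semisymmetric_mult[OF semisymmetric_Const])

lemma prod_last_class_semisymmetric:
  "(\<Prod>i\<in>last_class n. Var i - Const c :: 'a::comm_ring_1 mpol) \<in> semisymmetric n"
  unfolding semisymmetric_def using prod_last_class_polys substitute_prod_last_class by blast

lemma deg_le_prod_last_class:
  "deg_le (int (card (last_class n))) (\<Prod>i\<in>last_class n. Var i - Const c :: 'a::comm_ring_1 mpol)"
proof -
  have lin: "deg_le 1 (Var i - Const c :: 'a mpol)" for i
    by (rule deg_le_diff[OF deg_le_Var deg_le_mono[OF deg_le_Const]]) simp
  have "deg_le (int (card S)) (\<Prod>i\<in>S. Var i - Const c :: 'a mpol)" if "finite S" for S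
    using that
  proof induction
    case empty
    show ?case using deg_le_Const[of "1::'a"] by (simp add: Const_def)
  next
    case (insert i S)
    then show ?case using deg_le_mult[OF lin[of i] insert.IH] by simp
  qed
  then show ?thesis by simp
qed

lemma finite_bounded_partitions: "finite {\<mu> \<in> Partitions n. odd_size n \<mu> \<le> d}"
proof (rule finite_subset)
  show "{\<mu> \<in> Partitions n. odd_size n \<mu> \<le> d} \<subseteq> {f. \<forall>i. (i \<in> {1..n} \<longrightarrow> f i \<in> {..d}) \<and> (i \<notin> {1..n} \<longrightarrow> f i = 0)}"
  proof (intro subsetI CollectI allI conjI impI)
    fix \<mu> i
    assume \<mu>: "\<mu> \<in> {\<mu> \<in> Partitions n. odd_size n \<mu> \<le> d}" and i: "i \<in> {1..n}"
    have "\<mu> i \<le> \<mu> 1"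
      by (rule Partitions_mono[of \<mu> n]) (use \<mu> i in auto)
    also have "\<mu> 1 \<le> odd_size n \<mu>"
      unfolding odd_size_def by (rule member_le_sum) (use i in auto)
    finally show "\<mu> i \<in> {..d}" using \<mu> by simp
  next
    fix \<mu> i
    assume "\<mu> \<in> {\<mu> \<in> Partitions n. odd_size n \<mu> \<le> d}" "i \<notin> {1..n}"
    then show "\<mu> i = 0" by (simp add: Partitions_def)
  qed
  show "finite {f. \<forall>i. (i \<in> {1..n} \<longrightarrow> f i \<in> {..d}) \<and> (i \<notin> {1..n} \<longrightarrow> f i = (0::nat))}"
    by (rule finite_set_of_finite_funs) auto
qed

text \<open>
  The values at the nodes in \<open>Q\<close> are removed one at a time by subtracting a multiple of the
  interpolation polynomial of that node. To avoid division, \<open>g\<close> is multiplied by the value of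
  the latter, which \<open>h\<close> does not kill.
\<close>

lemma interpolation_correction:
  fixes g :: "'a::comm_ring_1 mpol" and h :: "'a \<Rightarrow> 'b::idom"
  assumes h: "comm_ring_hom h" and "finite Q" "Q \<subseteq> L"
    and F: "\<And>\<mu>. \<mu> \<in> Q \<Longrightarrow> \<exists>f\<in>semisymmetric n. deg_le d f \<and> h (eval_at (z \<mu>) f) \<noteq> 0 \<and>
      (\<forall>\<nu>\<in>L. \<nu> \<noteq> \<mu> \<longrightarrow> eval_at (z \<nu>) f = 0)"
    and g: "g \<in> semisymmetric n" "deg_le d g"
  shows "\<exists>f\<in>semisymmetric n. deg_le d f \<and> (\<forall>\<nu>\<in>Q. eval_at (z \<nu>) f = 0) \<and>
    (\<exists>c. h c \<noteq> 0 \<and> (\<forall>\<nu>\<in>L - Q. eval_at (z \<nu>) f = c * eval_at (z \<nu>) g))"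
  using assms(2-4)
proof (induction Q rule: finite_induct)
  case empty
  interpret h: comm_ring_hom h by (rule h)
  show ?case by (rule bexI[OF _ g(1)]) (use g in \<open>auto intro!: exI[of _ 1]\<close>)
next
  case (insert \<mu> Q)
  interpret h: comm_ring_hom h by (rule h)
  obtain f c where f: "f \<in> semisymmetric n" "deg_le d f" "\<And>\<nu>. \<nu> \<in> Q \<Longrightarrow> eval_at (z \<nu>) f = 0"
    and c: "h c \<noteq> 0" "\<And>\<nu>. \<nu> \<in> L - Q \<Longrightarrow> eval_at (z \<nu>) f = c * eval_at (z \<nu>) g"
    using insert.IH insert.prems by auto
  obtain p where p: "p \<in> semisymmetric n" "deg_le d p" "h (eval_at (z \<mu>) p) \<noteq> 0"
    "\<And>\<nu>. \<nu> \<in> L \<Longrightarrow> \<nu> \<noteq> \<mu> \<Longrightarrow> eval_at (z \<nu>) p = 0"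
    using insert.prems(2)[of \<mu>] by auto
  define a where "a = eval_at (z \<mu>) p"
  define b where "b = eval_at (z \<mu>) f"
  define q where "q = Const a * f + Const (- b) * p"
  have q: "eval_at (z \<nu>) q = a * eval_at (z \<nu>) f - b * eval_at (z \<nu>) p" for \<nu>
  proof -
    interpret comm_ring_hom "eval_at (z \<nu>)" by (rule eval_at_ring_hom)
    show ?thesis by (simp add: q_def hom_add hom_mult)
  qed
  have "q \<in> semisymmetric n"
    unfolding q_def by (intro semisymmetric_add semisymmetric_Const_mult f p)
  moreover have "deg_le d q"
    unfolding q_def by (intro deg_le_add deg_le_Const_mult f p)
  moreover have "eval_at (z \<nu>) q = 0" if "\<nu> \<in> insert \<mu> Q" for \<nu>
  proof (cases "\<nu> = \<mu>")
    case True
    then show ?thesis by (simp add: q a_def b_def)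
  next
    case False
    then have "\<nu> \<in> Q" "\<nu> \<in> L" using that insert.prems(1) by auto
    with False show ?thesis by (simp add: q f(3) p(4))
  qed
  moreover have "h (a * c) \<noteq> 0" using c(1) p(3) by (simp add: h.hom_mult a_def)
  moreover have "eval_at (z \<nu>) q = (a * c) * eval_at (z \<nu>) g" if "\<nu> \<in> L - insert \<mu> Q" for \<nu>
    using that c(2)[of \<nu>] p(4)[of \<nu>] by (simp add: q mult.assoc)
  ultimately show ?case by blast
qed

text \<open>
  Existence by the same induction as uniqueness. If \<open>\<mu>\<^sub>n > 0\<close>, multiply a solution for
  \<open>\<mu> - (1, \<dots>, 1)\<close> by the conjugates of \<open>z\<^sub>n - c\<close>; if \<open>\<mu>\<^sub>n = 0\<close>, lift a solution in one variable
  less and correct it at the nodes of the first kind. No division takes place, so that the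
  solution exists over the base ring and its value at the node of \<open>\<mu>\<close> is a product of factors
  \<open>m r + j\<close> with \<open>j > 0\<close>, which \<open>h\<close> does not kill.
\<close>

theorem interpolation_exists:
  fixes r c :: "'a::comm_ring_1" and h :: "'a \<Rightarrow> 'b::idom"
  assumes h: "comm_ring_hom h" and r: "\<And>m j. h (of_nat m * r + of_nat (Suc j)) \<noteq> 0"
    and \<mu>: "\<mu> \<in> Partitions n" "odd_size n \<mu> \<le> d"
  shows "\<exists>f\<in>semisymmetric n. deg_le (int d) f \<and> h (eval_at (node n r c \<mu>) f) \<noteq> 0 \<and>
    (\<forall>\<nu>\<in>{\<nu> \<in> Partitions n. odd_size n \<nu> \<le> d}. \<nu> \<noteq> \<mu> \<longrightarrow> eval_at (node n r c \<nu>) f = 0)"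
  using \<mu>
proof (induction n arbitrary: \<mu> c d)
  case 0
  interpret h: comm_ring_hom h by (rule h)
  show ?case
  proof (intro bexI[OF _ semisymmetric_Const[of 1]] conjI ballI impI)
    show "deg_le (int d) (Const 1)" by (rule deg_le_mono[OF deg_le_Const]) simp
    fix \<nu>
    assume "\<nu> \<in> {\<nu> \<in> Partitions 0. odd_size 0 \<nu> \<le> d}" "\<nu> \<noteq> \<mu>"
    then show "eval_at (node 0 r c \<nu>) (Const 1) = 0"
      using 0(1) Partitions_0 by blast
  qed simp
next
  case (Suc n)
  interpret h: comm_ring_hom h by (rule h)
  let ?N = "Suc n"
  note IH_n = Suc.IH
  show ?case
    using Suc.prems
  proof (induction d arbitrary: \<mu> c rule: less_induct)
    case (less d)
    let ?K = "card (last_class ?N)"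
    let ?u = "\<Prod>i\<in>last_class ?N. Var i - Const c :: 'a mpol"
    let ?L = "{\<nu> \<in> Partitions ?N. odd_size ?N \<nu> \<le> d}"
    have K: "0 < ?K" by (rule card_last_class_pos) simp
    have pos: "\<exists>f\<in>semisymmetric ?N. deg_le (int d) f \<and> h (eval_at (node ?N r c \<mu>) f) \<noteq> 0 \<and>
        (\<forall>\<nu>\<in>?L. \<nu> \<noteq> \<mu> \<longrightarrow> eval_at (node ?N r c \<nu>) f = 0)" if \<mu>: "\<mu> \<in> ?L" "\<mu> ?N \<noteq> 0" for \<mu>
    proof -
      obtain \<mu>' where \<mu>': "\<mu>' \<in> Partitions ?N" "\<mu> = incr ?N \<mu>'"
        using Partitions_incrE[of \<mu> ?N] \<mu> by blast
      have size: "odd_size ?N \<mu>' + ?K \<le> d" using \<mu> incr_Partitions(2)[OF \<mu>'(1)] by (simp add: \<mu>'(2))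
      then have "d - ?K < d" "odd_size ?N \<mu>' \<le> d - ?K" using K by simp_all
      from less.IH[OF this(1) \<mu>'(1) this(2), of "c + 1"]
      obtain g where g: "g \<in> semisymmetric ?N" "deg_le (int (d - ?K)) g"
        "h (eval_at (node ?N r (c + 1) \<mu>') g) \<noteq> 0"
        "\<And>\<nu>. \<nu> \<in> Partitions ?N \<Longrightarrow> odd_size ?N \<nu> \<le> d - ?K \<Longrightarrow> \<nu> \<noteq> \<mu>' \<Longrightarrow> eval_at (node ?N r (c + 1) \<nu>) g = 0"
        by auto
      have g_polys: "g \<in> polys ?N" using g(1) by (simp add: semisymmetric_def)
      have eval: "eval_at (node ?N r c \<nu>) (?u * g) =
          (\<Prod>i\<in>last_class ?N. node ?N r c \<nu> i - c) * eval_at (node ?N r c \<nu>) g" for \<nu>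
      proof -
        interpret comm_ring_hom "eval_at (node ?N r c \<nu>)" by (rule eval_at_ring_hom)
        show ?thesis by (simp add: hom_mult eval_prod_last_class)
      qed
      have "?u * g \<in> semisymmetric ?N"
        by (rule semisymmetric_mult[OF prod_last_class_semisymmetric g(1)])
      moreover have "deg_le (int d) (?u * g)"
        by (rule deg_le_mono[OF deg_le_mult[OF deg_le_prod_last_class g(2)]]) (use size in linarith)
      moreover have "h (eval_at (node ?N r c \<mu>) (?u * g)) \<noteq> 0"
      proof -
        have "node ?N r c (incr ?N \<mu>') i - c = of_nat (?N - i) * r + of_nat (Suc (\<mu>' i))"
          if "i \<in> last_class ?N" for i
          using that by (simp add: rho_def incr_def last_class_def)
        then have "h (\<Prod>i\<in>last_class ?N. node ?N r c (incr ?N \<mu>') i - c) \<noteq> 0"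
          unfolding h.hom_prod using r by (simp only: prod_zero_iff finite_last_class) metis
        then show ?thesis
          using g(3) unfolding eval \<mu>'(2) h.hom_mult eval_node_incr[OF g_polys] by simp
      qed
      moreover have "eval_at (node ?N r c \<nu>) (?u * g) = 0" if \<nu>: "\<nu> \<in> ?L" "\<nu> \<noteq> \<mu>" for \<nu>
      proof (cases "\<nu> ?N = 0")
        case True
        have "?N \<in> last_class ?N" "node ?N r c \<nu> ?N - c = 0"
          using True by (simp_all add: last_class_def rho_def)
        then have "(\<Prod>i\<in>last_class ?N. node ?N r c \<nu> i - c) = 0"
          by (intro prod_zero) (simp, blast)
        then show ?thesis unfolding eval by simp
      next
        case False
        then obtain \<nu>' where \<nu>': "\<nu>' \<in> Partitions ?N" "\<nu> = incr ?N \<nu>'"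
          using Partitions_incrE[of \<nu> ?N] \<nu> by blast
        have "odd_size ?N \<nu>' \<le> d - ?K"
          using \<nu>(1) incr_Partitions(2)[OF \<nu>'(1)] unfolding \<nu>'(2) mem_Collect_eq by linarith
        moreover have "\<nu>' \<noteq> \<mu>'" using \<nu>(2) \<nu>'(2) \<mu>'(2) by blast
        ultimately show ?thesis
          using g(4)[OF \<nu>'(1)] unfolding eval \<nu>'(2) eval_node_incr[OF g_polys] by simp
      qed
      ultimately show ?thesis by blast
    qed
    show ?case
    proof (cases "\<mu> ?N = 0")
      case False
      then show ?thesis using pos[of \<mu>] less.prems by blast
    next
      case True
      have \<mu>: "\<mu> \<in> Partitions n" using Partitions_Suc_zeroD[of \<mu> n] less.prems(1) True by simp
      moreover have "odd_size n \<mu> \<le> d" using less.prems(2) Partitions_Suc_zero(3)[OF \<mu>] by simp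
      ultimately obtain g where g: "g \<in> semisymmetric n" "deg_le (int d) g"
        "h (eval_at (node n r (c + r) \<mu>) g) \<noteq> 0"
        "\<And>\<nu>. \<nu> \<in> Partitions n \<Longrightarrow> odd_size n \<nu> \<le> d \<Longrightarrow> \<nu> \<noteq> \<mu> \<Longrightarrow> eval_at (node n r (c + r) \<nu>) g = 0"
        using IH_n[of \<mu> d "c + r"] by auto
      obtain G where G: "G \<in> semisymmetric ?N" "deg_le (int d) G" "substitute (Var(?N := Const c)) G = g"
        by (rule semisymmetric_lift[OF g(1,2)])
      have G_polys: "G \<in> polys ?N" using G(1) by (simp add: semisymmetric_def)
      have eval: "eval_at (node ?N r c \<nu>) G = eval_at (node n r (c + r) \<nu>) g" if "\<nu> ?N = 0" for \<nu>
        using eval_restrict_last[where \<mu> = \<nu> and r = r and c = c, OF G_polys that] unfolding G(3) by simp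
      let ?Q = "{\<nu> \<in> ?L. \<nu> ?N \<noteq> 0}"
      obtain f a where f: "f \<in> semisymmetric ?N" "deg_le (int d) f" "\<And>\<nu>. \<nu> \<in> ?Q \<Longrightarrow> eval_at (node ?N r c \<nu>) f = 0"
        and a: "h a \<noteq> 0" "\<And>\<nu>. \<nu> \<in> ?L - ?Q \<Longrightarrow> eval_at (node ?N r c \<nu>) f = a * eval_at (node ?N r c \<nu>) G"
      proof -
        have "finite ?Q" by (rule finite_subset[OF _ finite_bounded_partitions[of ?N d]]) blast
        from interpolation_correction[OF h this _ _ G(1,2), of ?L "node ?N r c"] pos
        show ?thesis using that by blast
      qed
      have "eval_at (node ?N r c \<nu>) f = 0" if \<nu>: "\<nu> \<in> ?L" "\<nu> \<noteq> \<mu>" for \<nu>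
      proof (cases "\<nu> ?N = 0")
        case True
        have "\<nu> \<in> Partitions n" using Partitions_Suc_zeroD[of \<nu> n] \<nu> True by simp
        then show ?thesis
          using \<nu> True a(2)[of \<nu>] g(4)[of \<nu>] Partitions_Suc_zero(3)[of \<nu> n] by (simp add: eval[of \<nu>])
      next
        case False
        then show ?thesis using f(3) \<nu> by blast
      qed
      moreover have "h (eval_at (node ?N r c \<mu>) f) \<noteq> 0"
        using a(1) a(2)[of \<mu>] True less.prems g(3) by (simp add: eval[of \<mu>] h.hom_mult)
      ultimately show ?thesis using f(1,2) by blast
    qed
  qed
qed

section \<open>The eigenvalue equation over a generic base ring\<close>

lemma vandermonde_product_nonzero:
  fixes r :: "'a::idom"
  assumes r: "\<And>m j. of_nat (Suc m) * r + of_nat j \<noteq> 0" and \<mu>: "\<mu> \<in> Partitions n"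
  shows "vandermonde_product n (\<lambda>i. rho n r i + of_nat (\<mu> i)) \<noteq> 0"
proof -
  have "rho n r i + of_nat (\<mu> i) - (rho n r j + of_nat (\<mu> j)) \<noteq> 0" if "(i, j) \<in> same_parity_pairs n" for i j
  proof -
    have ij: "1 \<le> i" "i < j" "j \<le> n" using that by (auto simp: same_parity_pairs_def)
    have le: "\<mu> j \<le> \<mu> i" by (rule Partitions_mono[OF \<mu>]) (use ij in auto)
    obtain m where m: "j = i + Suc m" using ij(2) less_iff_Suc_add by auto
    have "n - i = (n - j) + Suc m" using ij m by simp
    then have "rho n r i + of_nat (\<mu> i) - (rho n r j + of_nat (\<mu> j)) = of_nat (Suc m) * r + of_nat (\<mu> i - \<mu> j)"
      using le unfolding rho_def by (simp only: of_nat_add of_nat_diff) (simp add: algebra_simps)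
    with r show ?thesis by simp
  qed
  then show ?thesis
    unfolding vandermonde_product_def by (auto simp: prod_zero_iff)
qed

text \<open>
  By the cut-off property the value of \<open>det_op f\<close> at \<open>\<rho> + \<mu>\<close> only involves values of \<open>f\<close> at
  partitions \<open>\<nu>\<close> obtained by removing shifts. For these \<open>f\<close> vanishes unless \<open>\<nu> = l\<close>; in that
  case comparing sizes shows that only even variables were shifted, and the coefficient is 0.
\<close>

lemma eval_det_op:
  fixes r t :: "'a::{idom,ring_char_0}"
  assumes \<mu>: "\<mu> \<in> Partitions n" "odd_size n \<mu> \<le> odd_size n l"
    and f: "f \<in> polys n"
    and zero: "\<And>\<mu>. \<mu> \<in> Partitions n \<Longrightarrow> odd_size n \<mu> \<le> odd_size n l \<Longrightarrow> \<mu> \<noteq> l \<Longrightarrow>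
      eval_at (\<lambda>i. rho n r i + of_nat (\<mu> i)) f = 0"
  shows "eval_at (\<lambda>i. rho n r i + of_nat (\<mu> i)) (det_op e n r t f) =
    (\<Prod>i\<in>parity_class n e. rho n r i + of_nat (\<mu> i) + t) *
    vandermonde_product n (\<lambda>i. rho n r i + of_nat (\<mu> i)) *
    eval_at (\<lambda>i. rho n r i + of_nat (\<mu> i)) f"
proof -
  let ?z = "\<lambda>i. rho n r i + of_nat (\<mu> i)"
  let ?c = "\<lambda>S. leibniz n (coef_matrix e n r t S ?z)"
  have vanish: "?c S * eval_at (shifted n S ?z) f = 0" if S: "S \<in> Pow {1..n} - {{}}" for S
  proof (rule ccontr)
    assume "?c S * eval_at (shifted n S ?z) f \<noteq> 0"
    then have nz: "?c S \<noteq> 0" "eval_at (shifted n S ?z) f \<noteq> 0" by auto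
    have S': "S \<subseteq> {1..n}" "S \<noteq> {}" using S by auto
    obtain \<nu> where \<nu>: "\<nu> \<in> Partitions n" "\<And>i. \<mu> i = \<nu> i + (if i \<in> row_var n ` S then 1 else 0)"
      using coef_matrix_cutoff[OF \<mu>(1) S'(1) nz(1)] by blast
    have "shifted n S ?z = (\<lambda>i. rho n r i + of_nat (\<nu> i))"
      by (rule ext) (simp add: shifted_def \<nu>(2))
    with nz(2) have "eval_at (\<lambda>i. rho n r i + of_nat (\<nu> i)) f \<noteq> 0" by simp
    moreover have "odd_size n \<nu> \<le> odd_size n \<mu>"
      unfolding odd_size_def by (rule sum_mono) (simp add: \<nu>(2))
    ultimately have "\<nu> = l" using zero[OF \<nu>(1)] \<mu>(2) by fastforce
    have "nx n < a" if a: "a \<in> S" for a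
    proof (rule ccontr)
      assume "\<not> nx n < a"
      then have "odd (row_var n a)" using odd_row_var[of a n] a S'(1) by auto
      moreover have "row_var n a \<in> {1..n}" by (rule row_var_in) (use a S'(1) in blast)
      ultimately have "odd_size n \<nu> < odd_size n \<mu>"
        unfolding odd_size_def using a by (intro sum_strict_mono_ex1) (auto simp: \<nu>(2))
      with \<mu>(2) \<open>\<nu> = l\<close> show False by simp
    qed
    from coef_matrix_even_shifts[OF S' this] nz(1) show False by blast
  qed
  have "eval_at ?z (det_op e n r t f) = (\<Sum>S\<in>Pow {1..n}. ?c S * eval_at (shifted n S ?z) f)"
    using det_op_expansion[OF comm_ring_hom_ident] by (simp add: eval_at_def)
  also have "\<dots> = ?c {} * eval_at (shifted n {} ?z) f + (\<Sum>S\<in>Pow {1..n} - {{}}. ?c S * eval_at (shifted n S ?z) f)"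
    by (rule sum.remove) auto
  also have "(\<Sum>S\<in>Pow {1..n} - {{}}. ?c S * eval_at (shifted n S ?z) f) = 0"
    by (rule sum.neutral) (use vanish in blast)
  also have "shifted n {} ?z = ?z" by (simp add: shifted_def fun_eq_iff)
  finally show ?thesis by (simp add: coef_matrix_no_shift)
qed

text \<open>
  Both \<open>q = det_op f / \<phi>\<close> and the multiple of \<open>f\<close> by the eigenvalue are semisymmetric of degree
  at most \<open>|l|\<^sub>o\<^sub>d\<^sub>d\<close>, and they agree at all nodes since \<open>\<phi>\<close> does not vanish there.
\<close>

theorem det_op_eigenvector:
  fixes r t :: "'a::{idom,ring_char_0}"
  assumes r: "\<And>m j. of_nat m * r + of_nat (Suc j) \<noteq> 0" "\<And>m j. of_nat (Suc m) * r + of_nat j \<noteq> 0"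
    and f: "f \<in> semisymmetric n" "deg_le (int (odd_size n l)) f"
    and zero: "\<And>\<mu>. \<mu> \<in> Partitions n \<Longrightarrow> odd_size n \<mu> \<le> odd_size n l \<Longrightarrow> \<mu> \<noteq> l \<Longrightarrow>
      eval_at (\<lambda>i. rho n r i + of_nat (\<mu> i)) f = 0"
  shows "det_op e n r t f =
    varphi n * (Const (\<Prod>i\<in>parity_class n e. rho n r i + of_nat (l i) + t) * f)"
proof -
  let ?p = "\<lambda>\<mu>. \<Prod>i\<in>parity_class n e. rho n r i + of_nat (\<mu> i) + t"
  have f_polys: "f \<in> polys n" using f(1) by (simp add: semisymmetric_def)
  obtain q where q: "det_op e n r t f = varphi n * q" "q \<in> semisymmetric n" "deg_le (int (odd_size n l)) q"
    by (rule det_op_divisible[OF f])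
  have "q + Const (- ?p l) * f = 0"
  proof (rule interpolation_unique[OF r(1), where c = 0])
    show "q + Const (- ?p l) * f \<in> semisymmetric n"
      by (intro semisymmetric_add semisymmetric_Const_mult q f)
    show "deg_le (int (odd_size n l)) (q + Const (- ?p l) * f)"
      by (intro deg_le_add deg_le_Const_mult q f)
    fix \<mu>
    assume \<mu>: "\<mu> \<in> Partitions n" "odd_size n \<mu> \<le> odd_size n l"
    let ?z = "\<lambda>i. rho n r i + of_nat (\<mu> i)"
    interpret comm_ring_hom "eval_at ?z" by (rule eval_at_ring_hom)
    have "vandermonde_product n ?z * eval_at ?z q = eval_at ?z (det_op e n r t f)"
      unfolding q(1) hom_mult varphi_eq hom_vandermonde_product[OF eval_at_ring_hom] by simp
    also have "\<dots> = ?p \<mu> * vandermonde_product n ?z * eval_at ?z f"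
      by (rule eval_det_op[OF \<mu> f_polys zero])
    finally have "eval_at ?z q = ?p \<mu> * eval_at ?z f"
      using vandermonde_product_nonzero[OF r(2) \<mu>(1)] by simp
    moreover have "?p \<mu> * eval_at ?z f = ?p l * eval_at ?z f"
      using zero[OF \<mu>] by (cases "\<mu> = l") simp_all
    ultimately have "eval_at ?z (q + Const (- ?p l) * f) = 0"
      by (simp add: hom_add hom_mult)
    then show "eval_at (node n r 0 \<mu>) (q + Const (- ?p l) * f) = 0" by simp
  qed
  then have "q = Const (?p l) * f"
    by (simp add: Const_def single_uminus)
  then show ?thesis by (simp add: q(1))
qed

section \<open>Specialisation of the parameter\<close>

definition base_change :: "('a::comm_ring_1 \<Rightarrow> 'b::comm_ring_1) \<Rightarrow> 'a mpol \<Rightarrow> 'b mpol" where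
  "base_change h = subst_hom (\<lambda>a. Const (h a)) Var"

lemma Const_comp_hom: "comm_ring_hom h \<Longrightarrow> comm_ring_hom (\<lambda>a. Const (h a))"
  by (rule comm_ring_hom_comp[OF Const_hom])

lemma base_change_ring_hom: "comm_ring_hom h \<Longrightarrow> comm_ring_hom (base_change h)"
  unfolding base_change_def by (rule subst_hom_ring_hom[OF Const_comp_hom])

lemma subst_hom_base_change:
  assumes h: "comm_ring_hom h" and g: "comm_ring_hom g"
  shows "subst_hom g z (base_change h p) = subst_hom (\<lambda>a. g (h a)) z p"
  unfolding base_change_def
  by (subst hom_subst_hom[OF subst_hom_ring_hom[OF g] Const_comp_hom[OF h]])
    (simp add: subst_hom_Const subst_hom_Var comm_ring_hom_zero_one[OF g])

lemma substitute_base_change: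
  assumes h: "comm_ring_hom h"
  shows "substitute (\<lambda>i. base_change h (s i)) (base_change h p) = base_change h (substitute s p)"
proof -
  have "substitute (\<lambda>i. base_change h (s i)) (base_change h p) =
      subst_hom (\<lambda>a. Const (h a)) (\<lambda>i. base_change h (s i)) p"
    unfolding substitute_def by (rule subst_hom_base_change[OF h Const_hom])
  also have "\<dots> = base_change h (substitute s p)"
    unfolding substitute_def hom_subst_hom[OF base_change_ring_hom[OF h] Const_hom]
    by (simp add: base_change_def subst_hom_Const comm_ring_hom_zero_one[OF Const_comp_hom[OF h]])
  finally show ?thesis .
qed

lemma base_change_Var [simp]: "comm_ring_hom h \<Longrightarrow> base_change h (Var i) = Var i"
  unfolding base_change_def
  by (rule subst_hom_Var) (simp_all add: comm_ring_hom_zero_one[OF Const_comp_hom])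

lemma base_change_Const: "comm_ring_hom h \<Longrightarrow> base_change h (Const c) = Const (h c)"
  unfolding base_change_def
  by (rule subst_hom_Const) (simp add: comm_ring_hom_zero_one[OF Const_comp_hom])

lemma base_change_semisymmetric:
  assumes h: "comm_ring_hom h" and f: "f \<in> semisymmetric n"
  shows "base_change h f \<in> semisymmetric n"
proof -
  interpret h: comm_ring_hom "base_change h" by (rule base_change_ring_hom[OF h])
  have "base_change h f = base_change h (substitute (\<lambda>i. if i \<in> {1..n} then Var i else 0) f)"
    using f by (simp add: semisymmetric_def polys_iff_truncate)
  also have "\<dots> = substitute (\<lambda>i. base_change h (if i \<in> {1..n} then Var i else 0)) (base_change h f)"
    by (rule substitute_base_change[OF h, symmetric])
  also have "(\<lambda>i. base_change h (if i \<in> {1..n} then Var i else 0)) = (\<lambda>i. if i \<in> {1..n} then Var i else 0)"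
    by (simp add: fun_eq_iff h)
  finally have "base_change h f \<in> polys n" by (simp add: polys_iff_truncate)
  moreover have "substitute (\<lambda>i. Var (\<pi> i)) (base_change h f) = base_change h f"
    if "\<pi> \<in> semisym_group n" for \<pi>
    using substitute_base_change[OF h, of "\<lambda>i. Var (\<pi> i)" f] f that
    by (simp add: semisymmetric_def h)
  ultimately show ?thesis by (simp add: semisymmetric_def)
qed

lemma deg_le_base_change:
  assumes h: "comm_ring_hom h" and f: "deg_le d f"
  shows "deg_le d (base_change h f)"
proof -
  interpret h: comm_ring_hom "base_change h" by (rule base_change_ring_hom[OF h])
  have "deg_le (d + 0) (base_change h f)"
  proof (rule deg_le_monomial_map[OF f])
    fix m c
    have "base_change h (Poly_Mapping.single m c) = Poly_Mapping.single m (h c)"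
      using substitute_Var_ident[of "Poly_Mapping.single m (h c)"]
      by (simp add: base_change_def substitute_def subst_hom_single comm_ring_hom_zero_one[OF h]
          comm_ring_hom_zero_one[OF Const_hom] del: substitute_Var_ident)
    then show "deg_le (int (mdegree m) + 0) (base_change h (Poly_Mapping.single m c))"
      by (simp add: deg_le_def)
  qed (simp_all add: h.hom_add)
  then show ?thesis by simp
qed

lemma det_op_base_change:
  assumes h: "comm_ring_hom h"
  shows "base_change h (det_op e n r t f) = det_op e n (h r) (h t) (base_change h f)"
proof -
  have "det_op e n (h r) (h t) (base_change h f) =
      subst_hom Const Var (det_op e n (h r) (h t) (base_change h f))"
    using substitute_Var_ident[of "det_op e n (h r) (h t) (base_change h f)"] by (simp add: substitute_def)
  also have "\<dots> = base_change h (det_op e n r t f)"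
    unfolding base_change_def[of h, THEN fun_cong, of "det_op e n r t f"]
      det_op_expansion[OF Const_hom] det_op_expansion[OF Const_comp_hom[OF h]]
      subst_hom_base_change[OF h Const_hom] ..
  finally show ?thesis by simp
qed

lemma det_op_Const_mult:
  "det_op e n r t (Const c * f) = Const c * det_op e n r t (f :: 'a::comm_ring_1 mpol)"
proof -
  have id: "p = subst_hom Const Var p" for p :: "'a mpol"
    using substitute_Var_ident[of p] by (simp add: substitute_def)
  have C: "subst_hom Const z (Const c * f) = Const c * subst_hom Const z f" for z
  proof -
    interpret comm_ring_hom "subst_hom Const z :: 'a mpol \<Rightarrow> 'a mpol" by (rule subst_hom_ring_hom[OF Const_hom])
    show ?thesis by (simp add: hom_mult subst_hom_Const comm_ring_hom_zero_one[OF Const_hom])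
  qed
  have "subst_hom Const Var (det_op e n r t (Const c * f)) = Const c * subst_hom Const Var (det_op e n r t f)"
    unfolding det_op_expansion[OF Const_hom] C sum_distrib_left by (simp only: mult.left_commute)
  then show ?thesis by (simp only: id[symmetric])
qed

lemma smult_inverse_to_frac:
  fixes \<phi> :: "'k::field mpol"
  assumes "\<phi> \<noteq> 0"
  shows "Polynomial.smult (inverse (Fract \<phi> 1)) (to_frac (Polynomial.smult \<phi> F)) = to_frac F"
proof (rule poly_eqI)
  fix i
  have "inverse (Fract \<phi> 1) * Fract (\<phi> * coeff F i) 1 = Fract (coeff F i) 1"
    using assms by (simp add: eq_fract)
  then show "coeff (Polynomial.smult (inverse (Fract \<phi> 1)) (to_frac (Polynomial.smult \<phi> F))) i = coeff (to_frac F) i"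
    by (simp add: to_frac_def coeff_map_poly Zero_fract_def)
qed

lemma mpol_poly_eqI:
  fixes P Q :: "'k::field_char_0 mpol poly"
  assumes "\<And>c. poly P (Const c) = poly Q (Const c)"
  shows "P = Q"
proof (rule ccontr)
  assume "P \<noteq> Q"
  then have "finite {x. poly (P - Q) x = 0}" by (intro poly_roots_finite) simp
  moreover have "range Const \<subseteq> {x. poly (P - Q) x = 0}" using assms by auto
  ultimately have "finite (range (Const :: 'k \<Rightarrow> 'k mpol))" by (rule finite_subset[rotated])
  moreover have "inj (Const :: 'k \<Rightarrow> 'k mpol)"
    by (rule injI) (metis eval_at_Const)
  ultimately show False using infinite_UNIV_char_0 finite_imageD by blast
qed

lemma hom_rho: "comm_ring_hom h \<Longrightarrow> h (rho n r i) = rho n (h r) i"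
proof -
  assume "comm_ring_hom h"
  then interpret comm_ring_hom h .
  show ?thesis by (simp add: rho_def hom_mult hom_of_nat)
qed

text \<open>
  For \<open>r = 0\<close> the polynomial \<open>\<phi>\<close> vanishes at the nodes of partitions with equal entries in two
  positions of the same parity, and its value cannot be cancelled. So the parameter is an indeterminate \<open>s\<close> first: the
  interpolation polynomial over \<open>k[s]\<close> is an eigenvector, hence so is its specialisation at
  \<open>s = r\<close>, of which \<open>R\<close> is a multiple.
\<close>

lemma det_op_interpolation_polynomial:
  fixes r t :: "'k::field_char_0" and R :: "'k mpol"
  assumes r: "\<forall>q::rat. q < 0 \<longrightarrow> r \<noteq> of_rat q" and l: "l \<in> Partitions n" and R: "is_R n r l R"
  shows "det_op e n r t R =
    varphi n * (Const (\<Prod>i\<in>parity_class n e. rho n r i + of_nat (l i) + t) * R)"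
proof -
  let ?d = "odd_size n l"
  let ?z = "\<lambda>r \<nu> i. rho n r i + of_nat (\<nu> i)"
  let ?s = "[:0, 1:] :: 'k poly"
  define h where "h p = poly p r" for p :: "'k poly"
  have h: "comm_ring_hom h" unfolding h_def[abs_def] by (rule poly_eval_hom)
  interpret h: comm_ring_hom h by (rule h)
  have hs: "h ?s = r" "h [:t:] = t" by (simp_all add: h_def)
  have r': "of_nat m * r + of_nat (Suc j) \<noteq> 0" for m j
  proof
    assume *: "of_nat m * r + of_nat (Suc j) = 0"
    then have "m \<noteq> 0" by (metis add_0 mult_zero_left of_nat_0 of_nat_eq_0_iff nat.distinct(2))
    have "r * of_nat m = - of_nat (Suc j)"
      using * by (simp only: mult.commute[of r] eq_neg_iff_add_eq_0)
    then have "r = - of_nat (Suc j) / of_nat m"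
      using \<open>m \<noteq> 0\<close> by (simp add: field_simps)
    then have "r = of_rat (- of_nat (Suc j) / of_nat m)"
      by (simp only: of_rat_divide of_rat_minus of_rat_of_nat_eq)
    moreover have "- of_nat (Suc j) / of_nat m < (0::rat)" using \<open>m \<noteq> 0\<close> by (simp add: divide_neg_pos)
    ultimately show False using r by blast
  qed
  \<comment> \<open>the indeterminate \<open>s\<close> satisfies no relation with natural coefficients: put \<open>s = 1\<close>\<close>
  have s1: "of_nat m * ?s + of_nat (Suc j) \<noteq> 0" and s2: "of_nat (Suc m) * ?s + of_nat j \<noteq> 0" for m j
  proof -
    have "poly (of_nat m * ?s + of_nat (Suc j)) 1 = of_nat (m + Suc j)"
      "poly (of_nat (Suc m) * ?s + of_nat j) 1 = of_nat (Suc m + j)" by simp_all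
    then show "of_nat m * ?s + of_nat (Suc j) \<noteq> 0" "of_nat (Suc m) * ?s + of_nat j \<noteq> 0"
      by (metis of_nat_eq_0_iff poly_0 add_Suc_right nat.distinct(2), metis of_nat_eq_0_iff poly_0 add_Suc nat.distinct(2))
  qed
  obtain f where f: "f \<in> semisymmetric n" "deg_le (int ?d) f"
    "h (eval_at (?z ?s l) f) \<noteq> 0"
    "\<And>\<nu>. \<nu> \<in> Partitions n \<Longrightarrow> odd_size n \<nu> \<le> ?d \<Longrightarrow> \<nu> \<noteq> l \<Longrightarrow> eval_at (?z ?s \<nu>) f = 0"
  proof -
    have "h (of_nat m * ?s + of_nat (Suc j)) \<noteq> 0" for m j
      using r'[of m j] by (simp only: h.hom_add h.hom_mult h.hom_of_nat hs not_False_eq_True)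
    from interpolation_exists[OF h this l order_refl, of 0] show ?thesis
      unfolding add_0 using that by blast
  qed
  define g where "g = base_change h f"
  have "det_op e n ?s [:t:] f =
      varphi n * (Const (\<Prod>i\<in>parity_class n e. rho n ?s i + of_nat (l i) + [:t:]) * f)"
    by (rule det_op_eigenvector[OF s1 s2 f(1,2)]) (rule f(4))
  from arg_cong[OF this, of "base_change h"]
  have Dg: "det_op e n r t g = varphi n * (Const (\<Prod>i\<in>parity_class n e. rho n r i + of_nat (l i) + t) * g)"
  proof -
    interpret b: comm_ring_hom "base_change h" by (rule base_change_ring_hom[OF h])
    have "base_change h (varphi n) = varphi n"
      unfolding varphi_eq hom_vandermonde_product[OF base_change_ring_hom[OF h]] by (simp add: h)
    moreover have "h (\<Prod>i\<in>parity_class n e. rho n ?s i + of_nat (l i) + [:t:]) =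
        (\<Prod>i\<in>parity_class n e. rho n r i + of_nat (l i) + t)"
      by (simp only: h.hom_prod h.hom_add hom_rho[OF h] h.hom_of_nat hs)
    moreover assume "base_change h (det_op e n ?s [:t:] f) = base_change h (varphi n *
      (Const (\<Prod>i\<in>parity_class n e. rho n ?s i + of_nat (l i) + [:t:]) * f))"
    ultimately show ?thesis
      by (simp only: det_op_base_change[OF h] hs b.hom_mult base_change_Const[OF h] g_def)
  qed
  have eval_g: "eval_at (?z r \<nu>) g = h (eval_at (?z ?s \<nu>) f)" for \<nu>
  proof -
    have "h (eval_at (?z ?s \<nu>) f) = subst_hom h (\<lambda>i. h (?z ?s \<nu> i)) f"
      unfolding eval_at_def by (rule hom_subst_hom[OF h comm_ring_hom_ident])
    also have "(\<lambda>i. h (?z ?s \<nu> i)) = ?z r \<nu>"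
      by (simp only: h.hom_add hom_rho[OF h] h.hom_of_nat hs)
    also have "subst_hom h (?z r \<nu>) f = eval_at (?z r \<nu>) g"
      unfolding eval_at_def g_def by (rule subst_hom_base_change[OF h comm_ring_hom_ident, symmetric])
    finally show ?thesis by simp
  qed
  have g: "g \<in> semisymmetric n" "deg_le (int ?d) g"
    unfolding g_def by (rule base_change_semisymmetric[OF h f(1)], rule deg_le_base_change[OF h f(2)])
  have R': "R \<in> semisymmetric n" "deg_le (int ?d) R"
    "\<And>\<nu>. \<nu> \<in> Partitions n \<Longrightarrow> odd_size n \<nu> \<le> ?d \<Longrightarrow> \<nu> \<noteq> l \<Longrightarrow> eval_at (?z r \<nu>) R = 0"
    using R by (simp_all add: is_R_def deg_le_total_degree)
  define a where "a = eval_at (?z r l) R"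
  define b where "b = eval_at (?z r l) g"
  have b: "b \<noteq> 0" using f(3) by (simp only: b_def eval_g not_False_eq_True)
  have "R + Const (- (a / b)) * g = 0"
  proof (rule interpolation_unique[OF r', where c = 0])
    show "R + Const (- (a / b)) * g \<in> semisymmetric n"
      by (intro semisymmetric_add semisymmetric_Const_mult g R')
    show "deg_le (int ?d) (R + Const (- (a / b)) * g)"
      by (intro deg_le_add deg_le_Const_mult g R')
    fix \<nu>
    assume \<nu>: "\<nu> \<in> Partitions n" "odd_size n \<nu> \<le> ?d"
    interpret E: comm_ring_hom "eval_at (?z r \<nu>)" by (rule eval_at_ring_hom)
    have "eval_at (?z r \<nu>) (R + Const (- (a / b)) * g) = eval_at (?z r \<nu>) R - a / b * eval_at (?z r \<nu>) g"
      by (simp only: E.hom_add E.hom_mult eval_at_Const) simp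
    also have "\<dots> = 0"
    proof (cases "\<nu> = l")
      case True
      then show ?thesis using b by (simp add: a_def[symmetric] b_def[symmetric])
    next
      case False
      then show ?thesis
        using R'(3)[OF \<nu>] f(4)[OF \<nu>] eval_g[of \<nu>] by simp
    qed
    finally show "eval_at (node n r 0 \<nu>) (R + Const (- (a / b)) * g) = 0" unfolding add_0 .
  qed
  then have Rg: "R = Const (a / b) * g" by (simp add: Const_def single_uminus)
  show ?thesis
    unfolding Rg by (simp only: det_op_Const_mult Dg mult.left_commute)
qed

theorem theorem4p5:
  fixes n :: nat and r :: "'k::field_char_0" and l :: "nat \<Rightarrow> nat" and R :: "'k mpol"
  assumes "n \<ge> 1"
    and "\<forall>q::rat. q < 0 \<longrightarrow> r \<noteq> of_rat q"
    and "l \<in> Partitions n"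
    and "is_R n r l R"
  shows "R \<noteq> 0 \<and>
    opX n r R =
      to_frac ((\<Prod>i\<in>{i\<in>{1..n}. odd i}. [:Const (rho n r i + of_nat (l i)), 1:]) * [:R:]) \<and>
    opY n r R =
      to_frac ((\<Prod>i\<in>{i\<in>{1..n}. even i}. [:Const (rho n r i + of_nat (l i)), 1:]) * [:R:])"
proof -
  have "R \<noteq> 0" using assms(4) by (auto simp: is_R_def)
  have eigen: "poly (Polynomial.smult (varphi n) ((\<Prod>i\<in>parity_class n e. [:Const (rho n r i + of_nat (l i)), 1:]) * [:R:])) (Const c)
      = det_op e n r c R" for e c
  proof -
    interpret comm_ring_hom "Const :: 'k \<Rightarrow> 'k mpol" by (rule Const_hom)
    show ?thesis
      unfolding det_op_interpolation_polynomial[OF assms(2-4)] by (simp add: poly_prod hom_prod hom_add mult_ac)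
  qed
  have "op_det n (matX n r) [:R:] =
      Polynomial.smult (varphi n) ((\<Prod>i\<in>{i\<in>{1..n}. odd i}. [:Const (rho n r i + of_nat (l i)), 1:]) * [:R:])"
    by (rule mpol_poly_eqI) (use eigen[of True] in \<open>simp add: poly_det_matX\<close>)
  then have X: "opX n r R = to_frac ((\<Prod>i\<in>{i\<in>{1..n}. odd i}. [:Const (rho n r i + of_nat (l i)), 1:]) * [:R:])"
    unfolding opX_def by (simp only: smult_inverse_to_frac[OF varphi_nonzero])
  have "op_det n (matY n r) [:R:] =
      Polynomial.smult (varphi n) ((\<Prod>i\<in>{i\<in>{1..n}. even i}. [:Const (rho n r i + of_nat (l i)), 1:]) * [:R:])"
    by (rule mpol_poly_eqI) (use eigen[of False] in \<open>simp add: poly_det_matY\<close>)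
  then have Y: "opY n r R = to_frac ((\<Prod>i\<in>{i\<in>{1..n}. even i}. [:Const (rho n r i + of_nat (l i)), 1:]) * [:R:])"
    unfolding opY_def by (simp only: smult_inverse_to_frac[OF varphi_nonzero])
  from X Y \<open>R \<noteq> 0\<close> show ?thesis by blast
qed

end
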